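(* The set of Lagrange multipliers $\hat\Lambda_L(\bar y,\bar v)$ associated with $(\bar y,\bar v)$ and problem $(\mathrm{P})$ is non-empty.
   Context: **Time crisis problem and standing assumptions.** Fix $T>0$, positive integers $n,m,l$ and $x_0\in\mathbb{R}^n$; $|\cdot|$ is the Euclidean norm. $U\subset\mathbb{R}^m$ is non-empty and closed; $f:\mathbb{R}^n\times\mathbb{R}^m\to\mathbb{R}^n$ is of class $C^2$; there are $c_1,c_2>0$ with $|f(x,u)|\le c_1|x|+c_2$ for all $x\in\mathbb{R}^n$, $u\in U$; for every $x$ the set $\{f(x,u):u\in U\}$ is non-empty, compact and convex; $\phi:\mathbb{R}^n\to\mathbb{R}$ is of class $C^2$; $K\subset\mathbb{R}^n$ is closed with non-empty interior, $K^c$ is its complement and $\mathds{1}_{K^c}$ the indicator function of $K^c$ (value $1$ on $K^c$, $0$ on $K$). Let $\mathcal{U}$ be the set of measurable $u:[0,T]\to U$ and, for $u\in\mathcal{U}$, let $x_u$ be the unique solution on $[0,T]$ of $\dot x=f(x,u)$, $x(0)=x_0$. The time crisis problem is to minimize over $u\in\mathcal{U}$ the cost $J_T(u)=\phi(x_u(T))+\int_0^T\mathds{1}_{K^c}(x_u(t))\,dt$. Fix a global minimizer $\bar u\in\mathcal{U}$ and set $\bar x=x_{\bar u}$. It is assumed that: - There is $c:\mathbb{R}^m\to\mathbb{R}^l$ of class $C^2$ with $U=\{u: c_i(u)\le 0,\ 1\le i\le l\}$, and there are $\varepsilon,\delta>0$ such that, with $I(t)=\{i: c_i(\bar u(t))\ge-\delta\}$,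 one has $\varepsilon|\xi|\le\big|\sum_{i\in I(t)}\xi_i\nabla c_i(\bar u(t))\big|$ for all $\xi\in\mathbb{R}^{I(t)}$, for a.e. $t\in(0,T)$. - There is $g:\mathbb{R}^n\to\mathbb{R}$ of class $C^1$ with $K=\{x: g(x)\le 0\}$. - $\bar x$ has exactly one crossing time $\bar\tau\in(0,T)$; it is a transverse crossing time from $K$ to $K^c$: there is $\eta>0$ with $\bar x(t)\in K$ for $t\in(\bar\tau-\eta,\bar\tau]$ and $\bar x(t)\in K^c$ for $t\in(\bar\tau,\bar\tau+\eta)$; $\bar u$ is left- and right-continuous at $\bar\tau$ (one-sided limits $\bar u(\bar\tau^\pm)$ exist); and $\dot{\bar x}(\bar\tau^\pm)\cdot\nabla g(\bar x(\bar\tau))\ne0$, where $\dot{\bar x}(\bar\tau^\pm)=f(\bar x(\bar\tau),\bar u(\bar\tau^\pm))$. Moreover $g(\bar x(t))\neq0$ for all $t\in[0,T]\setminus\{\bar\tau\}$ (so $x_0\in\mathrm{Int}(K)$). **Time change.** For $\tau\in(0,T)$, $\pi_\tau:[0,2]\to[0,T]$ is $\pi_\tau(s)=\tau s$ for $s\in[0,1]$ and $\pi_\tau(s)=(T-\tau)s+2\tau-T$ for $s\in[1,2]$. Set $\tilde u=\bar u\circ\pi_{\bar\tau}$, $\tilde x=\bar x\circ\pi_{\bar\tau}$. **Problem $(\mathrm{P})$.** Write $y=(y^{(1)},y^{(2)},\xi)\in\mathbb{R}^{n}\times\mathbb{R}^n\times\mathbb{R}$, $v=(v^{(1)},v^{(2)})\in\mathbb{R}^m\times\mathbb{R}^m$,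 and $$F(y,v)=\big(\xi f(y^{(1)},v^{(1)}),\ (T-\xi)f(y^{(2)},v^{(2)}),\ 0\big),\qquad G(y_0,y_1)=\big(y_0^{(1)},\ \xi_0,\ y_0^{(2)}-y_1^{(1)},\ g(y_1^{(1)})\big)\in\mathbb{R}^{2n+2},$$ $C=\{x_0\}\times(0,T)\times\{0_{\mathbb{R}^n}\}\times\{0\}$, $\psi(y)=\phi(y^{(2)})+T-\xi$. $\mathcal{T}$ is the set of pairs $(y,v)$ with $v:[0,1]\to U\times U$ measurable and $y$ a solution of $\frac{dy}{ds}(s)=F(y(s),v(s))$ on $[0,1]$. Problem $(\mathrm{P})$ is: minimize $\psi(y(1))$ over $(y,v)\in\mathcal{T}$ subject to $G(y(0),y(1))\in C$. The reference pair is $\bar y(s)=(\tilde x(s),\tilde x(s+1),\bar\tau)$, $\bar v(s)=(\tilde u(s),\tilde u(s+1))$, $s\in[0,1]$; it is a weak minimum of $(\mathrm{P})$, i.e. $(\bar y,\bar v)\in\mathcal T$, $G(\bar y(0),\bar y(1))\in C$, and there is $\varepsilon>0$ such that $\psi(\bar y(1))\le\psi(y(1))$ for all $(y,v)\in\mathcal T$ with $G(y(0),y(1))\in C$, $|y(0)-\bar y(0)|\le\varepsilon$, $\|v-\bar v\|_{L^\infty(0,1;\mathbb{R}^{2m})}\le\varepsilon$. **Lagrange multipliers of $(\mathrm{P})$.** Let $\hat H(y,q,v)=q\cdot F(y,v)$ for $q=(p^{(1)},p^{(2)},\lambda)\in\mathbb{R}^{2n+1}$ and $\hat H^a(y,q,v,\mu)=\hat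 H(y,q,v)+\mu^{(1)}\cdot c(v^{(1)})+\mu^{(2)}\cdot c(v^{(2)})$ for $\mu=(\mu^{(1)},\mu^{(2)})\in\mathbb{R}^{2l}$. $\hat\Lambda_L(\bar y,\bar v)$ is the set of non-zero triplets $(\alpha,\beta,\mu)\in[0,\infty)\times\mathbb{R}^{2n+2}\times L^\infty(0,1;\mathbb{R}^{2l})$, $\beta=(\beta_1,\beta_2,\beta_3,\beta_4)\in\mathbb{R}^{n}\times\mathbb{R}\times\mathbb{R}^n\times\mathbb{R}$, such that: - $\beta_2=0$, and for a.e. $s\in[0,1]$, $\mu(s)\ge0$ and $\mu^{(1)}(s)\cdot c(\bar v^{(1)}(s))+\mu^{(2)}(s)\cdot c(\bar v^{(2)}(s))=0$; - there is an absolutely continuous $q:[0,1]\to\mathbb{R}^{2n+1}$ with $\frac{dq}{ds}(s)=-\nabla_y\hat H(\bar y(s),q(s),\bar v(s))$ for a.e. $s$, $-q(0)=\nabla_{y_0}G(\bar y(0),\bar y(1))\beta$ and $q(1)=\nabla_{y_1}G(\bar y(0),\bar y(1))\beta+\alpha\nabla\psi(\bar y(1))$, where $\nabla_{y_i}G$ denotes the transpose of the partial Jacobian of $G$ with respect to $y_i$; - $\nabla_v\hat H^a(\bar y(s),q(s),\bar v(s),\mu(s))=0$ for a.e. $s\in[0,1]$.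
   Formalization: The fixed minimizer ū is additionally assumed essentially bounded on [0,T]; for merely measurable ū with unbounded U the statement can fail, because the costate equation may have no non-zero absolutely continuous solution. *)

theory Defs
  imports "HOL-Analysis.Analysis" "HOL-Probability.Essential_Supremum"
begin

definition C1_fun :: "('a::real_normed_vector \<Rightarrow> 'b::real_normed_vector) \<Rightarrow> bool" where
  "C1_fun f \<longleftrightarrow> (\<exists>f' :: 'a \<Rightarrow> 'a \<Rightarrow>\<^sub>L 'b.
     (\<forall>x. (f has_derivative blinfun_apply (f' x)) (at x)) \<and> continuous_on UNIV f')"

definition C2_fun :: "('a::real_normed_vector \<Rightarrow> 'b::real_normed_vector) \<Rightarrow> bool" where
  "C2_fun f \<longleftrightarrow> (\<exists>f' :: 'a \<Rightarrow> 'a \<Rightarrow>\<^sub>L 'b.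
     (\<forall>x. (f has_derivative blinfun_apply (f' x)) (at x)) \<and> C1_fun f')"

definition grad :: "('a::real_inner \<Rightarrow> real) \<Rightarrow> 'a \<Rightarrow> 'a" where
  "grad h x = (THE D. GDERIV h x :> D)"

definition transposed_jacobian ::
    "('a::euclidean_space \<Rightarrow> 'b::euclidean_space) \<Rightarrow> 'a \<Rightarrow> 'b \<Rightarrow> 'a" where
  "transposed_jacobian h x = adjoint (frechet_derivative h (at x))"

(* The epsilon-delta definition of absolute continuity on [a,b]. The elements k of a division are
   non-overlapping compact intervals [Inf k, Sup k], whose union need not be all of [a,b]. *)
definition abs_continuous :: "real \<Rightarrow> real \<Rightarrow> (real \<Rightarrow> 'a::real_normed_vector) \<Rightarrow> bool" where
  "abs_continuous a b x \<longleftrightarrow>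
     (\<forall>\<epsilon>>0. \<exists>\<delta>>0. \<forall>d S. d division_of S \<and> S \<subseteq> {a..b} \<and> (\<Sum>k\<in>d. Sup k - Inf k) < \<delta> \<longrightarrow>
        (\<Sum>k\<in>d. norm (x (Sup k) - x (Inf k))) < \<epsilon>)"

definition ode_solution ::
    "real \<Rightarrow> real \<Rightarrow> (real \<Rightarrow> 'a \<Rightarrow> 'a) \<Rightarrow> (real \<Rightarrow> 'a::real_normed_vector) \<Rightarrow> bool" where
  "ode_solution a b rhs x \<longleftrightarrow> abs_continuous a b x \<and>
     (AE t in lebesgue_on {a..b}. (x has_vector_derivative rhs t (x t)) (at t within {a..b}))"

definition Linf_norm :: "real \<Rightarrow> real \<Rightarrow> (real \<Rightarrow> 'a::real_normed_vector) \<Rightarrow> ereal" where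
  "Linf_norm a b h = esssup (lebesgue_on {a..b}) (\<lambda>t. ereal (norm (h t)))"

definition Linf :: "real \<Rightarrow> real \<Rightarrow> (real \<Rightarrow> 'a::real_normed_vector) set" where
  "Linf a b = {h \<in> borel_measurable (lebesgue_on {a..b}). Linf_norm a b h < \<infinity>}"

definition controls :: "real \<Rightarrow> real \<Rightarrow> 'a set \<Rightarrow> (real \<Rightarrow> 'a::topological_space) set" where
  "controls a b U = {u \<in> borel_measurable (lebesgue_on {a..b}). \<forall>t\<in>{a..b}. u t \<in> U}"

(* x is a state x_u of the control u. The solution operator is rendered as a relation: minimality
   below compares with every solution generated by a competing control. *)
definition state_of ::
    "(real^'n \<Rightarrow> real^'m \<Rightarrow> real^'n) \<Rightarrow> real \<Rightarrow> real^'n \<Rightarrow> (real \<Rightarrow> real^'m) \<Rightarrow> (real \<Rightarrow> real^'n) \<Rightarrow> bool"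
  where
  "state_of f T x0 u x \<longleftrightarrow> x 0 = x0 \<and> ode_solution 0 T (\<lambda>t z. f z (u t)) x"

definition time_crisis_cost ::
    "(real^'n \<Rightarrow> real) \<Rightarrow> (real^'n) set \<Rightarrow> real \<Rightarrow> (real \<Rightarrow> real^'n) \<Rightarrow> real" where
  "time_crisis_cost \<phi> K T x = \<phi> (x T) + (LINT t|lebesgue_on {0..T}. indicat_real (- K) (x t))"

definition global_minimizer ::
    "(real^'n \<Rightarrow> real^'m \<Rightarrow> real^'n) \<Rightarrow> (real^'n \<Rightarrow> real) \<Rightarrow> (real^'n) set \<Rightarrow> (real^'m) set \<Rightarrow> real \<Rightarrow>
     real^'n \<Rightarrow> (real \<Rightarrow> real^'m) \<Rightarrow> (real \<Rightarrow> real^'n) \<Rightarrow> bool" where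
  "global_minimizer f \<phi> K U T x0 ubar xbar \<longleftrightarrow>
     ubar \<in> controls 0 T U \<and> state_of f T x0 ubar xbar \<and>
     (\<forall>u\<in>controls 0 T U. \<forall>x. state_of f T x0 u x \<longrightarrow>
        time_crisis_cost \<phi> K T xbar \<le> time_crisis_cost \<phi> K T x)"

definition exit_crossing :: "'a set \<Rightarrow> (real \<Rightarrow> 'a) \<Rightarrow> real \<Rightarrow> bool" where
  "exit_crossing K x \<tau> \<longleftrightarrow>
     (\<exists>\<eta>>0. (\<forall>t\<in>{\<tau>-\<eta><..\<tau>}. x t \<in> K) \<and> (\<forall>t\<in>{\<tau><..<\<tau>+\<eta>}. x t \<notin> K))"

definition entry_crossing :: "'a set \<Rightarrow> (real \<Rightarrow> 'a) \<Rightarrow> real \<Rightarrow> bool" where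
  "entry_crossing K x \<tau> \<longleftrightarrow>
     (\<exists>\<eta>>0. (\<forall>t\<in>{\<tau>-\<eta><..<\<tau>}. x t \<notin> K) \<and> (\<forall>t\<in>{\<tau>..<\<tau>+\<eta>}. x t \<in> K))"

definition crossing_time :: "'a set \<Rightarrow> (real \<Rightarrow> 'a) \<Rightarrow> real \<Rightarrow> bool" where
  "crossing_time K x \<tau> \<longleftrightarrow> exit_crossing K x \<tau> \<or> entry_crossing K x \<tau>"

definition transverse_exit_crossing ::
    "(real^'n \<Rightarrow> real^'m \<Rightarrow> real^'n) \<Rightarrow> (real^'n \<Rightarrow> real) \<Rightarrow> (real^'n) set \<Rightarrow>
     (real \<Rightarrow> real^'m) \<Rightarrow> (real \<Rightarrow> real^'n) \<Rightarrow> real \<Rightarrow> bool" where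
  "transverse_exit_crossing f g K u x \<tau> \<longleftrightarrow> exit_crossing K x \<tau> \<and>
     (\<exists>ul ur. (u \<longlongrightarrow> ul) (at_left \<tau>) \<and> (u \<longlongrightarrow> ur) (at_right \<tau>) \<and>
        f (x \<tau>) ul \<bullet> grad g (x \<tau>) \<noteq> 0 \<and> f (x \<tau>) ur \<bullet> grad g (x \<tau>) \<noteq> 0)"

definition time_change :: "real \<Rightarrow> real \<Rightarrow> real \<Rightarrow> real" where
  "time_change T \<tau> s = (if s \<le> 1 then \<tau> * s else (T - \<tau>) * s + 2 * \<tau> - T)"

type_synonym 'n pstate = "(real^'n) \<times> (real^'n) \<times> real"
type_synonym 'm pcontrol = "(real^'m) \<times> (real^'m)"
type_synonym 'n pconstr = "(real^'n) \<times> real \<times> (real^'n) \<times> real"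

definition P_dyn ::
    "(real^'n \<Rightarrow> real^'m \<Rightarrow> real^'n) \<Rightarrow> real \<Rightarrow> 'n pstate \<Rightarrow> 'm pcontrol \<Rightarrow> 'n pstate" where
  "P_dyn f T = (\<lambda>(y1, y2, \<xi>) (v1, v2). (\<xi> *\<^sub>R f y1 v1, (T - \<xi>) *\<^sub>R f y2 v2, 0))"

definition P_constr :: "(real^'n \<Rightarrow> real) \<Rightarrow> 'n pstate \<Rightarrow> 'n pstate \<Rightarrow> 'n pconstr" where
  "P_constr g = (\<lambda>(a1, a2, \<xi>0) (b1, b2, \<xi>1). (a1, \<xi>0, a2 - b1, g b1))"

definition P_target :: "real \<Rightarrow> real^'n \<Rightarrow> 'n pconstr set" where
  "P_target T x0 = {x0} \<times> {0<..<T} \<times> {0} \<times> {0}"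

definition P_cost :: "(real^'n \<Rightarrow> real) \<Rightarrow> real \<Rightarrow> 'n pstate \<Rightarrow> real" where
  "P_cost \<phi> T = (\<lambda>(y1, y2, \<xi>). \<phi> y2 + T - \<xi>)"

definition P_traj ::
    "(real^'n \<Rightarrow> real^'m \<Rightarrow> real^'n) \<Rightarrow> (real^'m) set \<Rightarrow> real \<Rightarrow>
     ((real \<Rightarrow> 'n pstate) \<times> (real \<Rightarrow> 'm pcontrol)) set" where
  "P_traj f U T = {(y, v). v \<in> controls 0 1 (U \<times> U) \<and>
     ode_solution 0 1 (\<lambda>s z. P_dyn f T z (v s)) y}"

definition P_ref_state ::
    "real \<Rightarrow> real \<Rightarrow> (real \<Rightarrow> real^'n) \<Rightarrow> real \<Rightarrow> 'n pstate" where
  "P_ref_state T \<tau> x s = (x (time_change T \<tau> s), x (time_change T \<tau> (s + 1)), \<tau>)"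

definition P_ref_control ::
    "real \<Rightarrow> real \<Rightarrow> (real \<Rightarrow> real^'m) \<Rightarrow> real \<Rightarrow> 'm pcontrol" where
  "P_ref_control T \<tau> u s = (u (time_change T \<tau> s), u (time_change T \<tau> (s + 1)))"

definition weak_minimum ::
    "(real^'n \<Rightarrow> real^'m \<Rightarrow> real^'n) \<Rightarrow> (real^'n \<Rightarrow> real) \<Rightarrow> (real^'n \<Rightarrow> real) \<Rightarrow> (real^'m) set \<Rightarrow> real \<Rightarrow>
     real^'n \<Rightarrow> (real \<Rightarrow> 'n pstate) \<Rightarrow> (real \<Rightarrow> 'm pcontrol) \<Rightarrow> bool" where
  "weak_minimum f g \<phi> U T x0 ybar vbar \<longleftrightarrow>
     (ybar, vbar) \<in> P_traj f U T \<and> P_constr g (ybar 0) (ybar 1) \<in> P_target T x0 \<and>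
     (\<exists>\<epsilon>>0. \<forall>(y, v)\<in>P_traj f U T.
        P_constr g (y 0) (y 1) \<in> P_target T x0 \<and> norm (y 0 - ybar 0) \<le> \<epsilon> \<and>
        Linf_norm 0 1 (\<lambda>s. v s - vbar s) \<le> ereal \<epsilon> \<longrightarrow>
        P_cost \<phi> T (ybar 1) \<le> P_cost \<phi> T (y 1))"

definition P_ham ::
    "(real^'n \<Rightarrow> real^'m \<Rightarrow> real^'n) \<Rightarrow> real \<Rightarrow> 'n pstate \<Rightarrow> 'n pstate \<Rightarrow> 'm pcontrol \<Rightarrow> real" where
  "P_ham f T y q v = q \<bullet> P_dyn f T y v"

definition P_aug_ham ::
    "(real^'n \<Rightarrow> real^'m \<Rightarrow> real^'n) \<Rightarrow> (real^'m \<Rightarrow> real^'l) \<Rightarrow> real \<Rightarrow>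
     'n pstate \<Rightarrow> 'n pstate \<Rightarrow> 'm pcontrol \<Rightarrow> (real^'l) \<times> (real^'l) \<Rightarrow> real" where
  "P_aug_ham f c T y q v \<mu> = P_ham f T y q v + fst \<mu> \<bullet> c (fst v) + snd \<mu> \<bullet> c (snd v)"

(* The component \<mu> is a representative of its class in L^infinity, so that a triplet is zero as soon
   as \<mu> vanishes almost everywhere (and \<alpha>, \<beta> are zero). *)
definition Lagrange_multipliers ::
    "(real^'n \<Rightarrow> real^'m \<Rightarrow> real^'n) \<Rightarrow> (real^'n \<Rightarrow> real) \<Rightarrow> (real^'m \<Rightarrow> real^'l) \<Rightarrow> (real^'n \<Rightarrow> real) \<Rightarrow>
     real \<Rightarrow> (real \<Rightarrow> 'n pstate) \<Rightarrow> (real \<Rightarrow> 'm pcontrol) \<Rightarrow>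
     (real \<times> 'n pconstr \<times> (real \<Rightarrow> (real^'l) \<times> (real^'l))) set" where
  "Lagrange_multipliers f g c \<phi> T ybar vbar = {(\<alpha>, \<beta>, \<mu>).
     0 \<le> \<alpha> \<and> \<mu> \<in> Linf 0 1 \<and>
     \<not> (\<alpha> = 0 \<and> \<beta> = 0 \<and> (AE s in lebesgue_on {0..1}. \<mu> s = 0)) \<and>
     (case \<beta> of (\<beta>1, \<beta>2, \<beta>3, \<beta>4) \<Rightarrow> \<beta>2 = 0) \<and>
     (AE s in lebesgue_on {0..1}.
        (\<forall>i. 0 \<le> fst (\<mu> s) $ i \<and> 0 \<le> snd (\<mu> s) $ i) \<and>
        fst (\<mu> s) \<bullet> c (fst (vbar s)) + snd (\<mu> s) \<bullet> c (snd (vbar s)) = 0) \<and>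
     (\<exists>q.
        ode_solution 0 1 (\<lambda>s p. - grad (\<lambda>y. P_ham f T y p (vbar s)) (ybar s)) q \<and>
        - q 0 = transposed_jacobian (\<lambda>y0. P_constr g y0 (ybar 1)) (ybar 0) \<beta> \<and>
        q 1 = transposed_jacobian (\<lambda>y1. P_constr g (ybar 0) y1) (ybar 1) \<beta>
              + \<alpha> *\<^sub>R grad (P_cost \<phi> T) (ybar 1) \<and>
        (AE s in lebesgue_on {0..1}.
           grad (\<lambda>v. P_aug_ham f c T (ybar s) (q s) v (\<mu> s)) (vbar s) = 0))}"

end

theory Submission
  imports Defs
begin

text \<open>
  The multiplier is found with \<open>\<alpha> = 1\<close>, working in real time on the original problem. A variation of the
  reference pair consists of a control perturbation \<open>w\<close> pointing into \<open>U\<close> and of a shift \<open>\<theta>\<close> of the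
  switching time, the latter realized by running through both pieces of the trajectory at modified speeds.
  After a time change the varied trajectory is a competitor in the time crisis problem, whatever its
  crossing time. Just before \<open>\<tau>\<close> the function \<open>g\<close> grows with positive speed along all nearby
  trajectories, so that the crossing constraint is penalized exactly: for some \<open>\<Lambda>\<close>, the functional
  \<open>\<phi> (x T) - \<theta> + \<Lambda> * max 0 (g (x \<tau>))\<close> is minimal at the reference.

  Adjoint states \<open>pa\<close> and \<open>pb\<close>, with final values \<open>grad \<phi>\<close> at \<open>T\<close> and \<open>grad g\<close> at \<open>\<tau>\<close>, express the first
  order changes of \<open>\<phi> (x T)\<close> and \<open>g (x \<tau>)\<close> as linear functionals of \<open>(\<theta>, w)\<close>. On the convex cone of
  variations a scalar separation argument replaces \<open>\<Lambda> * max 0\<close> by a slope \<open>\<beta>\<close>, the multiplier of the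
  crossing constraint. The coefficient of \<open>\<theta>\<close> must then vanish, which is the equation of the third
  costate, and what remains is nonnegative for all \<open>w\<close> pointing into \<open>U\<close>; the uniform linear
  independence of the active gradients turns this into a bounded multiplier \<open>\<mu>\<close>.
\<close>

section \<open>Gradients as representing vectors\<close>

text \<open>The obstacle is the end constraint \<open>g (y1 1) = 0\<close>. A varied control
  violates it, and restoring it exactly would call for an implicit function argument. Global
  minimality in the time crisis problem permits comparison with trajectories that cross elsewhere,
  so the violation only has to be priced. The price is one-sided. If g(x(\<tau>)) \<le> 0, the
  nearby trajectory has stayed in K up to \<tau> and loses nothing. If g(x(\<tau>)) > 0,
  transversality at the left limit of the control bounds the time lost by a multiple of
  g(x(\<tau>)). This Lipschitz bound is what allows \<alpha> = 1, and hence makes the triplet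
  non-zero. Since the pointwise control constraints are kept inside the cone of variations, one
  scalar constraint is left to separate, and no infinite-dimensional separation theorem enters. In
  real time the two controls of the transformed problem are one function on [0,T], so their
  multipliers come from a single \<mu>. The third costate is recovered as a difference of two
  running averages of p \<bullet> f.\<close>

definition riesz :: "('a::euclidean_space \<Rightarrow> real) \<Rightarrow> 'a" where
  "riesz l = (\<Sum>b\<in>Basis. l b *\<^sub>R b)"

text \<open>Representing vectors are explicit finite sums, so for functionals that depend on time
  measurability can be checked on basis vectors. \<open>grad_eq_riesz\<close> links them to
  \<open>grad\<close>.\<close>

lemma riesz_inner:
  assumes "linear l"
  shows "riesz l \<bullet> h = l h"
proof -
  have "l h = l (\<Sum>b\<in>Basis. (h \<bullet> b) *\<^sub>R b)" by (simp add: euclidean_representation)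
  also have "\<dots> = (\<Sum>b\<in>Basis. (h \<bullet> b) *\<^sub>R l b)" by (simp only: linear_sum[OF assms] linear_scale[OF assms])
  also have "\<dots> = (\<Sum>b\<in>Basis. l b * (b \<bullet> h))" by (intro sum.cong refl) (simp add: inner_commute[of h])
  finally show ?thesis by (simp add: riesz_def inner_sum_left)
qed

lemma norm_riesz_le:
  assumes l: "linear l" and le: "\<And>h. l h \<le> M * norm h" and M: "0 \<le> M"
  shows "norm (riesz l) \<le> M"
proof -
  have "norm (riesz l) * norm (riesz l) = l (riesz l)"
    using riesz_inner[OF l, of "riesz l"] by (simp add: dot_square_norm power2_eq_square)
  also have "\<dots> \<le> M * norm (riesz l)" by (rule le)
  finally show ?thesis using M by (cases "riesz l = 0") auto
qed

lemma linear_inner_partial: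
  fixes A :: "('a::euclidean_space \<times> 'b::euclidean_space) \<Rightarrow>\<^sub>L 'c::real_inner"
  shows "linear (\<lambda>h. q \<bullet> A (h, 0))" "linear (\<lambda>h. q \<bullet> A (0, h))"
  by (rule bounded_linear.linear, intro bounded_linear_compose[OF bounded_linear_inner_right]
      bounded_linear_compose[OF blinfun.bounded_linear_right] bounded_linear_Pair bounded_linear_ident bounded_linear_zero)+

lemma inner_blinfun_le:
  assumes "norm A \<le> M"
  shows "q \<bullet> blinfun_apply A w \<le> M * norm q * norm w"
proof -
  have "q \<bullet> blinfun_apply A w \<le> norm q * norm (blinfun_apply A w)" by (rule norm_cauchy_schwarz)
  also have "\<dots> \<le> norm q * (M * norm w)"
    by (intro mult_left_mono order_trans[OF norm_blinfun] mult_right_mono assms) auto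
  finally show ?thesis by (simp add: mult_ac)
qed

section \<open>Absolutely continuous functions\<close>

lemma AE_lebesgue_on_iff:
  assumes "S \<in> sets lebesgue"
  shows "(AE t in lebesgue_on S. P t) \<longleftrightarrow> (\<exists>N. negligible N \<and> (\<forall>t\<in>S - N. P t))"
proof -
  have "(AE t in lebesgue_on S. P t) \<longleftrightarrow> (AE t in lebesgue. t \<in> S \<longrightarrow> P t)"
    using assms by (simp add: AE_restrict_space_iff)
  also have "\<dots> \<longleftrightarrow> (\<exists>N. negligible N \<and> (\<forall>t\<in>S - N. P t))"
    unfolding eventually_ae_filter_negligible by blast
  finally show ?thesis .
qed

lemma abs_continuous_subinterval:
  assumes "abs_continuous a b x" "a \<le> c" "d \<le> b"
  shows "abs_continuous c d x"
  using assms unfolding abs_continuous_def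
  by (meson atLeastatMost_subset_iff order_trans)

lemma division_of_mono_content:
  fixes d :: "real set set"
  assumes "d division_of S" "k \<in> d"
  shows "k = {Inf k..Sup k}" "Inf k \<le> Sup k" "measure lebesgue k = Sup k - Inf k"
proof -
  obtain u v where "k = cbox u v"
    using division_ofD(4)[OF assms] by blast
  moreover have "k \<noteq> {}" using division_ofD(3)[OF assms] .
  ultimately show "k = {Inf k..Sup k}" "Inf k \<le> Sup k" "measure lebesgue k = Sup k - Inf k" by auto
qed

lemma lipschitz_imp_abs_continuous:
  assumes "L-lipschitz_on {a..b} x"
  shows "abs_continuous a b x"
  unfolding abs_continuous_def
proof (intro allI impI)
  fix \<epsilon> :: real assume e: "\<epsilon> > 0"
  have L: "L \<ge> 0" using assms lipschitz_on_nonneg by blast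
  show "\<exists>\<delta>>0. \<forall>d S. d division_of S \<and> S \<subseteq> {a..b} \<and> (\<Sum>k\<in>d. Sup k - Inf k) < \<delta> \<longrightarrow>
        (\<Sum>k\<in>d. norm (x (Sup k) - x (Inf k))) < \<epsilon>"
  proof (intro exI[of _ "\<epsilon> / (L + 1)"] conjI allI impI)
    show "0 < \<epsilon> / (L + 1)" using e L by simp
    fix d S assume *: "d division_of S \<and> S \<subseteq> {a..b} \<and> (\<Sum>k\<in>d. Sup k - Inf k) < \<epsilon> / (L + 1)"
    have "(\<Sum>k\<in>d. norm (x (Sup k) - x (Inf k))) \<le> (\<Sum>k\<in>d. L * (Sup k - Inf k))"
    proof (rule sum_mono)
      fix k assume k: "k \<in> d"
      have 1: "k = {Inf k..Sup k}" "Inf k \<le> Sup k" using division_of_mono_content * k by blast+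
      have "k \<subseteq> {a..b}" using * k by (meson division_ofD(2) order_trans)
      then have "Inf k \<in> {a..b}" "Sup k \<in> {a..b}" using 1
        by (metis atLeastAtMost_iff order_refl subsetD)+
      then show "norm (x (Sup k) - x (Inf k)) \<le> L * (Sup k - Inf k)"
        using lipschitz_onD[OF assms, of "Sup k" "Inf k"] 1 by (simp add: dist_norm)
    qed
    also have "\<dots> = L * (\<Sum>k\<in>d. Sup k - Inf k)" by (simp add: sum_distrib_left)
    also have "\<dots> \<le> L * (\<epsilon> / (L + 1))" using * L by (intro mult_left_mono) auto
    also have "\<dots> < \<epsilon>" using e L by (simp add: field_simps)
    finally show "(\<Sum>k\<in>d. norm (x (Sup k) - x (Inf k))) < \<epsilon>" .
  qed
qed

text \<open>Fundamental theorem of calculus by gauges. Tags off \<open>N\<close> obey the straddle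
  estimate of the derivative. Tags in \<open>N\<close> are forced into an open set of measure below
  \<delta>, so absolute continuity makes the increments over their intervals small in total.\<close>

lemma has_integral_abs_continuous_derivative:
  fixes x :: "real \<Rightarrow> 'a::euclidean_space"
  assumes ac: "abs_continuous a b x" and ab: "a \<le> b" and N: "negligible N"
    and der: "\<And>t. t \<in> {a..b} - N \<Longrightarrow> (x has_vector_derivative h t) (at t within {a..b})"
  shows "(h has_integral (x b - x a)) {a..b}"
proof -
  \<comment> \<open>With value 0 on \<open>N\<close>, a tag in \<open>N\<close> contributes nothing
    but the increment of \<open>x\<close>.\<close>
  define h0 where "h0 = (\<lambda>t. if t \<in> N then 0 else h t)"
  have "(h0 has_integral (x b - x a)) {a..b}"
    unfolding box_real[symmetric] has_integral
  proof (intro allI impI)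
    fix e :: real assume e: "e > 0"
    define e' where "e' = e / (2 * (b - a + 1))"
    have e': "e' > 0" using e ab by (simp add: e'_def)
    obtain \<delta> where \<delta>: "\<delta> > 0" and ac\<delta>: "\<And>d S. d division_of S \<Longrightarrow> S \<subseteq> {a..b} \<Longrightarrow>
        (\<Sum>k\<in>d. Sup k - Inf k) < \<delta> \<Longrightarrow> (\<Sum>k\<in>d. norm (x (Sup k) - x (Inf k))) < e / 2"
      using ac e unfolding abs_continuous_def by (metis half_gt_zero)
    have "N \<in> lmeasurable" "measure lebesgue N = 0"
      using N by (auto simp: negligible_imp_measurable negligible_imp_measure0)
    then obtain O' where O'0: "open O'" "N \<subseteq> O'" "O' - N \<in> lmeasurable" "emeasure lebesgue (O' - N) < ennreal \<delta>"
      using sets_lebesgue_outer_open[of N \<delta>] \<delta> by (metis fmeasurableD)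
    have N0: "N \<in> null_sets lebesgue" using N negligible_iff_null_sets by blast
    have "O' \<in> lmeasurable" using O'0 N0
      by (metis borel_open measurable_Diff_null_set sets_completionI_sets sets_lborel)
    with O'0 have O': "open O'" "N \<subseteq> O'" "O' \<in> lmeasurable" "emeasure lebesgue (O' - N) < ennreal \<delta>" by auto
    have mO: "measure lebesgue O' < \<delta>"
    proof -
      have "emeasure lebesgue O' = emeasure lebesgue (O' - N)"
        using N0 fmeasurableD[OF O'(3)] by (simp add: emeasure_Diff_null_set)
      then have "ennreal (measure lebesgue O') < ennreal \<delta>"
        using O'(4) emeasure_eq_measure2[OF O'(3)] by simp
      then show ?thesis
        by (simp add: ennreal_less_iff)
    qed
    have "\<exists>r>0. (t \<in> N \<longrightarrow> ball t r \<subseteq> O') \<and> (t \<in> {a..b} - N \<longrightarrow>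
       (\<forall>y\<in>{a..b}. norm (y - t) < r \<longrightarrow> norm (x y - x t - (y - t) *\<^sub>R h t) \<le> e' * norm (y - t)))" for t
    proof (cases "t \<in> N")
      case True
      then show ?thesis using O'(1,2) openE by (metis DiffD2 subsetD)
    next
      case False
      show ?thesis
      proof (cases "t \<in> {a..b}")
        case True
        with False der have "(x has_vector_derivative h t) (at t within {a..b})" by auto
        then obtain r where "r > 0" "\<forall>y\<in>{a..b}. norm (y - t) < r \<longrightarrow> norm (x y - x t - (y - t) *\<^sub>R h t) \<le> e' * norm (y - t)"
          unfolding has_vector_derivative_def has_derivative_within_alt using e' by blast
        then show ?thesis using False by blast
      qed (use False in \<open>auto intro: exI[of _ 1]\<close>)
    qed
    then obtain r where r: "\<And>t. r t > 0" "\<And>t. t \<in> N \<Longrightarrow> ball t (r t) \<subseteq> O'"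
      "\<And>t y. t \<in> {a..b} - N \<Longrightarrow> y \<in> {a..b} \<Longrightarrow> norm (y - t) < r t \<Longrightarrow>
          norm (x y - x t - (y - t) *\<^sub>R h t) \<le> e' * norm (y - t)" by metis
    define \<gamma> where "\<gamma> = (\<lambda>t. ball t (r t))"
    show "\<exists>\<gamma>. gauge \<gamma> \<and> (\<forall>\<D>. \<D> tagged_division_of cbox a b \<and> \<gamma> fine \<D> \<longrightarrow>
         norm ((\<Sum>(t,k)\<in>\<D>. measure lborel k *\<^sub>R h0 t) - (x b - x a)) < e)"
    proof (intro exI[of _ \<gamma>] conjI allI impI)
      show "gauge \<gamma>" using r(1) by (auto simp: gauge_def \<gamma>_def)
      fix D assume D: "D tagged_division_of cbox a b \<and> \<gamma> fine D"
      then have Dt: "D tagged_division_of {a..b}" and fine: "\<gamma> fine D" by auto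
      have fin: "finite D" using Dt by blast
      have tel: "(\<Sum>(t,k)\<in>D. x (Sup k) - x (Inf k)) = x b - x a"
        using additive_tagged_division_1[OF ab Dt] by simp
      have kk: "\<exists>u v. k = {u..v} \<and> u \<le> v \<and> t \<in> {u..v} \<and> a \<le> u \<and> v \<le> b \<and> {u..v} \<subseteq> ball t (r t)"
        if "(t,k) \<in> D" for t k
      proof -
        have "t \<in> k" "k \<subseteq> {a..b}" "\<exists>u v. k = cbox u v" "k \<subseteq> ball t (r t)"
          using tagged_division_ofD[OF Dt] that fine by (auto simp: fine_def \<gamma>_def)
        then show ?thesis by (metis atLeastAtMost_iff atLeastatMost_subset_iff box_real(2) order_trans)
      qed
      define E where "E = (\<lambda>(t,k). measure lborel k *\<^sub>R h0 t - (x (Sup k) - x (Inf k)))"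
      have eq: "(\<Sum>(t,k)\<in>D. measure lborel k *\<^sub>R h0 t) - (x b - x a) = (\<Sum>p\<in>D. E p)"
        unfolding tel[symmetric] E_def by (simp add: sum_subtractf case_prod_unfold)
      define D1 where "D1 = {p \<in> D. fst p \<in> N}"
      define D2 where "D2 = {p \<in> D. fst p \<notin> N}"
      have un: "D = D1 \<union> D2" "D1 \<inter> D2 = {}" and fin12: "finite D1" "finite D2"
        using fin by (auto simp: D1_def D2_def)
      have D1p: "D1 tagged_partial_division_of {a..b}"
        using Dt by (metis (no_types, lifting) D1_def mem_Collect_eq subsetI tagged_division_of_def tagged_partial_division_subset)
      have div: "snd ` D1 division_of \<Union>(snd ` D1)"
        using D1p by (rule partial_division_of_tagged_division)
      have sub: "\<Union>(snd ` D1) \<subseteq> O' \<inter> {a..b}"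
        using kk r(2) by (fastforce simp: D1_def)
      have ne: "k \<noteq> {}" if "k \<in> snd ` D1" for k
        using that kk by (fastforce simp: D1_def)
      have D1u: "D1 tagged_division_of \<Union>(snd ` D1)"
        using tagged_partial_division_of_Union_self[OF D1p] .
      \<comment> \<open>Passing from tagged intervals to intervals requires that degenerate ones
        contribute 0. The empty set is treated apart because its \<open>Sup\<close> and
        \<open>Inf\<close> are unspecified.\<close>
      define F where "F = (\<lambda>k::real set. if k = {} then 0 else norm (x (Sup k) - x (Inf k)))"
      have "(\<Sum>(t,k)\<in>D1. F k) = (\<Sum>k\<in>snd ` D1. F k)"
        by (rule sum.over_tagged_division_lemma[OF D1u]) (auto simp: F_def)
      then have sumeq: "(\<Sum>p\<in>D1. norm (x (Sup (snd p)) - x (Inf (snd p)))) =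
          (\<Sum>k\<in>snd ` D1. norm (x (Sup k) - x (Inf k)))"
        using ne by (simp add: F_def case_prod_unfold cong: sum.cong)
      have len: "(\<Sum>k\<in>snd ` D1. Sup k - Inf k) < \<delta>"
      proof -
        have "(\<Sum>k\<in>snd ` D1. Sup k - Inf k) = (\<Sum>k\<in>snd ` D1. measure lebesgue k)"
          using division_of_mono_content(3)[OF div] by (intro sum.cong) auto
        also have "\<dots> = measure lebesgue (\<Union>(snd ` D1))"
          using content_division[OF div] by simp
        also have "\<dots> \<le> measure lebesgue O'"
          using sub O' div by (intro measure_mono_fmeasurable) (auto simp: lmeasurable_division fmeasurableD)
        finally show ?thesis using mO by simp
      qed
      have "(\<Sum>p\<in>D1. norm (E p)) = (\<Sum>p\<in>D1. norm (x (Sup (snd p)) - x (Inf (snd p))))"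
        by (rule sum.cong) (auto simp: E_def D1_def h0_def norm_minus_commute)
      also have "\<dots> = (\<Sum>k\<in>snd ` D1. norm (x (Sup k) - x (Inf k)))"
        by (rule sumeq)
      also have "\<dots> < e / 2" using ac\<delta>[OF div _ len] sub by auto
      finally have S1: "(\<Sum>p\<in>D1. norm (E p)) < e / 2" .
      have "(\<Sum>p\<in>D2. norm (E p)) \<le> (\<Sum>p\<in>D2. e' * measure lborel (snd p))"
      proof (rule sum_mono)
        fix p assume p: "p \<in> D2"
        obtain t k where tk: "p = (t,k)" by (cases p)
        obtain u v where k: "k = {u..v}" "u \<le> v" "t \<in> {u..v}" "a \<le> u" "v \<le> b" "{u..v} \<subseteq> ball t (r t)"
          using kk[of t k] p tk by (auto simp: D2_def)
        have tN: "t \<in> {a..b} - N" using p tk k by (auto simp: D2_def)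
        have "dist t u < r t" "dist t v < r t" using k by (auto simp: subset_iff)
        then have "norm (x u - x t - (u - t) *\<^sub>R h t) \<le> e' * norm (u - t)"
          "norm (x v - x t - (v - t) *\<^sub>R h t) \<le> e' * norm (v - t)"
          using r(3)[OF tN, of u] r(3)[OF tN, of v] k by (auto simp: dist_norm abs_minus_commute)
        then have "norm ((x u - x t - (u - t) *\<^sub>R h t) - (x v - x t - (v - t) *\<^sub>R h t)) \<le> e' * (v - u)"
          using k by (intro order_trans[OF norm_triangle_ineq4]) (auto simp: algebra_simps)
        moreover have "E p = (x u - x t - (u - t) *\<^sub>R h t) - (x v - x t - (v - t) *\<^sub>R h t)"
          using tk k tN by (simp add: E_def h0_def algebra_simps)
        ultimately show "norm (E p) \<le> e' * measure lborel (snd p)" using tk k by simp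
      qed
      also have "\<dots> \<le> (\<Sum>p\<in>D. e' * measure lborel (snd p))"
        using fin e' by (intro sum_mono2) (auto simp: D2_def)
      also have "\<dots> = e' * (\<Sum>(t,k)\<in>D. measure lborel k)"
        by (simp add: sum_distrib_left case_prod_unfold)
      also have "\<dots> = e' * (b - a)"
        using additive_content_tagged_division[of D a b] Dt ab by simp
      also have "\<dots> \<le> e / 2" using ab e by (simp add: e'_def field_simps)
      finally have S2: "(\<Sum>p\<in>D2. norm (E p)) \<le> e / 2" .
      have "norm (\<Sum>p\<in>D. E p) \<le> (\<Sum>p\<in>D. norm (E p))" by (rule norm_sum)
      also have "\<dots> = (\<Sum>p\<in>D1. norm (E p)) + (\<Sum>p\<in>D2. norm (E p))"
        unfolding un(1) using un(2) fin12 by (rule sum.union_disjoint[rotated 2])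
      also have "\<dots> < e" using S1 S2 by simp
      finally show "norm ((\<Sum>(t,k)\<in>D. measure lborel k *\<^sub>R h0 t) - (x b - x a)) < e" unfolding eq .
    qed
  qed
  then show ?thesis
    using has_integral_spike[OF N, of "{a..b}" h h0] by (simp add: h0_def)
qed

text \<open>The differentiation theorem used here averages over cubes with a corner at the point. On
  the line these are intervals to its right, so only right derivatives come out.\<close>

lemma integral_has_right_derivative_AE:
  fixes h :: "real \<Rightarrow> 'a::euclidean_space"
  assumes h: "\<And>a b. h integrable_on {a..b}"
  shows "\<exists>N. negligible N \<and> (\<forall>t. t \<notin> N \<longrightarrow>
     (\<forall>e>0. \<exists>d>0. \<forall>s. 0 < s \<and> s < d \<longrightarrow> norm (integral {t..t+s} h - s *\<^sub>R h t) \<le> e * s))"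
proof -
  have h': "h integrable_on cbox a b" for a b using h by simp
  obtain N where N: "negligible N" "\<And>x e. \<lbrakk>x \<notin> N; 0 < e\<rbrakk> \<Longrightarrow>
               \<exists>d>0. \<forall>s. 0 < s \<and> s < d \<longrightarrow>
                         norm(integral (cbox x (x + s *\<^sub>R One)) h /\<^sub>R s ^ DIM(real) - h x) < e"
    by (rule integrable_ccontinuous_explicit[OF h']) blast
  have *: "norm (integral {t..t+s} h - s *\<^sub>R h t) \<le> e * s"
    if "0 < s" "norm(integral (cbox t (t + s *\<^sub>R One)) h /\<^sub>R s ^ DIM(real) - h t) < e" for t s e
  proof -
    have "integral {t..t+s} h - s *\<^sub>R h t = s *\<^sub>R (integral {t..t+s} h /\<^sub>R s - h t)"
      using that by (simp add: algebra_simps)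
    then show ?thesis using that by (simp add: mult.commute)
  qed
  show ?thesis
  proof (intro exI[of _ N] conjI allI impI)
    fix t and e :: real assume "t \<notin> N" "0 < e"
    then obtain d where "d > 0" "\<forall>s. 0 < s \<and> s < d \<longrightarrow>
        norm(integral (cbox t (t + s *\<^sub>R One)) h /\<^sub>R s ^ DIM(real) - h t) < e"
      using N(2) by blast
    then show "\<exists>d>0. \<forall>s. 0 < s \<and> s < d \<longrightarrow> norm (integral {t..t+s} h - s *\<^sub>R h t) \<le> e * s"
      using * by blast
  qed (rule N)
qed

text \<open>A left derivative at t is a right derivative of the reflected integrand at -t. Extension
  by 0 gives integrability on every interval, as the one-sided lemma demands.\<close>

lemma integral_has_vector_derivative_AE:
  fixes h :: "real \<Rightarrow> 'a::euclidean_space"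
  assumes h: "h integrable_on {a..b}"
  shows "\<exists>N. negligible N \<and> (\<forall>t\<in>{a..b} - N.
     ((\<lambda>t. integral {a..t} h) has_vector_derivative h t) (at t within {a..b}))"
proof -
  define h0 where "h0 = (\<lambda>t. if t \<in> {a..b} then h t else 0)"
  have h0: "h0 integrable_on {c..d}" for c d
  proof -
    have "h0 integrable_on UNIV" unfolding h0_def using h integrable_restrict_UNIV by blast
    then show ?thesis by (metis box_real(2) integrable_on_subcbox subset_UNIV)
  qed
  have h0r: "(\<lambda>t. h0 (- t)) integrable_on {c..d}" for c d
    using h0[of "-d" "-c"] Henstock_Kurzweil_Integration.integrable_reflect_real[where f=h0 and a="-d" and b="-c"] by simp
  obtain N1 where N1: "negligible N1" "\<And>t e. t \<notin> N1 \<Longrightarrow> e > 0 \<Longrightarrow>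
     \<exists>d>0. \<forall>s. 0 < s \<and> s < d \<longrightarrow> norm (integral {t..t+s} h0 - s *\<^sub>R h0 t) \<le> e * s"
    using integral_has_right_derivative_AE[OF h0] by metis
  obtain N2 where N2: "negligible N2" "\<And>t e. t \<notin> N2 \<Longrightarrow> e > 0 \<Longrightarrow>
     \<exists>d>0. \<forall>s. 0 < s \<and> s < d \<longrightarrow> norm (integral {t..t+s} (\<lambda>t. h0 (- t)) - s *\<^sub>R h0 (- t)) \<le> e * s"
    using integral_has_right_derivative_AE[OF h0r] by metis
  have negl: "negligible (N1 \<union> uminus ` N2)"
  proof (intro negligible_Un N1(1) negligible_locally_Lipschitz_image[OF _ N2(1)])
    show "\<exists>T B. open T \<and> t \<in> T \<and> (\<forall>y\<in>N2 \<inter> T. norm (- y - - t) \<le> B * norm (y - t))" for t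
      by (intro exI[of _ UNIV] exI[of _ 1]) auto
  qed simp
  have "((\<lambda>t. integral {a..t} h) has_vector_derivative h t) (at t within {a..b})"
    if t: "t \<in> {a..b} - (N1 \<union> uminus ` N2)" for t
    unfolding has_vector_derivative_def has_derivative_within_alt
  proof (intro conjI allI impI)
    show "bounded_linear (\<lambda>x. x *\<^sub>R h t)" by (simp add: bounded_linear_scaleR_left)
    fix e :: real assume e: "e > 0"
    have t1: "t \<notin> N1" and t2: "- t \<notin> N2" using t by (auto simp: image_iff intro: minus_minus[symmetric])
    obtain d1 where d1: "d1 > 0" "\<And>s. 0 < s \<Longrightarrow> s < d1 \<Longrightarrow> norm (integral {t..t+s} h0 - s *\<^sub>R h0 t) \<le> e * s"
      using N1(2)[OF t1 e] by blast
    obtain d2 where d2: "d2 > 0" "\<And>s. 0 < s \<Longrightarrow> s < d2 \<Longrightarrow>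
       norm (integral {-t..-t+s} (\<lambda>t. h0 (- t)) - s *\<^sub>R h0 t) \<le> e * s"
      using N2(2)[OF t2 e] by auto
    have h0t: "h0 t = h t" using t by (simp add: h0_def)
    show "\<exists>d>0. \<forall>y\<in>{a..b}. norm (y - t) < d \<longrightarrow>
        norm (integral {a..y} h - integral {a..t} h - (y - t) *\<^sub>R h t) \<le> e * norm (y - t)"
    proof (intro exI[of _ "min d1 d2"] conjI ballI impI)
      fix y assume y: "y \<in> {a..b}" "norm (y - t) < min d1 d2"
      consider "y = t" | "y > t" | "y < t" by linarith
      then show "norm (integral {a..y} h - integral {a..t} h - (y - t) *\<^sub>R h t) \<le> e * norm (y - t)"
      proof cases
        case 2
        have "integral {a..y} h = integral {a..t} h + integral {t..y} h"
          using Henstock_Kurzweil_Integration.integral_combine[where f=h and a=a and c=t and b=y] t y 2 h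
          by (simp add: integrable_on_subinterval[OF h])
        moreover have "integral {t..y} h = integral {t..y} h0"
          using t y by (intro integral_cong) (auto simp: h0_def)
        ultimately show ?thesis using d1(2)[of "y - t"] y 2 by (simp add: h0t)
      next
        case 3
        have "integral {a..t} h = integral {a..y} h + integral {y..t} h"
          using Henstock_Kurzweil_Integration.integral_combine[where f=h and a=a and c=y and b=t] t y 3 h
          by (simp add: integrable_on_subinterval[OF h])
        moreover have "integral {y..t} h = integral {y..t} h0"
          using t y by (intro integral_cong) (auto simp: h0_def)
        moreover have e: "-t + (t - y) = - y" by (simp only: add_diff_eq add.left_inverse diff_0)
        have "integral {y..t} h0 = integral {-t..-t+(t-y)} (\<lambda>t. h0 (- t))"
          unfolding e by (rule Henstock_Kurzweil_Integration.integral_reflect_real[symmetric])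
        moreover note this
        moreover define I where "I = integral {-t..-t+(t-y)} (\<lambda>t. h0 (- t))"
        ultimately have "integral {a..t} h = integral {a..y} h + I" by (simp only: I_def)
        then have "integral {a..y} h - integral {a..t} h - (y - t) *\<^sub>R h t = - (I - (t - y) *\<^sub>R h0 t)"
          by (simp add: h0t algebra_simps)
        then have "norm (integral {a..y} h - integral {a..t} h - (y - t) *\<^sub>R h t) =
            norm (I - (t - y) *\<^sub>R h0 t)"
          by (simp only: norm_minus_cancel)
        then show ?thesis using d2(2)[of "t - y"] y 3 unfolding I_def[symmetric] by simp
      qed simp
    qed (use d1 d2 in auto)
  qed
  then show ?thesis using negl by blast
qed

section \<open>Lipschitz primitives\<close>

text \<open>The working class of the proof. For bounded controls it contains trajectories, costates
  and their pairings, and it is stable under sums, products and bi-Lipschitz time changes. The rate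
  \<open>r\<close> matters only off a null set.\<close>

definition lip_primitive :: "real \<Rightarrow> real \<Rightarrow> (real \<Rightarrow> 'a) \<Rightarrow> (real \<Rightarrow> 'a::euclidean_space) \<Rightarrow> bool" where
  "lip_primitive a b r x \<longleftrightarrow> (\<exists>L. L-lipschitz_on {a..b} x) \<and>
     (\<exists>N. negligible N \<and> (\<forall>t\<in>{a..b} - N. (x has_vector_derivative r t) (at t within {a..b})))"

lemma lip_primitive_continuous: "lip_primitive a b r x \<Longrightarrow> continuous_on {a..b} x"
  unfolding lip_primitive_def by (auto intro: lipschitz_on_continuous_on)

lemma lip_primitive_subinterval:
  assumes "lip_primitive a b r x" "a \<le> c" "d \<le> b"
  shows "lip_primitive c d r x"
proof -
  have sub: "{c..d} \<subseteq> {a..b}" using assms by auto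
  obtain L M where L: "L-lipschitz_on {a..b} x" and M: "negligible M"
    "\<And>t. t\<in>{a..b} - M \<Longrightarrow> (x has_vector_derivative r t) (at t within {a..b})"
    using assms(1) unfolding lip_primitive_def by blast
  show ?thesis unfolding lip_primitive_def
    using lipschitz_on_subset[OF L sub] M sub
    by (intro conjI exI[of _ L] exI[of _ M]) (auto intro!: has_vector_derivative_within_subset[OF M(2) sub])
qed

lemma lip_primitive_has_integral:
  assumes "lip_primitive a b r x" "a \<le> c" "c \<le> d" "d \<le> b"
  shows "(r has_integral (x d - x c)) {c..d}"
proof -
  obtain L M where "L-lipschitz_on {c..d} x" and M: "negligible M"
    "\<And>t. t\<in>{c..d} - M \<Longrightarrow> (x has_vector_derivative r t) (at t within {c..d})"
    using lip_primitive_subinterval[OF assms(1,2,4)] unfolding lip_primitive_def by blast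
  then show ?thesis
    by (intro has_integral_abs_continuous_derivative[OF _ assms(3) M] lipschitz_imp_abs_continuous)
qed

lemma lip_primitive_cong:
  assumes "lip_primitive a b r x" "negligible N" "\<And>t. t \<in> {a..b} - N \<Longrightarrow> r t = r' t"
    "\<And>t. t \<in> {a..b} \<Longrightarrow> x t = x' t"
  shows "lip_primitive a b r' x'"
proof -
  obtain L M where L: "L-lipschitz_on {a..b} x" and M: "negligible M"
    "\<And>t. t\<in>{a..b} - M \<Longrightarrow> (x has_vector_derivative r t) (at t within {a..b})"
    using assms(1) unfolding lip_primitive_def by blast
  have "L-lipschitz_on {a..b} x'" using L assms(4) by (auto simp: lipschitz_on_def)
  moreover have "(x' has_vector_derivative r' t) (at t within {a..b})" if "t \<in> {a..b} - (M \<union> N)" for t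
    using M(2)[of t] assms(3)[of t] that assms(4)
    by (metis Diff_iff UnCI has_vector_derivative_transform)
  ultimately show ?thesis unfolding lip_primitive_def using M(1) assms(2)
    by (intro conjI exI[of _ L] exI[of _ "M \<union> N"]) auto
qed

lemma lip_primitive_imp_ode_solution:
  assumes "lip_primitive a b (\<lambda>t. rhs t (x t)) x"
  shows "ode_solution a b rhs x"
  using assms lipschitz_imp_abs_continuous unfolding lip_primitive_def ode_solution_def
  by (auto simp: AE_lebesgue_on_iff)

lemma integral_lip_primitive:
  fixes r :: "real \<Rightarrow> 'a::euclidean_space"
  assumes r: "r integrable_on {a..b}" and B: "\<And>t. t \<in> {a..b} \<Longrightarrow> norm (r t) \<le> B"
    and x: "\<And>t. t \<in> {a..b} \<Longrightarrow> x t = x0 + integral {a..t} r"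
  shows "lip_primitive a b r x"
proof -
  define y where "y = (\<lambda>t. x0 + integral {a..t} r)"
  have "\<bar>B\<bar>-lipschitz_on {a..b} y"
  proof (rule lipschitz_onI)
    have *: "norm (y t - y s) \<le> \<bar>B\<bar> * (t - s)" if "s \<in> {a..b}" "t \<in> {a..b}" "s \<le> t" for s t
    proof -
      have i: "r integrable_on {a..t}" "r integrable_on {s..t}"
        using r that by (auto intro: integrable_on_subinterval)
      have "y t - y s = integral {s..t} r"
        using Henstock_Kurzweil_Integration.integral_combine[where f=r and a=a and c=s and b=t] that i by (simp add: y_def algebra_simps)
      also have "norm \<dots> \<le> integral {s..t} (\<lambda>_. \<bar>B\<bar>)"
      proof (rule integral_norm_bound_integral[OF i(2)])
        show "norm (r x) \<le> \<bar>B\<bar>" if "x \<in> {s..t}" for x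
          using B[of x] that \<open>s \<in> {a..b}\<close> \<open>t \<in> {a..b}\<close> by auto
      qed (rule integrable_const_ivl)
      finally show ?thesis using that by (simp add: mult.commute)
    qed
    fix s t assume "s \<in> {a..b}" "t \<in> {a..b}"
    then show "dist (y s) (y t) \<le> \<bar>B\<bar> * dist s t"
      using *[of s t] *[of t s] by (cases "s \<le> t") (auto simp: dist_norm norm_minus_commute)
  qed simp
  moreover obtain N where "negligible N" "\<forall>t\<in>{a..b} - N.
     ((\<lambda>t. integral {a..t} r) has_vector_derivative r t) (at t within {a..b})"
    using integral_has_vector_derivative_AE[OF r] by blast
  then have "\<forall>t\<in>{a..b} - N. (y has_vector_derivative r t) (at t within {a..b})"
    unfolding y_def by (auto intro!: derivative_eq_intros)
  ultimately have "lip_primitive a b r y" unfolding lip_primitive_def using \<open>negligible N\<close> by blast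
  then show ?thesis by (rule lip_primitive_cong[OF _ negligible_empty]) (simp_all add: y_def x)
qed

text \<open>The entrance for the given state: an absolutely continuous function is the integral of
  its derivative, and a bounded integrand has a Lipschitz integral.\<close>

lemma abs_continuous_lip_primitive:
  fixes x :: "real \<Rightarrow> 'a::euclidean_space"
  assumes "abs_continuous a b x" "negligible N"
    and "\<And>t. t \<in> {a..b} - N \<Longrightarrow> (x has_vector_derivative r t) (at t within {a..b})"
    and B: "\<And>t. t \<in> {a..b} - N \<Longrightarrow> norm (r t) \<le> B"
  shows "lip_primitive a b r x"
proof -
  define r' where "r' = (\<lambda>t. if t \<in> N then 0 else r t)"
  have i: "(r has_integral (x t - x a)) {a..t}" if "t \<in> {a..b}" for t
    using that assms(1,3)
    by (intro has_integral_abs_continuous_derivative[OF _ _ assms(2)])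
       (auto intro: abs_continuous_subinterval has_vector_derivative_within_subset[where S="{a..b}"])
  have i': "(r' has_integral (x t - x a)) {a..t}" if "t \<in> {a..b}" for t
    by (rule has_integral_spike[OF assms(2) _ i[OF that]]) (auto simp: r'_def)
  have "lip_primitive a b r' x"
  proof (cases "a \<le> b")
    case True
    show ?thesis
    proof (rule integral_lip_primitive)
      show "r' integrable_on {a..b}" using i'[of b] True by auto
      show "norm (r' t) \<le> \<bar>B\<bar>" if "t \<in> {a..b}" for t using B[of t] that by (auto simp: r'_def)
      show "x t = x a + integral {a..t} r'" if "t \<in> {a..b}" for t
        using i'[OF that] by (simp add: integral_unique)
    qed
  next
    case False
    then have "{a..b} = {}" by simp
    then show ?thesis unfolding lip_primitive_def by (auto intro!: exI[of _ "0::real"] exI[of _ "{}"] lipschitz_onI)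
  qed
  then show ?thesis by (rule lip_primitive_cong[OF _ assms(2)]) (auto simp: r'_def)
qed

section \<open>Calculus of Lipschitz primitives\<close>

lemma lip_primitive_diff:
  assumes "lip_primitive a b r x" "lip_primitive a b s y"
  shows "lip_primitive a b (\<lambda>t. r t - s t) (\<lambda>t. x t - y t)"
proof -
  obtain L M where L: "L-lipschitz_on {a..b} x" and M: "negligible M"
    "\<And>t. t\<in>{a..b} - M \<Longrightarrow> (x has_vector_derivative r t) (at t within {a..b})"
    using assms(1) unfolding lip_primitive_def by blast
  obtain L' M' where L': "L'-lipschitz_on {a..b} y" and M': "negligible M'"
    "\<And>t. t\<in>{a..b} - M' \<Longrightarrow> (y has_vector_derivative s t) (at t within {a..b})"
    using assms(2) unfolding lip_primitive_def by blast
  show ?thesis unfolding lip_primitive_def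
    using lipschitz_on_diff[OF L L'] M M' negligible_Un[OF M(1) M'(1)]
    by (auto intro!: exI[of _ "M \<union> M'"] has_vector_derivative_diff)
qed

lemma lip_primitive_add:
  assumes "lip_primitive a b r x" "lip_primitive a b s y"
  shows "lip_primitive a b (\<lambda>t. r t + s t) (\<lambda>t. x t + y t)"
proof -
  obtain L M where L: "L-lipschitz_on {a..b} x" and M: "negligible M"
    "\<And>t. t\<in>{a..b} - M \<Longrightarrow> (x has_vector_derivative r t) (at t within {a..b})"
    using assms(1) unfolding lip_primitive_def by blast
  obtain L' M' where L': "L'-lipschitz_on {a..b} y" and M': "negligible M'"
    "\<And>t. t\<in>{a..b} - M' \<Longrightarrow> (y has_vector_derivative s t) (at t within {a..b})"
    using assms(2) unfolding lip_primitive_def by blast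
  show ?thesis unfolding lip_primitive_def
    using lipschitz_on_add[OF L L'] M M' negligible_Un[OF M(1) M'(1)]
    by (auto intro!: exI[of _ "M \<union> M'"] has_vector_derivative_add)
qed

lemma lip_primitive_bounded_linear:
  assumes "bounded_linear A" "lip_primitive a b r x"
  shows "lip_primitive a b (\<lambda>t. A (r t)) (\<lambda>t. A (x t))"
proof -
  obtain L M where L: "L-lipschitz_on {a..b} x" and M: "negligible M"
    "\<And>t. t\<in>{a..b} - M \<Longrightarrow> (x has_vector_derivative r t) (at t within {a..b})"
    using assms(2) unfolding lip_primitive_def by blast
  obtain C where "C-lipschitz_on (x ` {a..b}) A" using assms(1)
    by (metis bounded_linear.lipschitz_boundE)
  with L have "(C * L)-lipschitz_on {a..b} (\<lambda>t. A (x t))" using lipschitz_on_compose2 by blast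
  then show ?thesis unfolding lip_primitive_def
    using M bounded_linear.has_vector_derivative[OF assms(1)] by blast
qed

lemma lip_primitive_Pair:
  fixes x :: "real \<Rightarrow> 'a::euclidean_space" and y :: "real \<Rightarrow> 'b::euclidean_space"
  assumes "lip_primitive a b r x" "lip_primitive a b s y"
  shows "lip_primitive a b (\<lambda>t. (r t, s t)) (\<lambda>t. (x t, y t))"
proof -
  have "lip_primitive a b (\<lambda>t. (r t, 0) + (0, s t)) (\<lambda>t. (x t, 0) + (0, y t))"
    by (intro lip_primitive_add lip_primitive_bounded_linear[where A="\<lambda>x. (x, 0)"]
        lip_primitive_bounded_linear[where A="\<lambda>x. (0, x)"] assms bounded_linear_intros)
  then show ?thesis by simp
qed

text \<open>Integration by parts. It serves to write the end value of costate times state deviation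
  as an integral along the trajectory.\<close>

lemma lip_primitive_inner:
  assumes "lip_primitive a b r x" "lip_primitive a b s y"
  shows "lip_primitive a b (\<lambda>t. x t \<bullet> s t + r t \<bullet> y t) (\<lambda>t. x t \<bullet> y t)"
proof -
  obtain L M where L: "L-lipschitz_on {a..b} x" and M: "negligible M"
    "\<And>t. t\<in>{a..b} - M \<Longrightarrow> (x has_vector_derivative r t) (at t within {a..b})"
    using assms(1) unfolding lip_primitive_def by blast
  obtain L' M' where L': "L'-lipschitz_on {a..b} y" and M': "negligible M'"
    "\<And>t. t\<in>{a..b} - M' \<Longrightarrow> (y has_vector_derivative s t) (at t within {a..b})"
    using assms(2) unfolding lip_primitive_def by blast
  have Lp: "L \<ge> 0" "L' \<ge> 0" using L L' lipschitz_on_nonneg by auto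
  obtain B where B: "\<And>t. t \<in> {a..b} \<Longrightarrow> norm (x t) \<le> B"
    using compact_continuous_image[OF lipschitz_on_continuous_on[OF L] compact_Icc]
    by (meson compact_imp_bounded bounded_iff image_eqI)
  obtain B' where B': "\<And>t. t \<in> {a..b} \<Longrightarrow> norm (y t) \<le> B'"
    using compact_continuous_image[OF lipschitz_on_continuous_on[OF L'] compact_Icc]
    by (meson compact_imp_bounded bounded_iff image_eqI)
  have "(\<bar>B\<bar> * L' + L * \<bar>B'\<bar>)-lipschitz_on {a..b} (\<lambda>t. x t \<bullet> y t)"
  proof (rule lipschitz_onI)
    fix t u assume tu: "t \<in> {a..b}" "u \<in> {a..b}"
    have "x t \<bullet> y t - x u \<bullet> y u = x t \<bullet> (y t - y u) + (x t - x u) \<bullet> y u"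
      by (simp add: inner_diff_left inner_diff_right)
    then have "\<bar>x t \<bullet> y t - x u \<bullet> y u\<bar> \<le> norm (x t) * norm (y t - y u) + norm (x t - x u) * norm (y u)"
      using Cauchy_Schwarz_ineq2[of "x t" "y t - y u"] Cauchy_Schwarz_ineq2[of "x t - x u" "y u"] by linarith
    also have "\<dots> \<le> \<bar>B\<bar> * (L' * dist t u) + (L * dist t u) * \<bar>B'\<bar>"
      using lipschitz_onD[OF L tu] lipschitz_onD[OF L' tu] B[OF tu(1)] B'[OF tu(2)] Lp
      by (intro add_mono mult_mono) (auto simp: dist_norm)
    finally show "dist (x t \<bullet> y t) (x u \<bullet> y u) \<le> (\<bar>B\<bar> * L' + L * \<bar>B'\<bar>) * dist t u"
      by (simp add: dist_norm algebra_simps)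
  qed (use Lp in auto)
  moreover have "((\<lambda>t. x t \<bullet> y t) has_vector_derivative x t \<bullet> s t + r t \<bullet> y t) (at t within {a..b})"
    if "t \<in> {a..b} - (M \<union> M')" for t
    using bounded_bilinear.has_vector_derivative[OF bounded_bilinear_inner M(2)[of t] M'(2)[of t]] that by blast
  ultimately show ?thesis unfolding lip_primitive_def using negligible_Un[OF M(1) M'(1)] by blast
qed

text \<open>The chain rule for a time change needs preimages of null sets to be null, which is why the
  inverse of the change is required to be Lipschitz.\<close>

lemma lip_primitive_reparam:
  fixes x :: "real \<Rightarrow> 'a::euclidean_space"
  assumes x: "lip_primitive a b r x"
    and \<rho>: "L-lipschitz_on {c..d} \<rho>" "\<rho> ` {c..d} \<subseteq> {a..b}"
    and \<sigma>: "L'-lipschitz_on UNIV \<sigma>" "\<And>t. t \<in> {c..d} \<Longrightarrow> \<sigma> (\<rho> t) = t"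
    and der: "finite F" "\<And>t. t \<in> {c..d} - F \<Longrightarrow> (\<rho> has_real_derivative \<rho>' t) (at t within {c..d})"
  shows "lip_primitive c d (\<lambda>t. \<rho>' t *\<^sub>R r (\<rho> t)) (\<lambda>t. x (\<rho> t))"
proof -
  obtain K M where K: "K-lipschitz_on {a..b} x" and M: "negligible M"
    "\<And>t. t\<in>{a..b} - M \<Longrightarrow> (x has_vector_derivative r t) (at t within {a..b})"
    using x unfolding lip_primitive_def by blast
  have "(K * L)-lipschitz_on {c..d} (\<lambda>t. x (\<rho> t))"
    by (rule lipschitz_on_compose2[OF \<rho>(1) lipschitz_on_subset[OF K \<rho>(2)]])
  moreover have \<sigma>L: "norm (\<sigma> y - \<sigma> t) \<le> L' * norm (y - t)" for y t
    using lipschitz_onD[OF \<sigma>(1), of y t] by (simp add: dist_norm)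
  have "negligible (\<sigma> ` M)"
  proof (rule negligible_locally_Lipschitz_image[OF _ M(1)])
    show "\<exists>T B. open T \<and> t \<in> T \<and> (\<forall>y\<in>M \<inter> T. norm (\<sigma> y - \<sigma> t) \<le> B * norm (y - t))" for t
      by (intro exI[of _ UNIV] exI[of _ L'] conjI ballI open_UNIV UNIV_I \<sigma>L)
  qed (rule order_refl)
  then have neg: "negligible (\<sigma> ` M \<union> F)" by (rule negligible_Un[OF _ negligible_finite[OF der(1)]])
  moreover have "((\<lambda>t. x (\<rho> t)) has_vector_derivative \<rho>' t *\<^sub>R r (\<rho> t)) (at t within {c..d})"
    if t: "t \<in> {c..d} - (\<sigma> ` M \<union> F)" for t
  proof -
    have tc: "t \<in> {c..d}" "t \<notin> \<sigma> ` M" using t by auto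
    have "\<rho> t \<notin> M" using tc(2) \<sigma>(2)[OF tc(1)] by (metis image_eqI)
    then have "\<rho> t \<in> {a..b} - M" using tc(1) \<rho>(2) by blast
    then have 1: "(x has_vector_derivative r (\<rho> t)) (at (\<rho> t) within \<rho> ` {c..d})"
      by (rule has_vector_derivative_within_subset[OF M(2) \<rho>(2)])
    have 2: "(\<rho> has_vector_derivative \<rho>' t) (at t within {c..d})"
      using der(2) t by (simp add: has_real_derivative_iff_has_vector_derivative)
    show ?thesis using vector_diff_chain_within[OF 2 1] by (simp add: o_def)
  qed
  ultimately show ?thesis unfolding lip_primitive_def
    using neg by (intro conjI exI[of _ "K * L"] exI[of _ "\<sigma> ` M \<union> F"]) auto
qed

section \<open>Differential equations with measurable right-hand side\<close>

lemma continuous_on_Icc_bounded: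
  fixes f :: "real \<Rightarrow> 'a::real_normed_vector"
  assumes "continuous_on {a..b} f"
  obtains M where "M > 0" "\<And>t. t \<in> {a..b} \<Longrightarrow> norm (f t) \<le> M"
  using compact_imp_bounded[OF compact_continuous_image[OF assms compact_Icc]]
  unfolding bounded_pos by auto

lemma measurable_bounded_integrable_on:
  fixes r :: "real \<Rightarrow> 'a::euclidean_space"
  assumes "r \<in> borel_measurable (lebesgue_on {a..b})" "\<And>t. t \<in> {a..b} \<Longrightarrow> norm (r t) \<le> B"
  shows "r integrable_on {a..b}"
  by (rule measurable_bounded_by_integrable_imp_integrable[OF assms(1) integrable_const_ivl assms(2)]) auto

lemma integral_exp_scaled:
  fixes L :: real
  assumes "L > 0" "0 \<le> t"
  shows "((\<lambda>s. exp (2 * L * s)) has_integral ((exp (2 * L * t) - 1) / (2*L))) {0..t}"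
proof -
  have "((\<lambda>s. exp (2 * L * s)) has_integral (exp (2 * L * t) / (2*L) - exp (2 * L * 0) / (2*L))) {0..t}"
  proof (rule fundamental_theorem_of_calculus[OF assms(2)])
    fix x assume "x \<in> {0..t}"
    have "((\<lambda>s. exp (2 * L * s) / (2*L)) has_real_derivative exp (2 * L * x)) (at x within {0..t})"
      using assms(1) by (auto intro!: derivative_eq_intros)
    then show "((\<lambda>s. exp (2 * L * s) / (2*L)) has_vector_derivative exp (2 * L * x)) (at x within {0..t})"
      by (simp add: has_real_derivative_iff_has_vector_derivative)
  qed
  then show ?thesis by (simp add: diff_divide_distrib)
qed

text \<open>In the norm weighted by \<open>exp (- 2 * L * t)\<close> the Picard operator has contraction factor \<open>1/2\<close>. The distance
  from an approximate solution to the fixed point is then at most twice the defect, which gives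
  existence and stability at once and makes a Gronwall inequality superfluous.\<close>

lemma caratheodory_solution_near:
  fixes h :: "real \<Rightarrow> 'a::euclidean_space \<Rightarrow> 'a"
  assumes T: "0 \<le> T" and L: "0 < L"
    and meas: "\<And>x. continuous_on {0..T} x \<Longrightarrow> (\<lambda>s. h s (x s)) \<in> borel_measurable (lebesgue_on {0..T})"
    and lip: "\<And>s x y. s \<in> {0..T} \<Longrightarrow> norm (h s x - h s y) \<le> L * norm (x - y)"
    and bnd: "\<And>s. s \<in> {0..T} \<Longrightarrow> norm (h s 0) \<le> B"
    and z: "continuous_on {0..T} z"
    and defect: "\<And>t. t \<in> {0..T} \<Longrightarrow> norm (z t - (x0 + integral {0..t} (\<lambda>s. h s (z s)))) \<le> \<kappa>"
  obtains x where "lip_primitive 0 T (\<lambda>s. h s (x s)) x" "x 0 = x0"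
    "\<And>t. t \<in> {0..T} \<Longrightarrow> norm (x t - z t) \<le> 2 * exp (2 * L * T) * \<kappa>"
proof -
  have hbound: "\<exists>M. \<forall>s\<in>{0..T}. norm (h s (x s)) \<le> M" if x: "continuous_on {0..T} x" for x
  proof -
    obtain M where M: "\<And>s. s \<in> {0..T} \<Longrightarrow> norm (x s) \<le> M"
      using compact_continuous_image[OF x compact_Icc] by (meson compact_imp_bounded bounded_iff image_eqI)
    have "norm (h s (x s)) \<le> B + L * M" if "s \<in> {0..T}" for s
    proof -
      have "norm (h s (x s)) \<le> norm (h s 0) + norm (h s (x s) - h s 0)" by (rule norm_triangle_sub)
      also have "\<dots> \<le> B + L * norm (x s)" using bnd[OF that] lip[OF that, of "x s" 0] by simp
      also have "\<dots> \<le> B + L * M" using M[OF that] L by simp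
      finally show ?thesis .
    qed
    then show ?thesis by blast
  qed
  have hint: "(\<lambda>s. h s (x s)) integrable_on {0..t}" if x: "continuous_on {0..T} x" and t: "t \<in> {0..T}" for x t
  proof -
    obtain M where "\<And>s. s\<in>{0..T} \<Longrightarrow> norm (h s (x s)) \<le> M" using hbound[OF x] by blast
    then have "(\<lambda>s. h s (x s)) integrable_on {0..T}"
      by (rule measurable_bounded_integrable_on[OF meas[OF x]])
    then show ?thesis by (rule integrable_on_subinterval) (use t in auto)
  qed
  \<comment> \<open>The complete space of bounded continuous functions is over the whole line, so
    time is clamped to \<open>{0..T}\<close>.\<close>
  define cl where "cl = (\<lambda>t::real. max 0 (min t T))"
  have cl: "cl t \<in> {0..T}" "t \<in> {0..T} \<Longrightarrow> cl t = t" for t using T by (auto simp: cl_def)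
  have clc: "continuous_on UNIV cl" unfolding cl_def by (intro continuous_intros)
  have lift: "(\<lambda>t. exp (- (2 * L * cl t)) *\<^sub>R w (cl t)) \<in> bcontfun" if w: "continuous_on {0..T} w"
    for w :: "real \<Rightarrow> 'a"
  proof -
    obtain M where M: "\<And>s. s \<in> {0..T} \<Longrightarrow> norm (w s) \<le> M"
      using compact_continuous_image[OF w compact_Icc] by (meson compact_imp_bounded bounded_iff image_eqI)
    have "continuous_on UNIV (\<lambda>t. w (cl t))"
      by (rule continuous_on_compose2[OF w clc]) (use cl in auto)
    then have c: "continuous_on UNIV (\<lambda>t. exp (- (2 * L * cl t)) *\<^sub>R w (cl t))"
      by (intro continuous_intros clc)
    have "norm (exp (- (2 * L * cl t)) *\<^sub>R w (cl t)) \<le> M" for t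
    proof -
      have "norm (exp (- (2 * L * cl t)) *\<^sub>R w (cl t)) = exp (- (2 * L * cl t)) * norm (w (cl t))" by simp
      also have "\<dots> \<le> 1 * norm (w (cl t))" using cl(1)[of t] L by (intro mult_right_mono) auto
      finally show ?thesis using M[OF cl(1)[of t]] by simp
    qed
    then show ?thesis using c unfolding bcontfun_def bounded_iff by blast
  qed
  \<comment> \<open>A point of the complete space is a weighted function. \<open>X\<close> removes
    the weight and \<open>lft\<close> restores it; they are inverse to each other on
    \<open>{0..T}\<close>.\<close>
  define X where "X = (\<lambda>(y :: real \<Rightarrow>\<^sub>C 'a) s. exp (2 * L * s) *\<^sub>R apply_bcontfun y s)"
  define I where "I = (\<lambda>w t. x0 + integral {0..t} (\<lambda>s. h s (w s)))"
  define lft where "lft = (\<lambda>w :: real \<Rightarrow> 'a. Bcontfun (\<lambda>t. exp (- (2 * L * cl t)) *\<^sub>R w (cl t)))"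
  have Xc: "continuous_on S (X y)" for y S unfolding X_def by (intro continuous_intros) simp
  have Ic: "continuous_on {0..T} (I w)" if "continuous_on {0..T} w" for w
    unfolding I_def using hint[OF that, of T] T
    by (intro continuous_on_add continuous_on_const indefinite_integral_continuous_1) auto
  have lft: "apply_bcontfun (lft w) t = exp (- (2 * L * cl t)) *\<^sub>R w (cl t)" if "continuous_on {0..T} w" for w t
    unfolding lft_def by (simp add: Bcontfun_inverse[OF lift[OF that]])
  have Xlft: "X (lft w) t = w t" if "continuous_on {0..T} w" "t \<in> {0..T}" for w t
    by (simp add: X_def lft[OF that(1)] cl(2)[OF that(2)] exp_minus)
  define \<Phi> where "\<Phi> = (\<lambda>y. lft (I (X y)))"
  have contr: "dist (\<Phi> y) (\<Phi> y') \<le> 1/2 * dist y y'" for y y'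
  proof (rule dist_bound)
    fix t0 define t where "t = cl t0"
    have t: "t \<in> {0..T}" using cl(1) t_def by simp
    let ?D = "dist y y'"
    have i: "(\<lambda>s. h s (X y s)) integrable_on {0..t}" "(\<lambda>s. h s (X y' s)) integrable_on {0..t}"
      using hint[OF Xc t] by auto
    have e: "((\<lambda>s. (L * ?D) * exp (2 * L * s)) has_integral ((L * ?D) * ((exp (2 * L * t) - 1) / (2*L)))) {0..t}"
      using integral_exp_scaled[OF L, of t] t by (intro has_integral_mult_right) auto
    have "norm (I (X y) t - I (X y') t) = norm (integral {0..t} (\<lambda>s. h s (X y s) - h s (X y' s)))"
      using i by (simp add: I_def Henstock_Kurzweil_Integration.integral_diff)
    also have "\<dots> \<le> integral {0..t} (\<lambda>s. (L * ?D) * exp (2 * L * s))"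
    proof (rule integral_norm_bound_integral[OF integrable_diff[OF i] has_integral_integrable[OF e]])
      fix s assume s: "s \<in> {0..t}"
      have "norm (h s (X y s) - h s (X y' s)) \<le> L * norm (X y s - X y' s)"
        using lip s t by auto
      also have "norm (X y s - X y' s) = exp (2 * L * s) * dist (apply_bcontfun y s) (apply_bcontfun y' s)"
        unfolding X_def dist_norm scaleR_diff_right[symmetric] by simp
      also have "\<dots> \<le> exp (2 * L * s) * ?D" by (intro mult_left_mono dist_bounded) auto
      finally show "norm (h s (X y s) - h s (X y' s)) \<le> (L * ?D) * exp (2 * L * s)"
        using L by (simp add: algebra_simps)
    qed
    also have "\<dots> = ?D * (exp (2 * L * t) - 1) / 2" using integral_unique[OF e] L by simp
    also have "\<dots> \<le> ?D * exp (2 * L * t) / 2" by (intro divide_right_mono mult_left_mono) auto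
    finally have *: "norm (I (X y) t - I (X y') t) \<le> ?D * exp (2 * L * t) / 2" .
    have "dist (apply_bcontfun (\<Phi> y) t0) (apply_bcontfun (\<Phi> y') t0) = exp (- (2 * L * t)) * norm (I (X y) t - I (X y') t)"
      unfolding \<Phi>_def lft[OF Ic[OF Xc]] dist_norm t_def[symmetric] scaleR_diff_right[symmetric] by simp
    also have "\<dots> \<le> exp (- (2 * L * t)) * (?D * exp (2 * L * t) / 2)"
      by (rule mult_left_mono[OF *]) simp
    also have "\<dots> = 1/2 * ?D" by (simp add: exp_minus)
    finally show "dist (apply_bcontfun (\<Phi> y) t0) (apply_bcontfun (\<Phi> y') t0) \<le> 1/2 * ?D" .
  qed
  have "\<exists>!y. \<Phi> y = y" by (rule banach_fix_type[of "1/2"]) (use contr in auto)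
  then obtain y where y: "\<Phi> y = y" by blast
  define x where "x = X y"
  have xI: "x t = I x t" if "t \<in> {0..T}" for t
    using Xlft[OF Ic[OF Xc] that, of y] y by (simp add: x_def \<Phi>_def)
  have xc: "continuous_on {0..T} x" unfolding x_def by (rule Xc)
  obtain M where M: "\<And>s. s\<in>{0..T} \<Longrightarrow> norm (h s (x s)) \<le> M" using hbound[OF xc] by blast
  have "lip_primitive 0 T (\<lambda>s. h s (x s)) x"
    by (rule integral_lip_primitive[OF hint[OF xc] M]) (use xI T in \<open>auto simp: I_def\<close>)
  moreover have "x 0 = x0" using xI[of 0] T by (simp add: I_def)
  moreover have "norm (x t - z t) \<le> 2 * exp (2 * L * T) * \<kappa>" if t: "t \<in> {0..T}" for t
  proof -
    let ?z = "lft z"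
    have k0: "\<kappa> \<ge> 0" using order_trans[OF norm_ge_zero defect[of 0]] T by simp
    have Iz: "I (X ?z) s = I z s" if "s \<in> {0..T}" for s
    proof -
      have "integral {0..s} (\<lambda>r. h r (X ?z r)) = integral {0..s} (\<lambda>r. h r (z r))"
        by (rule integral_cong) (use Xlft[OF z] that in auto)
      then show ?thesis by (simp add: I_def)
    qed
    have "dist (\<Phi> ?z) ?z \<le> \<kappa>"
    proof (rule dist_bound)
      fix t0 define s where "s = cl t0"
      have s: "s \<in> {0..T}" using cl(1) s_def by simp
      have "dist (apply_bcontfun (\<Phi> ?z) t0) (apply_bcontfun ?z t0) = exp (- (2 * L * s)) * norm (z s - I z s)"
        unfolding \<Phi>_def lft[OF Ic[OF Xc]] lft[OF z] dist_norm s_def[symmetric] Iz[OF s]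
          scaleR_diff_right[symmetric] by (simp add: norm_minus_commute)
      also have "\<dots> \<le> 1 * \<kappa>" using defect[OF s] s L by (intro mult_mono) (auto simp: I_def)
      finally show "dist (apply_bcontfun (\<Phi> ?z) t0) (apply_bcontfun ?z t0) \<le> \<kappa>" by simp
    qed
    moreover have "dist y ?z \<le> dist (\<Phi> y) (\<Phi> ?z) + dist (\<Phi> ?z) ?z"
      using dist_triangle[of y ?z "\<Phi> ?z"] y by simp
    ultimately have "dist y ?z \<le> 2 * \<kappa>" using contr[of y ?z] by simp
    then have d: "norm (apply_bcontfun y t - apply_bcontfun ?z t) \<le> 2 * \<kappa>"
      using dist_bounded[of y t ?z] by (simp add: dist_norm)
    have "x t - z t = exp (2 * L * t) *\<^sub>R (apply_bcontfun y t - apply_bcontfun ?z t)"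
      using Xlft[OF z t] by (simp add: x_def X_def scaleR_diff_right)
    then have "norm (x t - z t) = exp (2 * L * t) * norm (apply_bcontfun y t - apply_bcontfun ?z t)" by simp
    also have "\<dots> \<le> exp (2 * L * T) * (2 * \<kappa>)"
      using d t L k0 by (intro mult_mono) auto
    finally show ?thesis by (simp add: mult_ac)
  qed
  ultimately show ?thesis by (rule that)
qed

text \<open>A Lebesgue measurable function of a continuous one may fail to be measurable. Here a
  preimage is split into a Borel set, pulled back by continuity, and a null set, whose pullback lies
  in its Lipschitz image under \<sigma> and is null again.\<close>

lemma borel_measurable_lebesgue_on_reparam:
  fixes \<rho> \<sigma> :: "real \<Rightarrow> real" and g :: "real \<Rightarrow> 'b::topological_space"
  assumes g: "g \<in> borel_measurable (lebesgue_on {a..b})"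
    and \<rho>: "continuous_on {c..d} \<rho>" "\<rho> ` {c..d} \<subseteq> {a..b}"
    and \<sigma>: "L'-lipschitz_on UNIV \<sigma>" "\<And>t. t \<in> {c..d} \<Longrightarrow> \<sigma> (\<rho> t) = t"
  shows "(\<lambda>t. g (\<rho> t)) \<in> borel_measurable (lebesgue_on {c..d})"
proof (rule measurableI)
  fix A :: "'b set" assume A: "A \<in> sets borel"
  define E where "E = g -` A \<inter> {a..b}"
  have "E \<in> sets (lebesgue_on {a..b})" using measurable_sets[OF g A] by (simp add: E_def)
  then have "E \<in> sets lebesgue" by (simp add: sets_restrict_space_iff)
  then obtain S N N' where S: "E = S \<union> N" "N \<subseteq> N'" "N' \<in> null_sets lborel" "S \<in> sets lborel"
    using sets_completionE[of E lborel] by metis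
  have N: "negligible N" using S(2,3) by (meson negligible_iff_null_sets negligible_subset null_sets_completionI)
  have \<sigma>L: "norm (\<sigma> y - \<sigma> t) \<le> L' * norm (y - t)" for y t
    using lipschitz_onD[OF \<sigma>(1), of y t] by (simp add: dist_norm)
  have "negligible (\<sigma> ` N)"
  proof (rule negligible_locally_Lipschitz_image[OF _ N])
    show "\<exists>T B. open T \<and> t \<in> T \<and> (\<forall>y\<in>N \<inter> T. norm (\<sigma> y - \<sigma> t) \<le> B * norm (y - t))" for t
      by (intro exI[of _ UNIV] exI[of _ L'] conjI ballI open_UNIV UNIV_I \<sigma>L)
  qed (rule order_refl)
  moreover have "\<rho> -` N \<inter> {c..d} \<subseteq> \<sigma> ` N" using \<sigma>(2) by (force simp: image_iff)
  ultimately have "negligible (\<rho> -` N \<inter> {c..d})" by (rule negligible_subset)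
  then have 1: "\<rho> -` N \<inter> {c..d} \<in> sets lebesgue" by (rule negligible_imp_sets)
  have "\<rho> \<in> borel_measurable (restrict_space borel {c..d})"
    by (rule borel_measurable_continuous_on_restrict[OF \<rho>(1)])
  then have "\<rho> -` S \<inter> {c..d} \<in> sets (restrict_space borel {c..d})"
    using measurable_sets[of \<rho> "restrict_space borel {c..d}" borel S] S(4) by (simp add: space_restrict_space)
  then have 2: "\<rho> -` S \<inter> {c..d} \<in> sets lebesgue"
    by (simp add: sets_restrict_space_iff)
  have "(\<lambda>t. g (\<rho> t)) -` A \<inter> {c..d} = (\<rho> -` S \<inter> {c..d}) \<union> (\<rho> -` N \<inter> {c..d})"
    using S(1) \<rho>(2) unfolding E_def by blast
  then have "(\<lambda>t. g (\<rho> t)) -` A \<inter> {c..d} \<in> sets lebesgue" using sets.Un[OF 2 1] by simp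
  then show "(\<lambda>t. g (\<rho> t)) -` A \<inter> space (lebesgue_on {c..d}) \<in> sets (lebesgue_on {c..d})"
    by (simp add: sets_restrict_space_iff)
qed simp

text \<open>Time reversal turns the terminal condition into an initial one. The constant
  \<open>pT\<close> is used as the approximate solution; its defect is bounded by continuity, and
  only existence is extracted.\<close>

lemma caratheodory_backward:
  fixes A :: "real \<Rightarrow> 'a::euclidean_space \<Rightarrow> 'a"
  assumes T: "0 \<le> T" and L: "0 < L"
    and meas: "\<And>x. continuous_on {0..T} x \<Longrightarrow> (\<lambda>s. A s (x s)) \<in> borel_measurable (lebesgue_on {0..T})"
    and lip: "\<And>s x y. s \<in> {0..T} \<Longrightarrow> norm (A s x - A s y) \<le> L * norm (x - y)"
    and bnd: "\<And>s. s \<in> {0..T} \<Longrightarrow> norm (A s 0) \<le> B"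
  obtains p where "lip_primitive 0 T (\<lambda>s. - A s (p s)) p" "p T = pT"
proof -
  define \<rho> where "\<rho> = (\<lambda>t. T - t)"
  have \<rho>c: "continuous_on S \<rho>" for S unfolding \<rho>_def by (intro continuous_intros)
  have \<rho>i: "\<rho> ` {0..T} \<subseteq> {0..T}" by (auto simp: \<rho>_def)
  have \<rho>l: "1-lipschitz_on S \<rho>" for S by (rule lipschitz_onI) (auto simp: \<rho>_def dist_norm)
  have \<rho>\<rho>: "\<rho> (\<rho> t) = t" for t by (simp add: \<rho>_def)
  define h where "h = (\<lambda>s. A (\<rho> s))"
  have hm: "(\<lambda>s. h s (x s)) \<in> borel_measurable (lebesgue_on {0..T})" if x: "continuous_on {0..T} x" for x
  proof -
    have "continuous_on {0..T} (\<lambda>s. x (\<rho> s))"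
      by (rule continuous_on_compose2[OF x \<rho>c \<rho>i])
    from borel_measurable_lebesgue_on_reparam[OF meas[OF this] \<rho>c \<rho>i \<rho>l \<rho>\<rho>]
    show ?thesis by (simp add: h_def \<rho>\<rho>)
  qed
  have hl: "norm (h s x - h s y) \<le> L * norm (x - y)" and hb: "norm (h s 0) \<le> B" if "s \<in> {0..T}" for s x y
    using lip bnd that by (auto simp: h_def \<rho>_def)
  define z where "z = (\<lambda>t::real. pT)"
  have zc: "continuous_on {0..T} z" unfolding z_def by (intro continuous_intros)
  have "(\<lambda>s. h s (z s)) integrable_on {0..T}"
  proof (rule measurable_bounded_integrable_on[OF hm[OF zc]])
    show "norm (h s (z s)) \<le> B + L * norm pT" if "s \<in> {0..T}" for s
      using norm_triangle_sub[of "h s pT" "h s 0"] hl[OF that, of pT 0] hb[OF that] by (simp add: z_def)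
  qed
  then have "continuous_on {0..T} (\<lambda>t. z t - (pT + integral {0..t} (\<lambda>s. h s (z s))))"
    unfolding z_def by (intro continuous_intros indefinite_integral_continuous_1)
  from continuous_on_Icc_bounded[OF this] obtain \<kappa> where "\<And>t. t \<in> {0..T} \<Longrightarrow> norm (z t - (pT + integral {0..t} (\<lambda>s. h s (z s)))) \<le> \<kappa>"
    by blast
  from caratheodory_solution_near[OF T L hm hl hb zc this]
  obtain x where x: "lip_primitive 0 T (\<lambda>s. h s (x s)) x" "x 0 = pT" by blast
  have "lip_primitive 0 T (\<lambda>t. (-1) *\<^sub>R h (\<rho> t) (x (\<rho> t))) (\<lambda>t. x (\<rho> t))"
    by (rule lip_primitive_reparam[OF x(1) \<rho>l \<rho>i \<rho>l \<rho>\<rho> finite.emptyI])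
       (auto simp: \<rho>_def intro!: derivative_eq_intros)
  then have "lip_primitive 0 T (\<lambda>t. - A t (x (\<rho> t))) (\<lambda>t. x (\<rho> t))"
    by (simp add: h_def \<rho>\<rho>)
  moreover have "x (\<rho> T) = pT" using x(2) by (simp add: \<rho>_def)
  ultimately show ?thesis by (rule that)
qed

section \<open>Bounded multipliers for pointwise constraints\<close>

text \<open>Converts the integral inequalities obtained from test directions into pointwise
  statements.\<close>

lemma integral_nonneg_le_0_AE:
  fixes f :: "real \<Rightarrow> real"
  assumes f: "f \<in> borel_measurable (lebesgue_on {a..b})" "\<And>t. t \<in> {a..b} \<Longrightarrow> f t \<le> B"
    and pos: "\<And>t. t \<in> {a..b} \<Longrightarrow> 0 \<le> f t" and int: "integral {a..b} f \<le> 0"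
  shows "\<exists>N. negligible N \<and> (\<forall>t\<in>{a..b} - N. f t = 0)"
proof -
  have "f absolutely_integrable_on {a..b}"
    by (rule measurable_bounded_by_integrable_imp_absolutely_integrable[OF f(1) _ integrable_const_ivl[of B]])
       (use f(2) pos in auto)
  then have i: "integrable (lebesgue_on {a..b}) f"
    by (simp add: integrable_restrict_space set_integrable_def)
  have "integral\<^sup>L (lebesgue_on {a..b}) f = integral {a..b} f"
    by (rule lebesgue_integral_eq_integral[OF i]) simp
  moreover have "integral\<^sup>L (lebesgue_on {a..b}) f \<ge> 0"
    by (rule integral_nonneg_AE) (use pos in \<open>auto intro!: AE_I2\<close>)
  ultimately have "integral\<^sup>L (lebesgue_on {a..b}) f = 0" using int by simp
  then have "AE t in lebesgue_on {a..b}. f t = 0"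
    by (subst (asm) integral_nonneg_eq_0_iff_AE[OF i]) (use pos in \<open>auto intro!: AE_I2\<close>)
  then show ?thesis by (simp add: AE_lebesgue_on_iff)
qed

section \<open>Measurable dual vectors of the active gradients\<close>

lemma borel_measurable_det:
  fixes F :: "'l::finite \<Rightarrow> 'l \<Rightarrow> 'a \<Rightarrow> real"
  assumes "\<And>i j. (\<lambda>t. F i j t) \<in> borel_measurable M"
  shows "(\<lambda>t. det (\<chi> i j. F i j t)) \<in> borel_measurable M"
  unfolding det_def vec_lambda_beta
  by (intro borel_measurable_sum borel_measurable_times borel_measurable_const borel_measurable_prod assms)

text \<open>The dual vectors come from inverting the Gram matrix by Cramer's rule; the diagonal is set to one
  at the inactive indices, where the vectors vanish.\<close>

lemma measurable_dual_system:
  fixes a :: "'l::finite \<Rightarrow> real \<Rightarrow> 'b::euclidean_space" and J :: "real \<Rightarrow> 'l set"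
  assumes meas: "\<And>i. a i \<in> borel_measurable M"
    and J: "\<And>i. (\<lambda>t. if i \<in> J t then 1 else 0 :: real) \<in> borel_measurable M"
    and zero: "\<And>i t. t \<in> space M \<Longrightarrow> i \<notin> J t \<Longrightarrow> a i t = 0"
    and bound: "\<And>i t. t \<in> space M \<Longrightarrow> norm (a i t) \<le> B"
    and eps: "\<epsilon> > 0"
    and qual: "\<And>t \<xi>. t \<in> space M \<Longrightarrow> (\<And>i. i \<notin> J t \<Longrightarrow> \<xi> $ i = 0) \<Longrightarrow>
        \<epsilon> * norm (\<xi> :: real^'l) \<le> norm (\<Sum>i\<in>UNIV. \<xi> $ i *\<^sub>R a i t)"
  obtains d :: "'l \<Rightarrow> real \<Rightarrow> 'b" and x :: "'l \<Rightarrow> 'l \<Rightarrow> real \<Rightarrow> real" and C :: real where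
    "\<And>i. d i \<in> borel_measurable M" "\<And>i t. t \<in> space M \<Longrightarrow> norm (d i t) \<le> C"
    "\<And>i t. d i t = (\<Sum>k\<in>UNIV. x i k t *\<^sub>R a k t)"
    "\<And>i k t. t \<in> space M \<Longrightarrow> a k t \<bullet> d i t = (if k = i \<and> i \<in> J t then 1 else 0)"
proof -
  \<comment> \<open>Coercivity constant of the modified Gram matrix: \<epsilon> squared on the
    active block, 1 on the diagonal added at inactive indices.\<close>
  define m where "m = min (\<epsilon>\<^sup>2) 1"
  have m: "m > 0" "m \<le> \<epsilon>\<^sup>2" "m \<le> 1" using eps by (auto simp: m_def)
  define g where "g = (\<lambda>i j t. a i t \<bullet> a j t + (if i = j then 1 - (if i \<in> J t then 1 else 0 :: real) else 0))"
  define G where "G = (\<lambda>t. \<chi> i j. g i j t)"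
  have gm: "(\<lambda>t. g i j t) \<in> borel_measurable M" for i j
  proof (cases "i = j")
    case True
    then show ?thesis unfolding g_def
      by simp (intro borel_measurable_add borel_measurable_diff borel_measurable_const J borel_measurable_inner meas)
  next
    case False
    then show ?thesis unfolding g_def by simp (intro borel_measurable_inner meas)
  qed
  have Gv: "(G t *v \<xi>) $ i = a i t \<bullet> (\<Sum>j\<in>UNIV. \<xi> $ j *\<^sub>R a j t) + (if i \<in> J t then 0 else \<xi> $ i)" for t \<xi> i
  proof -
    have "(G t *v \<xi>) $ i = (\<Sum>j\<in>UNIV. (a i t \<bullet> a j t) * \<xi> $ j +
        (if i = j then (1 - (if i \<in> J t then 1 else 0)) * \<xi> $ j else 0))"
      unfolding G_def g_def matrix_vector_mult_def vec_lambda_beta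
      by (intro sum.cong) (auto simp: algebra_simps)
    also have "\<dots> = a i t \<bullet> (\<Sum>j\<in>UNIV. \<xi> $ j *\<^sub>R a j t) + (if i \<in> J t then 0 else \<xi> $ i)"
      by (simp add: sum.distrib inner_sum_right mult.commute)
    finally show ?thesis .
  qed
  have lower: "m * norm \<xi> \<le> norm (G t *v \<xi>)" if t: "t \<in> space M" for t \<xi>
  proof -
    define \<zeta> :: "real^'l" where "\<zeta> = (\<chi> i. if i \<in> J t then \<xi> $ i else 0)"
    define s where "s = (\<Sum>j\<in>UNIV. \<xi> $ j *\<^sub>R a j t)"
    have s: "s = (\<Sum>j\<in>UNIV. \<zeta> $ j *\<^sub>R a j t)"
      unfolding s_def \<zeta>_def by (intro sum.cong) (auto simp: zero[OF t])
    have "\<epsilon> * norm \<zeta> \<le> norm s" unfolding s by (rule qual[OF t]) (simp add: \<zeta>_def)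
    then have "(\<epsilon> * norm \<zeta>)\<^sup>2 \<le> (norm s)\<^sup>2" using eps by (intro power_mono) auto
    then have s2: "\<epsilon>\<^sup>2 * (\<Sum>i\<in>UNIV. \<zeta> $ i * \<zeta> $ i) \<le> s \<bullet> s"
      by (simp add: power_mult_distrib power2_norm_eq_inner inner_vec_def)
    have "\<xi> \<bullet> (G t *v \<xi>) = (\<Sum>i\<in>UNIV. \<xi> $ i * (a i t \<bullet> s) + (if i \<in> J t then 0 else \<xi> $ i * \<xi> $ i))"
      unfolding inner_vec_def Gv s_def[symmetric] by (intro sum.cong) (auto simp: algebra_simps)
    also have "\<dots> = s \<bullet> s + (\<Sum>i\<in>UNIV. if i \<in> J t then 0 else \<xi> $ i * \<xi> $ i)"
      by (simp add: sum.distrib s_def inner_sum_left)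
    finally have q: "\<xi> \<bullet> (G t *v \<xi>) = s \<bullet> s + (\<Sum>i\<in>UNIV. if i \<in> J t then 0 else \<xi> $ i * \<xi> $ i)" .
    have "m * (norm \<xi>)\<^sup>2 = (\<Sum>i\<in>UNIV. m * (\<zeta> $ i * \<zeta> $ i) + m * (if i \<in> J t then 0 else \<xi> $ i * \<xi> $ i))"
      unfolding power2_norm_eq_inner inner_vec_def sum_distrib_left
      by (intro sum.cong) (auto simp: \<zeta>_def)
    also have "\<dots> \<le> (\<Sum>i\<in>UNIV. \<epsilon>\<^sup>2 * (\<zeta> $ i * \<zeta> $ i) + (if i \<in> J t then 0 else \<xi> $ i * \<xi> $ i))"
    proof (intro sum_mono add_mono)
      fix i
      show "m * (\<zeta> $ i * \<zeta> $ i) \<le> \<epsilon>\<^sup>2 * (\<zeta> $ i * \<zeta> $ i)" by (rule mult_right_mono[OF m(2)]) simp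
      show "m * (if i \<in> J t then 0 else \<xi> $ i * \<xi> $ i) \<le> (if i \<in> J t then 0 else \<xi> $ i * \<xi> $ i)"
        using mult_right_mono[OF m(3), of "\<xi> $ i * \<xi> $ i"] by auto
    qed
    also have "\<dots> \<le> \<xi> \<bullet> (G t *v \<xi>)" unfolding q sum.distrib sum_distrib_left[symmetric] using s2 by simp
    also have "\<dots> \<le> norm \<xi> * norm (G t *v \<xi>)" by (rule norm_cauchy_schwarz)
    finally have "norm \<xi> * (m * norm \<xi>) \<le> norm \<xi> * norm (G t *v \<xi>)"
      by (simp add: power2_eq_square algebra_simps)
    then show ?thesis by (cases "\<xi> = 0") auto
  qed
  have detG: "det (G t) \<noteq> 0" if t: "t \<in> space M" for t
  proof -
    have "inj ((*v) (G t))"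
    proof (rule injI)
      fix \<xi> \<zeta> assume "G t *v \<xi> = G t *v \<zeta>"
      then have "G t *v (\<xi> - \<zeta>) = 0" by (simp add: matrix_vector_mult_diff_distrib)
      then show "\<xi> = \<zeta>" using lower[OF t, of "\<xi> - \<zeta>"] m(1) by (simp add: mult_le_0_iff)
    qed
    then show ?thesis by (metis invertible_det_nz matrix_left_invertible_injective invertible_left_inverse)
  qed
  \<comment> \<open>Cramer's rule for the i-th column of the inverse Gram matrix. Determinants are
    polynomials in the entries, so measurability in \<open>t\<close> is automatic.\<close>
  define x where "x = (\<lambda>i k t. det (\<chi> p q. if q = k then axis i 1 $ p else g p q t) / det (G t))"
  have xm: "x i k \<in> borel_measurable M" for i k
  proof -
    have "(\<lambda>t. if q = k then axis i 1 $ p else g p q t) \<in> borel_measurable M" for p q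
      by (cases "q = k") (auto simp: gm)
    then show ?thesis unfolding x_def G_def
      by (intro borel_measurable_divide borel_measurable_det gm) auto
  qed
  have Gx: "G t *v (\<chi> k. x i k t) = axis i 1" if t: "t \<in> space M" for t i
  proof -
    have "(\<chi> k. x i k t) = (\<chi> k. det (\<chi> p q. if q = k then axis i 1 $ p else G t $ p $ q) / det (G t))"
      unfolding x_def G_def vec_lambda_beta ..
    then show ?thesis using cramer[OF detG[OF t]] by blast
  qed
  define d where "d = (\<lambda>i t. \<Sum>k\<in>UNIV. x i k t *\<^sub>R a k t)"
  show ?thesis
  proof (rule that[of d "real CARD('l) * (1 / m * \<bar>B\<bar>)" x])
    show "d i \<in> borel_measurable M" for i unfolding d_def
      by (intro borel_measurable_sum borel_measurable_scaleR xm meas)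
    show "d i t = (\<Sum>k\<in>UNIV. x i k t *\<^sub>R a k t)" for i t by (simp add: d_def)
    show "norm (d i t) \<le> real CARD('l) * (1 / m * \<bar>B\<bar>)" if t: "t \<in> space M" for i t
    proof -
      have "m * norm (\<chi> k. x i k t) \<le> 1" using lower[OF t, of "\<chi> k. x i k t"] Gx[OF t, of i] by simp
      then have "norm (\<chi> k. x i k t) \<le> 1 / m" using m(1) by (simp add: field_simps)
      then have xb: "\<bar>x i k t\<bar> \<le> 1 / m" for k
        using component_le_norm_cart[of "\<chi> k. x i k t" k] by simp
      have "norm (d i t) \<le> (\<Sum>k\<in>UNIV. norm (x i k t *\<^sub>R a k t))" unfolding d_def by (rule norm_sum)
      also have "\<dots> \<le> (\<Sum>k\<in>(UNIV::'l set). 1 / m * \<bar>B\<bar>)"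
      proof (rule sum_mono)
        fix k
        have "norm (a k t) \<le> \<bar>B\<bar>" using bound[OF t, of k] by simp
        then show "norm (x i k t *\<^sub>R a k t) \<le> 1 / m * \<bar>B\<bar>"
          unfolding norm_scaleR by (intro mult_mono xb) (use m in auto)
      qed
      finally show ?thesis by simp
    qed
    show "a k t \<bullet> d i t = (if k = i \<and> i \<in> J t then 1 else 0)" if t: "t \<in> space M" for i k t
    proof (cases "k \<in> J t")
      case True
      have "(G t *v (\<chi> k. x i k t)) $ k = a k t \<bullet> d i t" unfolding Gv d_def using True by simp
      then show ?thesis using True unfolding Gx[OF t] by (cases "k = i") (auto simp: axis_def)
    next
      case False
      then show ?thesis by (auto simp: zero[OF t])
    qed
  qed
qed

text \<open>The control constraints detached from the dynamics: \<gamma> i t stands for the i-th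
  constraint value at the control and \<open>a i t\<close> for its gradient, set to zero where the
  constraint is inactive, so that all sums may run over the full index type.\<close>

locale active_gradients =
  fixes a :: "'l::finite \<Rightarrow> real \<Rightarrow> 'b::euclidean_space" and \<gamma> :: "'l \<Rightarrow> real \<Rightarrow> real"
    and t0 t1 B \<delta> \<epsilon> :: real
  assumes a: "\<And>i. a i \<in> borel_measurable (lebesgue_on {t0..t1})" "\<And>i t. t \<in> {t0..t1} \<Longrightarrow> norm (a i t) \<le> B"
    and \<gamma>: "\<And>i. \<gamma> i \<in> borel_measurable (lebesgue_on {t0..t1})"
    and zero: "\<And>i t. t \<in> {t0..t1} \<Longrightarrow> \<gamma> i t < - \<delta> \<Longrightarrow> a i t = 0"
    and \<delta>: "\<delta> > 0"
    and eps: "\<epsilon> > 0"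
    and qual: "\<And>t \<xi>. t \<in> {t0..t1} \<Longrightarrow> (\<And>i. \<gamma> i t < - \<delta> \<Longrightarrow> \<xi> $ i = 0) \<Longrightarrow>
        \<epsilon> * norm (\<xi> :: real^'l) \<le> norm (\<Sum>i\<in>UNIV. \<xi> $ i *\<^sub>R a i t)"
begin

lemma active_dual_system:
  "\<exists>(d :: 'l \<Rightarrow> real \<Rightarrow> 'b) (x :: 'l \<Rightarrow> 'l \<Rightarrow> real \<Rightarrow> real) D.
    (\<forall>i. d i \<in> borel_measurable (lebesgue_on {t0..t1})) \<and> (\<forall>i. \<forall>t\<in>{t0..t1}. norm (d i t) \<le> D) \<and>
    (\<forall>i t. d i t = (\<Sum>k\<in>UNIV. x i k t *\<^sub>R a k t)) \<and>
    (\<forall>i k. \<forall>t\<in>{t0..t1}. a k t \<bullet> d i t = (if k = i \<and> \<gamma> i t \<ge> - \<delta> then 1 else 0))"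
    (is ?ex)
proof -
  let ?S = "{t0..t1}" and ?M = "lebesgue_on {t0..t1}"
  have sp: "space ?M = ?S" by simp
  define J where "J = (\<lambda>t. {i. \<gamma> i t \<ge> - \<delta>})"
  have Jm: "(\<lambda>t. if i \<in> J t then 1 else 0 :: real) \<in> borel_measurable ?M" for i
    unfolding J_def mem_Collect_eq using \<gamma>[of i] by measurable
  have zJ: "a i t = 0" if "t \<in> ?S" "i \<notin> J t" for i t using zero that by (auto simp: J_def)
  have qJ: "\<epsilon> * norm \<xi> \<le> norm (\<Sum>i\<in>UNIV. \<xi> $ i *\<^sub>R a i t)"
    if "t \<in> ?S" "\<And>i. i \<notin> J t \<Longrightarrow> \<xi> $ i = 0" for t \<xi>
    by (rule qual[OF that(1)]) (rule that(2), simp add: J_def)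
  show ?ex
  proof (rule measurable_dual_system[of a ?M J B \<epsilon>, unfolded sp])
    fix d :: "'l \<Rightarrow> real \<Rightarrow> 'b" and x :: "'l \<Rightarrow> 'l \<Rightarrow> real \<Rightarrow> real" and D :: real
    assume *: "\<And>i. d i \<in> borel_measurable ?M" "\<And>i t. t \<in> ?S \<Longrightarrow> norm (d i t) \<le> D"
      "\<And>i t. d i t = (\<Sum>k\<in>UNIV. x i k t *\<^sub>R a k t)"
      "\<And>i k t. t \<in> ?S \<Longrightarrow> a k t \<bullet> d i t = (if k = i \<and> i \<in> J t then 1 else 0)"
    show ?ex
      by (rule exI[of _ d], rule exI[of _ x], rule exI[of _ D])
        (intro conjI allI ballI *(1-3) *(4)[unfolded J_def mem_Collect_eq]; assumption)
  qed ((rule a(1) Jm eps) | (rule zJ qJ a(2), assumption+) | (rule qJ, assumption, blast))+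
qed

text \<open>Minus the sum of the dual vectors works, because an active gradient meets only its own
  dual vector.\<close>

lemma inward_direction_exists:
  "\<exists>w C. w \<in> borel_measurable (lebesgue_on {t0..t1}) \<and> (\<forall>t\<in>{t0..t1}. norm (w t) \<le> C) \<and>
    (\<forall>i. \<forall>t\<in>{t0..t1}. \<gamma> i t \<ge> - \<delta> \<longrightarrow> a i t \<bullet> w t = - 1)"
proof -
  let ?S = "{t0..t1}" and ?M = "lebesgue_on {t0..t1}"
  obtain d :: "'l \<Rightarrow> real \<Rightarrow> 'b" and x :: "'l \<Rightarrow> 'l \<Rightarrow> real \<Rightarrow> real" and D where
    d: "\<forall>i. d i \<in> borel_measurable ?M" "\<forall>i. \<forall>t\<in>?S. norm (d i t) \<le> D"
    "\<forall>i t. d i t = (\<Sum>k\<in>UNIV. x i k t *\<^sub>R a k t)"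
    "\<forall>i k. \<forall>t\<in>?S. a k t \<bullet> d i t = (if k = i \<and> \<gamma> i t \<ge> - \<delta> then 1 else 0)"
    using active_dual_system by (elim exE conjE)
  define w where "w = (\<lambda>t. - (\<Sum>i\<in>UNIV. d i t))"
  have "w \<in> borel_measurable ?M" unfolding w_def
    by (intro borel_measurable_uminus borel_measurable_sum d(1)[rule_format])
  moreover have "norm (w t) \<le> real CARD('l) * D" if "t \<in> ?S" for t
  proof -
    have "norm (w t) \<le> (\<Sum>i\<in>(UNIV::'l set). D)" unfolding w_def norm_minus_cancel
      by (rule sum_norm_le) (use d(2) that in auto)
    then show ?thesis by simp
  qed
  moreover have "a k t \<bullet> w t = - 1" if t: "t \<in> ?S" "\<gamma> k t \<ge> - \<delta>" for k t
  proof -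
    have "a k t \<bullet> w t = - (\<Sum>i\<in>UNIV. if i = k then 1 else 0)"
      unfolding w_def inner_minus_right inner_sum_right using d(4) t
      by (intro arg_cong[where f=uminus] sum.cong) auto
    then show ?thesis by simp
  qed
  ultimately show ?thesis by blast
qed

text \<open>The tests are \<open>- R\<close>, where \<open>R\<close> is the part of \<open>P\<close> orthogonal to the active gradients, then \<open>- d i\<close> where
  \<open>\<mu> i < 0\<close>, and \<open>d i\<close> where \<open>\<mu> i > 0\<close> although \<open>\<gamma> i\<close> is bounded away from zero. A small multiple of an inward
  direction makes each of them admissible.\<close>

lemma bounded_multiplier_exists:
  fixes P :: "real \<Rightarrow> 'b"
  assumes P: "P \<in> borel_measurable (lebesgue_on {t0..t1})" "\<And>t. t \<in> {t0..t1} \<Longrightarrow> norm (P t) \<le> B"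
    and nonpos: "\<And>i t. t \<in> {t0..t1} \<Longrightarrow> \<gamma> i t \<le> 0"
    and test: "\<And>w C k. w \<in> borel_measurable (lebesgue_on {t0..t1}) \<Longrightarrow> (\<And>t. t \<in> {t0..t1} \<Longrightarrow> norm (w t) \<le> C) \<Longrightarrow>
        k > 0 \<Longrightarrow> k \<le> \<delta> \<Longrightarrow> (\<And>t i. t \<in> {t0..t1} \<Longrightarrow> \<gamma> i t \<ge> - k \<Longrightarrow> a i t \<bullet> w t \<le> - k) \<Longrightarrow>
        integral {t0..t1} (\<lambda>t. P t \<bullet> w t) \<ge> 0"
  obtains \<mu> :: "'l \<Rightarrow> real \<Rightarrow> real" and C N where
    "\<And>i. \<mu> i \<in> borel_measurable (lebesgue_on {t0..t1})" "\<And>i t. t \<in> {t0..t1} \<Longrightarrow> \<bar>\<mu> i t\<bar> \<le> C"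
    "negligible N" "\<And>i t. t \<in> {t0..t1} - N \<Longrightarrow> 0 \<le> \<mu> i t" "\<And>i t. t \<in> {t0..t1} - N \<Longrightarrow> \<mu> i t * \<gamma> i t = 0"
    "\<And>t. t \<in> {t0..t1} - N \<Longrightarrow> P t + (\<Sum>i\<in>UNIV. \<mu> i t *\<^sub>R a i t) = 0"
proof -
  let ?S = "{t0..t1}" and ?M = "lebesgue_on {t0..t1}"
  define J where "J = (\<lambda>t. {i. \<gamma> i t \<ge> - \<delta>})"
  have Jm: "(\<lambda>t. if i \<in> J t then 1 else 0 :: real) \<in> borel_measurable ?M" for i
    unfolding J_def mem_Collect_eq using \<gamma>[of i] by measurable
  obtain d :: "'l \<Rightarrow> real \<Rightarrow> 'b" and x :: "'l \<Rightarrow> 'l \<Rightarrow> real \<Rightarrow> real" and D :: real where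
    d': "\<forall>i. d i \<in> borel_measurable ?M" "\<forall>i. \<forall>t\<in>?S. norm (d i t) \<le> D"
    "\<forall>i t. d i t = (\<Sum>k\<in>UNIV. x i k t *\<^sub>R a k t)"
    "\<forall>i k. \<forall>t\<in>?S. a k t \<bullet> d i t = (if k = i \<and> \<gamma> i t \<ge> - \<delta> then 1 else 0)"
    using active_dual_system by (elim exE conjE)
  have d: "\<And>i. d i \<in> borel_measurable ?M" "\<And>i t. t \<in> ?S \<Longrightarrow> norm (d i t) \<le> D"
    "\<And>i t. d i t = (\<Sum>k\<in>UNIV. x i k t *\<^sub>R a k t)"
    "\<And>i k t. t \<in> ?S \<Longrightarrow> a k t \<bullet> d i t = (if k = i \<and> i \<in> J t then 1 else 0)"
    subgoal for i by (rule d'(1)[rule_format])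
    subgoal for i t by (rule d'(2)[rule_format])
    subgoal for i t by (rule d'(3)[rule_format])
    subgoal for i k t using d'(4)[rule_format, of t k i] by (simp add: J_def)
    done
  have bnd_int: "(\<lambda>t. P t \<bullet> w t) integrable_on ?S"
    if "w \<in> borel_measurable ?M" "\<And>t. t \<in> ?S \<Longrightarrow> norm (w t) \<le> C" for w C
  proof (rule measurable_bounded_integrable_on[of _ _ _ "\<bar>B\<bar> * \<bar>C\<bar>"])
    show "(\<lambda>t. P t \<bullet> w t) \<in> borel_measurable ?M" by (intro borel_measurable_inner P that)
    fix t assume t: "t \<in> ?S"
    have "norm (P t \<bullet> w t) \<le> norm (P t) * norm (w t)" using Cauchy_Schwarz_ineq2 by simp
    also have "\<dots> \<le> \<bar>B\<bar> * \<bar>C\<bar>" using P(2)[OF t] that(2)[OF t] by (intro mult_mono) auto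
    finally show "norm (P t \<bullet> w t) \<le> \<bar>B\<bar> * \<bar>C\<bar>" .
  qed
  obtain w0 C0 where w0m: "w0 \<in> borel_measurable ?M" and w0: "\<forall>t\<in>?S. norm (w0 t) \<le> C0"
    "\<forall>i. \<forall>t\<in>?S. \<gamma> i t \<ge> - \<delta> \<longrightarrow> a i t \<bullet> w0 t = - 1"
    using inward_direction_exists by (elim exE conjE)
  have w0b: "norm (w0 t) \<le> C0" if "t \<in> ?S" for t using w0(1) that by blast
  \<comment> \<open>Non-strict directions may be tested too: add \<rho> times the inward
    \<open>w0\<close>, apply \<open>test\<close>, and let \<rho> tend to 0.\<close>
  have test': "integral ?S (\<lambda>t. P t \<bullet> v t) \<ge> 0"
    if v: "v \<in> borel_measurable ?M" "\<And>t. t \<in> ?S \<Longrightarrow> norm (v t) \<le> C" and \<kappa>: "\<kappa> > 0"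
      and av: "\<And>t i. t \<in> ?S \<Longrightarrow> \<gamma> i t \<ge> - \<kappa> \<Longrightarrow> a i t \<bullet> v t \<le> 0" for v C \<kappa>
  proof -
    let ?I = "integral ?S (\<lambda>t. P t \<bullet> v t)" and ?K = "integral ?S (\<lambda>t. P t \<bullet> w0 t)"
    have *: "?I + \<rho> * ?K \<ge> 0" if \<rho>: "\<rho> > 0" for \<rho>
    proof -
      define k where "k = min \<rho> (min \<kappa> \<delta>)"
      have k: "k > 0" "k \<le> \<rho>" "k \<le> \<kappa>" "k \<le> \<delta>" using \<rho> \<kappa> \<delta> by (auto simp: k_def)
      have "integral ?S (\<lambda>t. P t \<bullet> (v t + \<rho> *\<^sub>R w0 t)) \<ge> 0"
      proof (rule test[OF _ _ k(1,4)])
        show "(\<lambda>t. v t + \<rho> *\<^sub>R w0 t) \<in> borel_measurable ?M"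
          by (intro borel_measurable_add borel_measurable_scaleR v w0m borel_measurable_const)
        show "norm (v t + \<rho> *\<^sub>R w0 t) \<le> C + \<rho> * C0" if t: "t \<in> ?S" for t
          using v(2)[OF t] w0b[OF t] \<rho>
          by (intro order_trans[OF norm_triangle_ineq] add_mono) auto
        show "a i t \<bullet> (v t + \<rho> *\<^sub>R w0 t) \<le> - k" if t: "t \<in> ?S" "\<gamma> i t \<ge> - k" for t i
        proof -
          have "\<gamma> i t \<ge> - \<delta>" "\<gamma> i t \<ge> - \<kappa>" using t k by linarith+
          then have "a i t \<bullet> w0 t = - 1" "a i t \<bullet> v t \<le> 0" using w0(2) av t(1) by auto
          then show ?thesis using k by (simp add: inner_add_right)
        qed
      qed
      also have "integral ?S (\<lambda>t. P t \<bullet> (v t + \<rho> *\<^sub>R w0 t)) = ?I + \<rho> * ?K"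
        unfolding inner_add_right inner_scaleR_right
        by (intro integral_unique has_integral_add has_integral_mult_right integrable_integral
            bnd_int[OF v] bnd_int[OF w0m w0b])
      finally show ?thesis .
    qed
    show ?thesis
    proof (rule ccontr)
      assume "\<not> ?thesis"
      then have neg: "?I < 0" by simp
      \<comment> \<open>Chosen so that \<rho> times the integral of \<open>w0\<close> makes up for
        at most half of the negative value.\<close>
      define \<rho> where "\<rho> = - ?I / (2 * (\<bar>?K\<bar> + 1))"
      have \<rho>: "\<rho> > 0" using neg by (simp add: \<rho>_def divide_neg_pos)
      have "\<rho> * ?K \<le> \<rho> * (\<bar>?K\<bar> + 1)" using \<rho> by (intro mult_left_mono) auto
      also have "\<dots> = - ?I / 2" by (simp add: \<rho>_def field_simps)
      finally show False using *[OF \<rho>] neg by simp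
    qed
  qed
  \<comment> \<open>The \<open>d i\<close> lie in the span of the \<open>a k\<close> and are dual to
    them, so the subtracted sum is the orthogonal projection of \<open>P\<close> onto that span.
    Hence \<open>P t \<bullet> R t\<close> is the square of the norm of \<open>R t\<close>, and the
    test with \<open>- R\<close> forces \<open>R\<close> to vanish almost everywhere.\<close>
  define R where "R = (\<lambda>t. P t - (\<Sum>i\<in>UNIV. (P t \<bullet> a i t) *\<^sub>R d i t))"
  have Rm: "R \<in> borel_measurable ?M" unfolding R_def
    by (intro borel_measurable_diff borel_measurable_sum borel_measurable_scaleR borel_measurable_inner P a d)
  have Rb: "norm (R t) \<le> \<bar>B\<bar> + real CARD('l) * (\<bar>B\<bar> * \<bar>B\<bar> * \<bar>D\<bar>)" if t: "t \<in> ?S" for t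
  proof -
    have "norm ((P t \<bullet> a i t) *\<^sub>R d i t) \<le> \<bar>B\<bar> * \<bar>B\<bar> * \<bar>D\<bar>" for i
    proof -
      have "\<bar>P t \<bullet> a i t\<bar> \<le> norm (P t) * norm (a i t)" by (rule Cauchy_Schwarz_ineq2)
      also have "\<dots> \<le> \<bar>B\<bar> * \<bar>B\<bar>" using P(2)[OF t] a(2)[OF t, of i] by (intro mult_mono) auto
      finally show ?thesis unfolding norm_scaleR
        using d(2)[OF t, of i] by (intro mult_mono) auto
    qed
    then have "norm (\<Sum>i\<in>UNIV. (P t \<bullet> a i t) *\<^sub>R d i t) \<le> (\<Sum>i\<in>(UNIV::'l set). \<bar>B\<bar> * \<bar>B\<bar> * \<bar>D\<bar>)"
      by (rule sum_norm_le)
    then show ?thesis unfolding R_def using P(2)[OF t]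
      by (intro order_trans[OF norm_triangle_ineq4] add_mono) auto
  qed
  have aR: "a k t \<bullet> R t = 0" if t: "t \<in> ?S" for k t
  proof -
    have "a k t \<bullet> R t = a k t \<bullet> P t - (\<Sum>i\<in>UNIV. if i = k then (if k \<in> J t then P t \<bullet> a k t else 0) else 0)"
      unfolding R_def inner_diff_right inner_sum_right inner_scaleR_right d(4)[OF t]
      by (intro arg_cong2[where f="(-)"] sum.cong) auto
    also have "\<dots> = 0" using zero[OF t, of k] by (auto simp: J_def inner_commute)
    finally show ?thesis .
  qed
  have PR: "P t \<bullet> R t = R t \<bullet> R t" if t: "t \<in> ?S" for t
  proof -
    have "d i t \<bullet> R t = 0" for i unfolding d(3) by (simp add: inner_sum_left aR[OF t])
    then have "(P t - R t) \<bullet> R t = 0" unfolding R_def by (simp add: inner_sum_left)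
    then show ?thesis by (simp add: inner_diff_left)
  qed
  define DB where "DB = \<bar>B\<bar> + real CARD('l) * (\<bar>B\<bar> * \<bar>B\<bar> * \<bar>D\<bar>)"
  have "integral ?S (\<lambda>t. P t \<bullet> (- R t)) \<ge> 0"
    by (rule test'[of _ _ 1]) (use Rm Rb aR in auto)
  also have "integral ?S (\<lambda>t. P t \<bullet> (- R t)) = - integral ?S (\<lambda>t. R t \<bullet> R t)"
    unfolding Henstock_Kurzweil_Integration.integral_neg[symmetric]
    by (rule integral_cong) (simp add: PR)
  finally have R0: "integral ?S (\<lambda>t. R t \<bullet> R t) \<le> 0" by simp
  have "\<exists>N. negligible N \<and> (\<forall>t\<in>?S - N. R t \<bullet> R t = 0)"
  proof (rule integral_nonneg_le_0_AE[OF _ _ _ R0, of "DB\<^sup>2"])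
    show "R t \<bullet> R t \<le> DB\<^sup>2" if "t \<in> ?S" for t
      using power_mono[OF Rb[OF that], of 2] unfolding DB_def by (simp add: power2_norm_eq_inner)
  qed (use Rm in auto)
  then obtain N0 where N0: "negligible N0" "\<And>t. t \<in> ?S - N0 \<Longrightarrow> R t = 0" by auto
  \<comment> \<open>Minus the coordinates of \<open>P\<close> with respect to the active gradients,
    read off by the dual vectors.\<close>
  define \<mu> where "\<mu> = (\<lambda>i t. if i \<in> J t then - (P t \<bullet> d i t) else 0)"
  have \<mu>m: "\<mu> i \<in> borel_measurable ?M" for i
  proof -
    have "(\<lambda>t. (if i \<in> J t then 1 else 0) * - (P t \<bullet> d i t)) \<in> borel_measurable ?M"
      by (intro borel_measurable_times borel_measurable_uminus borel_measurable_inner Jm P d)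
    moreover have "\<mu> i = (\<lambda>t. (if i \<in> J t then 1 else 0) * - (P t \<bullet> d i t))" by (auto simp: \<mu>_def)
    ultimately show ?thesis by simp
  qed
  have \<mu>b: "\<bar>\<mu> i t\<bar> \<le> \<bar>B\<bar> * \<bar>D\<bar>" if t: "t \<in> ?S" for i t
  proof -
    have "\<bar>\<mu> i t\<bar> \<le> \<bar>P t \<bullet> d i t\<bar>" by (simp add: \<mu>_def)
    also have "\<dots> \<le> norm (P t) * norm (d i t)" by (rule Cauchy_Schwarz_ineq2)
    also have "\<dots> \<le> \<bar>B\<bar> * \<bar>D\<bar>" using P(2)[OF t] d(2)[OF t, of i] by (intro mult_mono) auto
    finally show ?thesis .
  qed
  have N1: "\<exists>N. negligible N \<and> (\<forall>t\<in>?S - N. (if \<mu> i t < 0 then - \<mu> i t else 0) = 0)" for i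
  proof -
    define v where "v = (\<lambda>t. if \<mu> i t < 0 then - d i t else 0)"
    have vm: "v \<in> borel_measurable ?M" unfolding v_def using \<mu>m[of i] d(1)[of i] by measurable
    have fm: "(\<lambda>t. if \<mu> i t < 0 then - \<mu> i t else 0) \<in> borel_measurable ?M" using \<mu>m[of i] by measurable
    have "integral ?S (\<lambda>t. P t \<bullet> v t) \<ge> 0"
    proof (rule test'[OF vm, of D 1])
      show "norm (v t) \<le> D" if "t \<in> ?S" for t
        using d(2)[OF that, of i] order_trans[OF norm_ge_zero d(2)[OF that, of i]] by (simp add: v_def)
    qed (auto simp: v_def d(4))
    also have "integral ?S (\<lambda>t. P t \<bullet> v t) = - integral ?S (\<lambda>t. if \<mu> i t < 0 then - \<mu> i t else 0)"
      unfolding Henstock_Kurzweil_Integration.integral_neg[symmetric]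
      by (rule integral_cong) (auto simp: v_def \<mu>_def)
    finally have "integral ?S (\<lambda>t. if \<mu> i t < 0 then - \<mu> i t else 0) \<le> 0" by simp
    then show ?thesis
      by (rule integral_nonneg_le_0_AE[OF fm, of "\<bar>B\<bar> * \<bar>D\<bar>", rotated 2]) (use \<mu>b[of _ i] in \<open>auto simp: abs_le_iff\<close>)
  qed
  have "\<exists>N1. \<forall>i. negligible (N1 i) \<and> (\<forall>t\<in>?S - N1 i. (if \<mu> i t < 0 then - \<mu> i t else 0) = 0)"
    by (rule choice) (intro allI N1)
  then obtain N1 where N1': "\<forall>i. negligible (N1 i) \<and> (\<forall>t\<in>?S - N1 i. (if \<mu> i t < 0 then - \<mu> i t else 0) = 0)" ..
  have N1: "\<And>i. negligible (N1 i)" "\<And>i t. t \<in> ?S - N1 i \<Longrightarrow> \<mu> i t \<ge> 0"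
    subgoal for i using spec[OF N1', of i] by simp
    subgoal for i t using bspec[OF conjunct2[OF spec[OF N1', of i]], of t] by (simp split: if_splits)
    done
  have N2: "\<exists>N. negligible N \<and> (\<forall>t\<in>?S - N. (if \<mu> i t > 0 \<and> \<gamma> i t \<le> - (1 / real (Suc n)) then \<mu> i t else 0) = 0)" for i n
  proof -
    define f where "f = (\<lambda>t. if \<mu> i t > 0 \<and> \<gamma> i t \<le> - (1 / real (Suc n)) then \<mu> i t else 0)"
    define v where "v = (\<lambda>t. if \<mu> i t > 0 \<and> \<gamma> i t \<le> - (1 / real (Suc n)) then d i t else 0)"
    have vm: "v \<in> borel_measurable ?M" unfolding v_def using \<mu>m[of i] d(1)[of i] \<gamma>[of i] by measurable
    have fm: "f \<in> borel_measurable ?M" unfolding f_def using \<mu>m[of i] \<gamma>[of i] by measurable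
    have "integral ?S (\<lambda>t. P t \<bullet> v t) \<ge> 0"
    \<comment> \<open>The threshold 1/(n+2) lies strictly below 1/(n+1): where constraint i is
      within it, \<open>v\<close> is zero, and the other active gradients are orthogonal to
      \<open>d i\<close>.\<close>
    proof (rule test'[OF vm, of D "1 / real (Suc (Suc n))"])
      show "norm (v t) \<le> D" if "t \<in> ?S" for t
        using d(2)[OF that, of i] order_trans[OF norm_ge_zero d(2)[OF that, of i]] by (simp add: v_def)
      have lt: "1 / real (Suc (Suc n)) < 1 / real (Suc n)" by (simp add: frac_less2)
      fix t k assume t: "t \<in> ?S" and k: "- (1 / real (Suc (Suc n))) \<le> \<gamma> k t"
      show "a k t \<bullet> v t \<le> 0"
      proof (cases "k = i")
        case True
        have "- (1 / real (Suc n)) < - (1 / real (Suc (Suc n)))" using lt by (simp only: neg_less_iff_less)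
        then have "- (1 / real (Suc n)) < \<gamma> k t" using k by (rule less_le_trans)
        then have "\<not> \<gamma> i t \<le> - (1 / real (Suc n))" unfolding True by (simp only: not_le)
        then show ?thesis by (simp add: v_def)
      qed (simp add: v_def d(4)[OF t])
    qed simp
    also have "integral ?S (\<lambda>t. P t \<bullet> v t) = - integral ?S f"
      unfolding Henstock_Kurzweil_Integration.integral_neg[symmetric]
      by (rule integral_cong) (auto simp: v_def f_def \<mu>_def split: if_splits)
    finally have "integral ?S f \<le> 0" by simp
    then have "\<exists>N. negligible N \<and> (\<forall>t\<in>?S - N. f t = 0)"
      by (rule integral_nonneg_le_0_AE[OF fm, of "\<bar>B\<bar> * \<bar>D\<bar>", rotated 2]) (use \<mu>b[of _ i] in \<open>auto simp: f_def abs_le_iff\<close>)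
    then show ?thesis unfolding f_def .
  qed
  have "\<exists>N2. \<forall>p. negligible (N2 p) \<and> (\<forall>t\<in>?S - N2 p.
      (if \<mu> (fst p) t > 0 \<and> \<gamma> (fst p) t \<le> - (1 / real (Suc (snd p))) then \<mu> (fst p) t else 0) = 0)"
    by (rule choice) (intro allI N2)
  then obtain N3 where N3: "\<forall>p. negligible (N3 p) \<and> (\<forall>t\<in>?S - N3 p.
      (if \<mu> (fst p) t > 0 \<and> \<gamma> (fst p) t \<le> - (1 / real (Suc (snd p))) then \<mu> (fst p) t else 0) = 0)" ..
  define N2 where "N2 = (\<lambda>i n. N3 (i, n))"
  have N2: "\<And>i n. negligible (N2 i n)"
    "\<And>i n t. t \<in> ?S - N2 i n \<Longrightarrow> (if \<mu> i t > 0 \<and> \<gamma> i t \<le> - (1 / real (Suc n)) then \<mu> i t else 0) = 0"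
    subgoal for i n using spec[OF N3, of "(i, n)"] by (simp add: N2_def)
    subgoal for i n t using spec[OF N3, of "(i, n)"] unfolding N2_def fst_conv snd_conv by blast
    done
  \<comment> \<open>The union over n is countable and exhausts the set where \<gamma> i is negative,
    which gives complementarity.\<close>
  define N where "N = N0 \<union> (\<Union>i. N1 i) \<union> (\<Union>i. \<Union>n. N2 i n)"
  have N: "negligible N" unfolding N_def
    by (intro negligible_Un N0 negligible_Union) (auto intro!: negligible_countable_Union N1 N2)
  show ?thesis
  proof (rule that[of \<mu> "\<bar>B\<bar> * \<bar>D\<bar>" N])
    fix i t assume t: "t \<in> ?S - N"
    show pos: "0 \<le> \<mu> i t" using N1(2)[of t i] t by (auto simp: N_def)
    show "\<mu> i t * \<gamma> i t = 0"
    proof (cases "\<gamma> i t < 0")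
      case True
      then obtain n where n: "1 / real (Suc n) < - \<gamma> i t" using nat_approx_posE[of "- \<gamma> i t"] by auto
      have "t \<in> ?S - N2 i n" using t by (auto simp: N_def)
      from N2(2)[OF this] n pos show ?thesis by (auto split: if_splits)
    next
      case False
      then show ?thesis using nonpos[of t i] t by auto
    qed
  next
    fix t assume "t \<in> ?S - N"
    then have t: "t \<in> ?S" "t \<in> ?S - N0" by (auto simp: N_def)
    \<comment> \<open>As \<open>R\<close> vanishes, \<open>P\<close> is a combination of the
      gradients with coefficients \<nu>. Pairing with \<open>d i\<close> shows that \<mu> is - \<nu>
      at the active indices.\<close>
    define \<nu> where "\<nu> = (\<lambda>k. \<Sum>i\<in>UNIV. (P t \<bullet> a i t) * x i k t)"
    have "P t = (\<Sum>i\<in>UNIV. (P t \<bullet> a i t) *\<^sub>R d i t)" using N0(2)[OF t(2)] by (simp add: R_def)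
    also have "\<dots> = (\<Sum>i\<in>UNIV. \<Sum>k\<in>UNIV. ((P t \<bullet> a i t) * x i k t) *\<^sub>R a k t)"
      unfolding d(3) by (simp add: scaleR_sum_right)
    also have "\<dots> = (\<Sum>k\<in>UNIV. \<nu> k *\<^sub>R a k t)" unfolding \<nu>_def
      by (subst sum.swap) (simp add: scaleR_sum_left)
    finally have P\<nu>: "P t = (\<Sum>k\<in>UNIV. \<nu> k *\<^sub>R a k t)" .
    have "P t \<bullet> d i t = (if i \<in> J t then \<nu> i else 0)" for i
    proof -
      have "P t \<bullet> d i t = (\<Sum>k\<in>UNIV. if k = i then (if i \<in> J t then \<nu> i else 0) else 0)"
        unfolding P\<nu> inner_sum_left inner_scaleR_left d(4)[OF t(1)] by (intro sum.cong) auto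
      then show ?thesis by simp
    qed
    then have "(\<Sum>i\<in>UNIV. \<mu> i t *\<^sub>R a i t) = (\<Sum>i\<in>UNIV. - (\<nu> i *\<^sub>R a i t))"
      using zero[OF t(1)] by (intro sum.cong) (auto simp: \<mu>_def J_def)
    then show "P t + (\<Sum>i\<in>UNIV. \<mu> i t *\<^sub>R a i t) = 0" using P\<nu> by (simp add: sum_negf)
  qed (use \<mu>m \<mu>b N in auto)
qed

end

section \<open>First-order variations of a trajectory\<close>

text \<open>A pointwise Taylor expansion would not do along a merely measurable control. Uniform
  continuity of the derivative on a larger ball makes the remainder uniform in the base
  point.\<close>

lemma C1_uniform_expansion:
  fixes f :: "'a::euclidean_space \<Rightarrow> 'b::real_normed_vector" and f' :: "'a \<Rightarrow> 'a \<Rightarrow>\<^sub>L 'b"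
  assumes der: "\<And>x. (f has_derivative blinfun_apply (f' x)) (at x)" and cont: "continuous_on UNIV f'"
    and \<kappa>: "\<kappa> > 0"
  obtains \<delta> where "\<delta> > 0" "\<And>z h. norm z \<le> R \<Longrightarrow> norm h \<le> \<delta> \<Longrightarrow> norm (f (z + h) - f z - f' z h) \<le> \<kappa> * norm h"
proof -
  have "uniformly_continuous_on (cball 0 (R + 1)) f'"
    by (rule compact_uniformly_continuous[OF continuous_on_subset[OF cont]]) auto
  then obtain d where d: "d > 0" "\<And>x y. x \<in> cball 0 (R + 1) \<Longrightarrow> y \<in> cball 0 (R + 1) \<Longrightarrow> dist y x < d \<Longrightarrow> dist (f' y) (f' x) < \<kappa>"
    using \<kappa> unfolding uniformly_continuous_on_def by metis
  show ?thesis
  \<comment> \<open>The 1 keeps the segment inside the ball of radius R + 1; d/2 yields the strict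
    inequality demanded by uniform continuity.\<close>
  proof (rule that[of "min 1 (d / 2)"])
    show "min 1 (d / 2) > 0" using d by simp
    fix z h :: 'a assume z: "norm z \<le> R" and h: "norm h \<le> min 1 (d / 2)"
    let ?S = "cball z (norm h)"
    have "norm ((f (z + h) - f' z (z + h)) - (f z - f' z z)) \<le> \<kappa> * norm (z + h - z)"
    proof (rule differentiable_bound[where S="?S" and f="\<lambda>y. f y - f' z y" and f'="\<lambda>y. blinfun_apply (f' y - f' z)"])
      fix y assume y: "y \<in> ?S"
      show "((\<lambda>y. f y - f' z y) has_derivative blinfun_apply (f' y - f' z)) (at y within ?S)"
        unfolding minus_blinfun.rep_eq
        by (intro has_derivative_diff has_derivative_at_withinI[OF der] bounded_linear_imp_has_derivative
            blinfun.bounded_linear_right)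
      have "norm y \<le> norm z + norm (y - z)" by (rule norm_triangle_sub)
      also have "norm (y - z) \<le> norm h" using y by (simp add: dist_norm norm_minus_commute)
      finally have "y \<in> cball 0 (R + 1)" using z h by simp
      moreover have "z \<in> cball 0 (R + 1)" using z by simp
      moreover have "dist y z < d" using y h d(1) by (simp add: dist_commute)
      ultimately have "norm (f' y - f' z) < \<kappa>" using d(2) by (simp add: dist_norm)
      then show "onorm (blinfun_apply (f' y - f' z)) \<le> \<kappa>" by (simp add: norm_blinfun.rep_eq)
    qed (auto simp: dist_norm)
    then show "norm (f (z + h) - f z - f' z h) \<le> \<kappa> * norm h"
      by (simp add: blinfun.add_right algebra_simps)
  qed
qed

lemma C1_bounds_on_ball:
  fixes f :: "'a::euclidean_space \<Rightarrow> 'b::real_normed_vector" and f' :: "'a \<Rightarrow> 'a \<Rightarrow>\<^sub>L 'b"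
  assumes der: "\<And>x. (f has_derivative blinfun_apply (f' x)) (at x)" and cont: "continuous_on UNIV f'"
  obtains L where "L > 0" "\<And>x. norm x \<le> R \<Longrightarrow> norm (f x) \<le> L" "\<And>x. norm x \<le> R \<Longrightarrow> norm (f' x) \<le> L"
    "\<And>x y. norm x \<le> R \<Longrightarrow> norm y \<le> R \<Longrightarrow> norm (f x - f y) \<le> L * norm (x - y)"
proof -
  have fc: "continuous_on UNIV f"
    using der by (meson continuous_at_imp_continuous_on has_derivative_continuous)
  have "bounded (f ` cball 0 R)" "bounded (f' ` cball 0 R)"
    by (intro compact_imp_bounded compact_continuous_image continuous_on_subset[OF fc] continuous_on_subset[OF cont]; simp)+
  then obtain A B where A: "A > 0" "\<And>x. x \<in> cball 0 R \<Longrightarrow> norm (f x) \<le> A"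
    and B: "B > 0" "\<And>x. x \<in> cball 0 R \<Longrightarrow> norm (f' x) \<le> B"
    unfolding bounded_pos by auto
  show ?thesis
  proof (rule that[of "max A B"])
    show "max A B > 0" using A by auto
    show "norm (f x) \<le> max A B" if "norm x \<le> R" for x using A(2)[of x] that by simp
    show fb: "norm (f' x) \<le> max A B" if "norm x \<le> R" for x using B(2)[of x] that by simp
    show "norm (f x - f y) \<le> max A B * norm (x - y)" if "norm x \<le> R" "norm y \<le> R" for x y
    proof (rule differentiable_bound[where S="cball 0 R" and f'="\<lambda>x. blinfun_apply (f' x)"])
      show "(f has_derivative blinfun_apply (f' x)) (at x within cball 0 R)" for x
        by (rule has_derivative_at_withinI[OF der])
      show "onorm (blinfun_apply (f' x)) \<le> max A B" if "x \<in> cball 0 R" for x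
        using fb[of x] that by (simp add: norm_blinfun.rep_eq)
    qed (use that in auto)
  qed
qed

text \<open>The bounds are required at every time, not just almost everywhere, so that estimates can
  be made pointwise under the integral.\<close>

locale controlled_trajectory =
  fixes f :: "'a::euclidean_space \<times> 'b::euclidean_space \<Rightarrow> 'a"
    and f' :: "'a \<times> 'b \<Rightarrow> ('a \<times> 'b) \<Rightarrow>\<^sub>L 'a"
    and T R :: real and x\<^sub>0 :: "real \<Rightarrow> 'a" and u :: "real \<Rightarrow> 'b"
  assumes T: "T > 0"
    and f': "\<And>z. (f has_derivative blinfun_apply (f' z)) (at z)" "continuous_on UNIV f'"
    and u_meas: "u \<in> borel_measurable (lebesgue_on {0..T})"
    and u_bound: "\<And>t. t \<in> {0..T} \<Longrightarrow> norm (u t) \<le> R"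
    and x\<^sub>0: "lip_primitive 0 T (\<lambda>t. f (x\<^sub>0 t, u t)) x\<^sub>0"
    and x\<^sub>0_bound: "\<And>t. t \<in> {0..T} \<Longrightarrow> norm (x\<^sub>0 t) \<le> R"
begin

lemma f_cont: "continuous_on UNIV f"
  using f'(1) by (meson continuous_at_imp_continuous_on has_derivative_continuous)

lemma R_nonneg: "R \<ge> 0"
  using order_trans[OF norm_ge_zero u_bound[of 0]] T by simp

lemma measurable_restrict: "g \<in> borel_measurable (lebesgue_on {0..T}) \<Longrightarrow> S \<le> T \<Longrightarrow> g \<in> borel_measurable (lebesgue_on {0..S})"
  by (rule measurable_restrict_mono) auto

lemma continuous_measurable: "continuous_on {0..S::real} g \<Longrightarrow> g \<in> borel_measurable (lebesgue_on {0..S})"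
  by (rule continuous_imp_measurable_on_sets_lebesgue) simp_all

lemma x\<^sub>0_meas: "x\<^sub>0 \<in> borel_measurable (lebesgue_on {0..T})"
  by (rule continuous_measurable[OF lip_primitive_continuous[OF x\<^sub>0]])

lemma f_measurable:
  assumes "y \<in> borel_measurable M" "v \<in> borel_measurable M"
  shows "(\<lambda>t. f (y t, v t)) \<in> borel_measurable M"
  by (rule borel_measurable_continuous_on[OF f_cont borel_measurable_Pair[OF assms]])

lemma f'_measurable:
  assumes "y \<in> borel_measurable M" "v \<in> borel_measurable M" "h \<in> borel_measurable M" "k \<in> borel_measurable M"
  shows "(\<lambda>t. f' (y t, v t) (h t, k t)) \<in> borel_measurable M"
proof -
  have "continuous_on UNIV (\<lambda>p. f' (fst p) (snd p))"
    by (intro bounded_bilinear.continuous_on[OF bounded_bilinear_blinfun_apply] continuous_intros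
        continuous_on_compose2[OF f'(2)]) auto
  from borel_measurable_continuous_on[OF this borel_measurable_Pair[OF borel_measurable_Pair[OF assms(1,2)] borel_measurable_Pair[OF assms(3,4)]]]
  show ?thesis by simp
qed

definition variation :: "(real \<Rightarrow> real) \<Rightarrow> (real \<Rightarrow> 'b) \<Rightarrow> real \<Rightarrow> (real \<Rightarrow> 'a) \<Rightarrow> bool" where
  "variation a w \<epsilon> x \<longleftrightarrow> lip_primitive 0 T (\<lambda>t. (1 + \<epsilon> * a t) *\<^sub>R f (x t, u t + \<epsilon> *\<^sub>R w t)) x \<and> x 0 = x\<^sub>0 0"

text \<open>The dynamics are only locally Lipschitz. The state is therefore clipped to a ball one
  unit larger than the reference needs, the clipped equation is solved close to the reference, and
  for small \<epsilon> the solution stays where clipping does nothing.\<close>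

lemma variation_exists:
  assumes a: "a \<in> borel_measurable (lebesgue_on {0..T})" "\<And>t. t \<in> {0..T} \<Longrightarrow> \<bar>a t\<bar> \<le> C"
    and w: "w \<in> borel_measurable (lebesgue_on {0..T})" "\<And>t. t \<in> {0..T} \<Longrightarrow> norm (w t) \<le> C"
  shows "\<exists>K>0. \<exists>\<epsilon>\<^sub>0>0. \<forall>\<epsilon>. 0 < \<epsilon> \<and> \<epsilon> < \<epsilon>\<^sub>0 \<longrightarrow>
    (\<exists>x. variation a w \<epsilon> x \<and> (\<forall>t\<in>{0..T}. norm (x t - x\<^sub>0 t) \<le> K * \<epsilon>))"
proof -
  have C: "C \<ge> 0" using order_trans[OF abs_ge_zero a(2)[of 0]] T by simp
  \<comment> \<open>R + 1 bounds the clipped state and R + C the perturbed control for \<epsilon>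
    \<le> 1; their sum bounds the pair.\<close>
  define Q where "Q = (R + 1) + (R + C)"
  obtain M where M: "M > 0" "\<And>z. norm z \<le> Q \<Longrightarrow> norm (f z) \<le> M" "\<And>z. norm z \<le> Q \<Longrightarrow> norm (f' z) \<le> M"
    "\<And>z y. norm z \<le> Q \<Longrightarrow> norm y \<le> Q \<Longrightarrow> norm (f z - f y) \<le> M * norm (z - y)"
    by (rule C1_bounds_on_ball[OF f', of Q]) blast
  define clip :: "'a \<Rightarrow> 'a" where "clip = closest_point (cball 0 (R + 1))"
  have clipb: "norm (clip x) \<le> R + 1" for x
    using closest_point_in_set[of "cball (0::'a) (R + 1)" x] R_nonneg by (simp add: clip_def)
  have clipl: "norm (clip x - clip y) \<le> norm (x - y)" for x y
    using closest_point_lipschitz[of "cball (0::'a) (R + 1)" x y] R_nonneg by (simp add: clip_def dist_norm)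
  have clipi: "clip x = x" if "norm x \<le> R + 1" for x
    using that by (simp add: clip_def closest_point_self)
  have clipc: "continuous_on UNIV clip"
    by (rule lipschitz_on_continuous_on[of 1]) (rule lipschitz_onI, auto simp: dist_norm clipl)
  define L where "L = (1 + C) * M"
  have L: "L > 0" using C M(1) by (simp add: L_def)
  \<comment> \<open>Defect of the reference in the perturbed equation per unit of \<epsilon>:
    \<open>C * M\<close> from the changed control and \<open>C * M\<close> from the changed speed,
    over time \<open>T\<close>.\<close>
  define D where "D = C * (M + M) * T"
  define K where "K = 2 * exp (2 * L * T) * D + 1"
  have D: "D \<ge> 0" using C M(1) T by (simp add: D_def)
  have K: "K > 0" using D by (simp add: K_def add_nonneg_pos)
  have "\<exists>x. variation a w \<epsilon> x \<and> (\<forall>t\<in>{0..T}. norm (x t - x\<^sub>0 t) \<le> K * \<epsilon>)"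
    \<comment> \<open>The bound 1/K keeps the deviation at most 1, inside the unclipped
      ball.\<close>
    if \<epsilon>: "0 < \<epsilon>" "\<epsilon> < min 1 (1 / K)" for \<epsilon>
  proof -
    have e1: "\<epsilon> \<le> 1" "K * \<epsilon> \<le> 1" using \<epsilon> K by (auto simp: field_simps)
    define v where "v = (\<lambda>t. u t + \<epsilon> *\<^sub>R w t)"
    have vm: "v \<in> borel_measurable (lebesgue_on {0..T})" unfolding v_def
      by (intro borel_measurable_add borel_measurable_scaleR borel_measurable_const u_meas w)
    have ew: "norm (\<epsilon> *\<^sub>R w t) \<le> \<epsilon> * C" if "t \<in> {0..T}" for t
      using w(2)[OF that] \<epsilon> by simp
    have vb: "norm (v t) \<le> R + C" if t: "t \<in> {0..T}" for t
    proof -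
      have "\<epsilon> * C \<le> 1 * C" using e1 C by (intro mult_right_mono) auto
      then show ?thesis unfolding v_def using ew[OF t] u_bound[OF t]
        by (intro order_trans[OF norm_triangle_ineq] add_mono) auto
    qed
    have inQ: "norm (x, v) \<le> Q" if "norm x \<le> R + 1" "norm v \<le> R + C" for x :: 'a and v :: 'b
      using that norm_Pair_le[of x v] by (simp add: Q_def)
    have ab: "\<bar>1 + \<epsilon> * a t\<bar> \<le> 1 + C" if t: "t \<in> {0..T}" for t
    proof -
      have "\<bar>\<epsilon> * a t\<bar> \<le> 1 * C" unfolding abs_mult using a(2)[OF t] e1 \<epsilon> by (intro mult_mono) auto
      then show ?thesis by linarith
    qed
    define h where "h = (\<lambda>t x. (1 + \<epsilon> * a t) *\<^sub>R f (clip x, v t))"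
    have hm: "(\<lambda>t. h t (x t)) \<in> borel_measurable (lebesgue_on {0..T})" if x: "continuous_on {0..T} x" for x
      unfolding h_def
      by (intro borel_measurable_scaleR borel_measurable_add borel_measurable_times borel_measurable_const a
          f_measurable vm borel_measurable_continuous_on[OF clipc] continuous_measurable[OF x])
    have hl: "norm (h t x - h t y) \<le> L * norm (x - y)" if t: "t \<in> {0..T}" for t x y
    proof -
      have "norm (h t x - h t y) = \<bar>1 + \<epsilon> * a t\<bar> * norm (f (clip x, v t) - f (clip y, v t))"
        by (simp add: h_def flip: scaleR_diff_right)
      also have "\<dots> \<le> (1 + C) * (M * norm ((clip x, v t) - (clip y, v t)))"
        by (intro mult_mono ab[OF t] M(4) inQ clipb vb[OF t]) (use C in auto)
      also have "norm ((clip x, v t) - (clip y, v t)) \<le> norm (x - y)"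
        using clipl[of x y] by (simp add: norm_Pair)
      finally show ?thesis using C M(1) by (simp add: L_def mult.assoc)
    qed
    have hb: "norm (h t 0) \<le> (1 + C) * M" if t: "t \<in> {0..T}" for t
      unfolding h_def norm_scaleR
      by (intro mult_mono ab[OF t] M(2) inQ clipb vb[OF t]) (use C in auto)
    have x0c: "continuous_on {0..T} x\<^sub>0" by (rule lip_primitive_continuous[OF x\<^sub>0])
    have defect: "norm (x\<^sub>0 t - (x\<^sub>0 0 + integral {0..t} (\<lambda>s. h s (x\<^sub>0 s)))) \<le> D * \<epsilon>" if t: "t \<in> {0..T}" for t
    proof -
      have i1: "((\<lambda>s. f (x\<^sub>0 s, u s)) has_integral (x\<^sub>0 t - x\<^sub>0 0)) {0..t}"
        using lip_primitive_has_integral[OF x\<^sub>0, of 0 t] t by simp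
      have hx: "norm (h s (x\<^sub>0 s)) \<le> (1 + C) * M" if s: "s \<in> {0..T}" for s
        unfolding h_def norm_scaleR
        by (intro mult_mono ab[OF s] M(2) inQ clipb vb[OF s]) (use C in auto)
      have i2: "(\<lambda>s. h s (x\<^sub>0 s)) integrable_on {0..t}"
        by (rule integrable_on_subinterval[OF measurable_bounded_integrable_on[OF hm[OF x0c] hx]]) (use t in auto)
      have i3: "((\<lambda>s. f (x\<^sub>0 s, u s) - h s (x\<^sub>0 s)) has_integral
          (x\<^sub>0 t - x\<^sub>0 0 - integral {0..t} (\<lambda>s. h s (x\<^sub>0 s)))) {0..t}"
        by (intro has_integral_diff i1 integrable_integral i2)
      have "norm (integral {0..t} (\<lambda>s. f (x\<^sub>0 s, u s) - h s (x\<^sub>0 s))) \<le> integral {0..t} (\<lambda>_. \<epsilon> * C * (M + M))"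
      proof (rule integral_norm_bound_integral[OF has_integral_integrable[OF i3] integrable_const_ivl])
        fix s assume "s \<in> {0..t}"
        then have s: "s \<in> {0..T}" using t by auto
        have xb: "norm (x\<^sub>0 s) \<le> R + 1" using x\<^sub>0_bound[OF s] by simp
        have ub: "norm (u s) \<le> R + C" using u_bound[OF s] C by simp
        have "f (x\<^sub>0 s, u s) - h s (x\<^sub>0 s) = (f (x\<^sub>0 s, u s) - f (x\<^sub>0 s, v s)) - (\<epsilon> * a s) *\<^sub>R f (x\<^sub>0 s, v s)"
          by (simp add: h_def clipi[OF xb] scaleR_add_left)
        also have "norm \<dots> \<le> M * norm ((x\<^sub>0 s, u s) - (x\<^sub>0 s, v s)) + norm ((\<epsilon> * a s) *\<^sub>R f (x\<^sub>0 s, v s))"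
          by (intro order_trans[OF norm_triangle_ineq4] add_mono M(4) inQ xb ub vb[OF s] order_refl)
        also have "norm ((x\<^sub>0 s, u s) - (x\<^sub>0 s, v s)) \<le> \<epsilon> * C" using ew[OF s] by (simp add: v_def norm_Pair)
        also have "norm ((\<epsilon> * a s) *\<^sub>R f (x\<^sub>0 s, v s)) \<le> (\<epsilon> * C) * M"
        proof -
          have "\<bar>\<epsilon> * a s\<bar> \<le> \<epsilon> * C" unfolding abs_mult using a(2)[OF s] \<epsilon> by simp
          then show ?thesis unfolding norm_scaleR using \<epsilon> C by (intro mult_mono M(2) inQ xb vb[OF s]) auto
        qed
        finally show "norm (f (x\<^sub>0 s, u s) - h s (x\<^sub>0 s)) \<le> \<epsilon> * C * (M + M)"
          using M(1) by (simp add: algebra_simps)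
      qed
      also have "\<dots> = t * (\<epsilon> * C * (M + M))" using t by simp
      also have "\<dots> \<le> T * (\<epsilon> * C * (M + M))" using t \<epsilon> C M(1) by (intro mult_right_mono) auto
      finally show ?thesis unfolding integral_unique[OF i3] by (simp add: D_def algebra_simps)
    qed
    have "\<exists>x. lip_primitive 0 T (\<lambda>s. h s (x s)) x \<and> x 0 = x\<^sub>0 0 \<and>
        (\<forall>t\<in>{0..T}. norm (x t - x\<^sub>0 t) \<le> 2 * exp (2 * L * T) * (D * \<epsilon>))"
      by (rule caratheodory_solution_near[OF less_imp_le[OF T] L hm hl hb x0c defect]) blast+
    then obtain x where x: "lip_primitive 0 T (\<lambda>s. h s (x s)) x" "x 0 = x\<^sub>0 0"
      "\<forall>t\<in>{0..T}. norm (x t - x\<^sub>0 t) \<le> 2 * exp (2 * L * T) * (D * \<epsilon>)" by blast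
    have xK: "norm (x t - x\<^sub>0 t) \<le> K * \<epsilon>" if "t \<in> {0..T}" for t
      using bspec[OF x(3) that] \<epsilon> by (simp add: K_def algebra_simps)
    have "norm (x t) \<le> R + 1" if "t \<in> {0..T}" for t
      using norm_triangle_sub[of "x t" "x\<^sub>0 t"] xK[OF that] e1 x\<^sub>0_bound[OF that] by linarith
    then have "lip_primitive 0 T (\<lambda>t. (1 + \<epsilon> * a t) *\<^sub>R f (x t, v t)) x"
      by (intro lip_primitive_cong[OF x(1) negligible_empty]) (auto simp: h_def clipi)
    then have "variation a w \<epsilon> x" using x(2) by (simp add: variation_def v_def)
    then show ?thesis using xK by blast
  qed
  moreover have "min 1 (1 / K) > 0" using K by simp
  ultimately show ?thesis using K by blast
qed

text \<open>Transpose of the partial Jacobian in the state, along the reference; the costate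
  equation is p' = - adj p.\<close>

definition adj :: "real \<Rightarrow> 'a \<Rightarrow> 'a" where
  "adj t q = riesz (\<lambda>b. q \<bullet> f' (x\<^sub>0 t, u t) (b, 0))"

lemma adj_inner: "adj t q \<bullet> h = q \<bullet> f' (x\<^sub>0 t, u t) (h, 0)"
  unfolding adj_def by (rule riesz_inner[OF linear_inner_partial(1)])

lemma norm_adj_le:
  assumes "norm (f' (x\<^sub>0 t, u t)) \<le> M" "M \<ge> 0"
  shows "norm (adj t q) \<le> M * norm q"
  unfolding adj_def
proof (rule norm_riesz_le[OF linear_inner_partial(1)])
  show "q \<bullet> f' (x\<^sub>0 t, u t) (h, 0) \<le> M * norm q * norm h" for h
    using inner_blinfun_le[OF assms(1), of q "(h, 0)"] by (simp add: norm_Pair)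
qed (use assms in simp)

lemma adjoint_exists:
  assumes S: "0 < S" "S \<le> T"
  obtains p where "lip_primitive 0 S (\<lambda>t. - adj t (p t)) p" "p S = q"
proof -
  obtain M where M: "M > 0" "\<And>z. norm z \<le> R + R \<Longrightarrow> norm (f' z) \<le> M"
    by (rule C1_bounds_on_ball[OF f', of "R + R"]) blast
  have fb: "norm (f' (x\<^sub>0 t, u t)) \<le> M" if "t \<in> {0..S}" for t
  proof -
    have t: "t \<in> {0..T}" using that S by auto
    show ?thesis by (rule M(2)) (use norm_Pair_le[of "x\<^sub>0 t" "u t"] x\<^sub>0_bound[OF t] u_bound[OF t] in linarith)
  qed
  have diff: "adj t p - adj t q = adj t (p - q)" for t p q
    by (simp add: adj_def riesz_def inner_diff_left scaleR_diff_left sum_subtractf)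
  have "\<exists>p. lip_primitive 0 S (\<lambda>t. - adj t (p t)) p \<and> p S = q"
  proof (rule caratheodory_backward[of S M adj 0 q])
    show "(\<lambda>t. adj t (p t)) \<in> borel_measurable (lebesgue_on {0..S})" if p: "continuous_on {0..S} p" for p
      unfolding adj_def riesz_def
      by (intro borel_measurable_sum borel_measurable_scaleR borel_measurable_inner borel_measurable_const
          continuous_measurable[OF p] f'_measurable measurable_restrict[OF _ S(2)] u_meas x\<^sub>0_meas)
    show "norm (adj t p - adj t q) \<le> M * norm (p - q)" if "t \<in> {0..S}" for t p q
      unfolding diff by (rule norm_adj_le[OF fb[OF that]]) (use M in simp)
    show "norm (adj t 0) \<le> 0" for t by (simp add: adj_def riesz_def)
  qed (use S M in auto)
  then show ?thesis using that by blast
qed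

text \<open>Integrand of the first variation: the costate against the direct change of velocity due
  to speed and control. The indirect effect through the state is absorbed by the adjoint
  equation.\<close>

definition sens :: "(real \<Rightarrow> 'a) \<Rightarrow> (real \<Rightarrow> real) \<Rightarrow> (real \<Rightarrow> 'b) \<Rightarrow> real \<Rightarrow> real" where
  "sens p a w t = p t \<bullet> (a t *\<^sub>R f (x\<^sub>0 t, u t) + f' (x\<^sub>0 t, u t) (0, w t))"

lemma sens_integrable:
  assumes S: "S \<le> T" and p: "continuous_on {0..S} p"
    and a: "a \<in> borel_measurable (lebesgue_on {0..T})" "\<And>t. t \<in> {0..T} \<Longrightarrow> \<bar>a t\<bar> \<le> C"
    and w: "w \<in> borel_measurable (lebesgue_on {0..T})" "\<And>t. t \<in> {0..T} \<Longrightarrow> norm (w t) \<le> C"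
  shows "sens p a w integrable_on {0..S}"
proof -
  have C: "C \<ge> 0" using order_trans[OF abs_ge_zero a(2)[of 0]] T by simp
  obtain M where M: "M > 0" "\<And>z. norm z \<le> R + R \<Longrightarrow> norm (f z) \<le> M" "\<And>z. norm z \<le> R + R \<Longrightarrow> norm (f' z) \<le> M"
    by (rule C1_bounds_on_ball[OF f', of "R + R"]) blast
  obtain P where P: "P > 0" "\<And>t. t \<in> {0..S} \<Longrightarrow> norm (p t) \<le> P" by (rule continuous_on_Icc_bounded[OF p]) blast
  show ?thesis
  proof (rule measurable_bounded_integrable_on[of _ _ _ "P * (C * M + M * C)"])
    show "sens p a w \<in> borel_measurable (lebesgue_on {0..S})"
      unfolding sens_def
      by (intro borel_measurable_inner borel_measurable_add borel_measurable_scaleR f_measurable f'_measurable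
          continuous_measurable[OF p] borel_measurable_const measurable_restrict[OF _ S] u_meas x\<^sub>0_meas a w)
    fix t assume t: "t \<in> {0..S}"
    then have tT: "t \<in> {0..T}" using S by auto
    have z: "norm (x\<^sub>0 t, u t) \<le> R + R"
      using norm_Pair_le[of "x\<^sub>0 t" "u t"] x\<^sub>0_bound[OF tT] u_bound[OF tT] by linarith
    have 1: "norm (a t *\<^sub>R f (x\<^sub>0 t, u t)) \<le> C * M"
      unfolding norm_scaleR by (intro mult_mono a(2)[OF tT] M(2)[OF z] C) auto
    have "norm (f' (x\<^sub>0 t, u t) (0, w t)) \<le> norm (f' (x\<^sub>0 t, u t)) * norm (0::'a, w t)" by (rule norm_blinfun)
    also have "\<dots> \<le> M * C" using w(2)[OF tT] M(1) by (intro mult_mono M(3)[OF z]) (auto simp: norm_Pair)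
    finally have 2: "norm (f' (x\<^sub>0 t, u t) (0, w t)) \<le> M * C" .
    have "norm (sens p a w t) \<le> norm (p t) * norm (a t *\<^sub>R f (x\<^sub>0 t, u t) + f' (x\<^sub>0 t, u t) (0, w t))"
      unfolding sens_def using Cauchy_Schwarz_ineq2 by simp
    also have "\<dots> \<le> P * (C * M + M * C)"
      by (intro mult_mono P(2)[OF t] order_trans[OF norm_triangle_ineq] add_mono 1 2) (use P in auto)
    finally show "norm (sens p a w t) \<le> P * (C * M + M * C)" .
  qed
qed

text \<open>With e the deviation of the state, the derivative of p \<bullet> e loses its terms
  linear in e by the adjoint equation. What remains is \<epsilon> times \<open>sens\<close> and a
  uniformly small remainder. The threshold for \<epsilon> is chosen before the varied
  trajectory.\<close>

lemma variation_first_order: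
  assumes S: "0 < S" "S \<le> T" and p: "lip_primitive 0 S (\<lambda>t. - adj t (p t)) p"
    and \<Phi>: "(\<Phi> has_derivative (\<lambda>h. p S \<bullet> h)) (at (x\<^sub>0 S))"
    and a: "a \<in> borel_measurable (lebesgue_on {0..T})" "\<And>t. t \<in> {0..T} \<Longrightarrow> \<bar>a t\<bar> \<le> C"
    and w: "w \<in> borel_measurable (lebesgue_on {0..T})" "\<And>t. t \<in> {0..T} \<Longrightarrow> norm (w t) \<le> C"
    and K: "K > 0" and \<kappa>: "\<kappa> > 0"
  shows "\<exists>\<epsilon>\<^sub>1>0. \<forall>\<epsilon> x. 0 < \<epsilon> \<and> \<epsilon> < \<epsilon>\<^sub>1 \<and> variation a w \<epsilon> x \<and> (\<forall>t\<in>{0..T}. norm (x t - x\<^sub>0 t) \<le> K * \<epsilon>) \<longrightarrow>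
    \<bar>\<Phi> (x S) - \<Phi> (x\<^sub>0 S) - \<epsilon> * integral {0..S} (sens p a w)\<bar> \<le> \<kappa> * \<epsilon>"
proof -
  have C: "C \<ge> 0" using order_trans[OF abs_ge_zero a(2)[of 0]] T by simp
  note pc = lip_primitive_continuous[OF p]
  obtain P where P: "P > 0" "\<And>t. t \<in> {0..S} \<Longrightarrow> norm (p t) \<le> P" by (rule continuous_on_Icc_bounded[OF pc]) blast
  define Q where "Q = (R + R) + (K + C)"
  obtain M where M: "M > 0" "\<And>z y. norm z \<le> Q \<Longrightarrow> norm y \<le> Q \<Longrightarrow> norm (f z - f y) \<le> M * norm (z - y)"
    by (rule C1_bounds_on_ball[OF f', of Q]) blast
  \<comment> \<open>Two remainders, each bounded by \<kappa>' \<epsilon> (K + C), are weighted by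
    \<open>P\<close> and integrated over length \<open>S\<close>; together they use half of
    \<kappa>. The other half goes to the differentiability of \<Phi>.\<close>
  define \<kappa>' where "\<kappa>' = \<kappa> / (4 * P * S * (K + C))"
  have \<kappa>': "\<kappa>' > 0" using \<kappa> P(1) S(1) K C by (simp add: \<kappa>'_def)
  obtain \<delta> where \<delta>: "\<delta> > 0" "\<And>z h. norm z \<le> R + R \<Longrightarrow> norm h \<le> \<delta> \<Longrightarrow> norm (f (z + h) - f z - f' z h) \<le> \<kappa>' * norm h"
    by (rule C1_uniform_expansion[OF f' \<kappa>']) blast
  obtain \<delta>2 where \<delta>2: "\<delta>2 > 0" "\<And>y. norm (y - x\<^sub>0 S) < \<delta>2 \<Longrightarrow> \<bar>\<Phi> y - \<Phi> (x\<^sub>0 S) - p S \<bullet> (y - x\<^sub>0 S)\<bar> \<le> \<kappa> / (2 * K) * norm (y - x\<^sub>0 S)"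
  proof -
    have "\<kappa> / (2 * K) > 0" using \<kappa> K by simp
    with \<Phi> show ?thesis using that unfolding has_derivative_at_alt real_norm_def by blast
  qed
  \<comment> \<open>In order: the increment is at most K + C; it is within reach of the expansion of
    \<open>f\<close>; the end point is within reach of that of \<Phi>; the product of speed change
    and velocity change is absorbed by \<kappa>'.\<close>
  define \<epsilon>\<^sub>1 where "\<epsilon>\<^sub>1 = min (min 1 (\<delta> / (K + C))) (min (\<delta>2 / K) (\<kappa>' / (C * M + 1)))"
  have e1: "\<epsilon>\<^sub>1 > 0" using \<delta>(1) \<delta>2(1) K C \<kappa>' M(1) by (auto simp: \<epsilon>\<^sub>1_def intro!: divide_pos_pos add_nonneg_pos)
  have "\<bar>\<Phi> (x S) - \<Phi> (x\<^sub>0 S) - \<epsilon> * integral {0..S} (sens p a w)\<bar> \<le> \<kappa> * \<epsilon>"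
    if \<epsilon>: "0 < \<epsilon>" "\<epsilon> < \<epsilon>\<^sub>1" and x: "variation a w \<epsilon> x" and xK: "\<forall>t\<in>{0..T}. norm (x t - x\<^sub>0 t) \<le> K * \<epsilon>" for \<epsilon> x
  proof -
    have "C * M + 1 > 0" using C M(1) by (simp add: add_nonneg_pos)
    moreover have "\<epsilon> < \<kappa>' / (C * M + 1)" using \<epsilon> by (simp add: \<epsilon>\<^sub>1_def)
    ultimately have el4: "\<epsilon> * (C * M + 1) \<le> \<kappa>'" by (simp add: pos_less_divide_eq)
    have el: "\<epsilon> \<le> 1" "\<epsilon> * (K + C) \<le> \<delta>" "K * \<epsilon> < \<delta>2"
      using \<epsilon> K C by (auto simp: \<epsilon>\<^sub>1_def field_simps add_nonneg_pos)
    have eCM: "\<epsilon> * C * M \<le> \<kappa>'" using el4 \<epsilon>(1) by (simp add: algebra_simps)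
    define v where "v = (\<lambda>t. u t + \<epsilon> *\<^sub>R w t)"
    define e where "e = (\<lambda>t. x t - x\<^sub>0 t)"
    define r where "r = (\<lambda>t. (1 + \<epsilon> * a t) *\<^sub>R f (x t, v t) - f (x\<^sub>0 t, u t))"
    have xl: "lip_primitive 0 T (\<lambda>t. (1 + \<epsilon> * a t) *\<^sub>R f (x t, v t)) x" and x0: "x 0 = x\<^sub>0 0"
      using x by (auto simp: variation_def v_def)
    have "lip_primitive 0 T r e" unfolding r_def e_def by (rule lip_primitive_diff[OF xl x\<^sub>0])
    then have "lip_primitive 0 S r e" by (rule lip_primitive_subinterval) (use S in auto)
    from lip_primitive_inner[OF p this]
    have "lip_primitive 0 S (\<lambda>t. p t \<bullet> r t + - adj t (p t) \<bullet> e t) (\<lambda>t. p t \<bullet> e t)" .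
    from lip_primitive_has_integral[OF this, of 0 S]
    have i1: "((\<lambda>t. p t \<bullet> r t + - adj t (p t) \<bullet> e t) has_integral p S \<bullet> e S) {0..S}"
      using S x0 by (simp add: e_def)
    have i2: "((\<lambda>t. \<epsilon> * sens p a w t) has_integral \<epsilon> * integral {0..S} (sens p a w)) {0..S}"
      by (intro has_integral_mult_right integrable_integral sens_integrable[OF S(2) pc a w])
    note i3 = has_integral_diff[OF i1 i2]
    have "norm (integral {0..S} (\<lambda>t. p t \<bullet> r t + - adj t (p t) \<bullet> e t - \<epsilon> * sens p a w t)) \<le>
        integral {0..S} (\<lambda>_. P * ((\<kappa>' + \<kappa>') * (\<epsilon> * (K + C))))"
    proof (rule integral_norm_bound_integral[OF has_integral_integrable[OF i3] integrable_const_ivl])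
      fix t assume t: "t \<in> {0..S}"
      then have tT: "t \<in> {0..T}" using S by auto
      define z where "z = (x\<^sub>0 t, u t)"
      define h where "h = (e t, \<epsilon> *\<^sub>R w t)"
      have zb: "norm z \<le> R + R"
        using norm_Pair_le[of "x\<^sub>0 t" "u t"] x\<^sub>0_bound[OF tT] u_bound[OF tT] unfolding z_def by linarith
      have "norm (e t) \<le> K * \<epsilon>" using bspec[OF xK tT] by (simp add: e_def)
      moreover have "norm (\<epsilon> *\<^sub>R w t) \<le> \<epsilon> * C" using w(2)[OF tT] \<epsilon>(1) by simp
      ultimately have hb: "norm h \<le> \<epsilon> * (K + C)"
        using norm_Pair_le[of "e t" "\<epsilon> *\<^sub>R w t"] unfolding h_def by (simp add: algebra_simps)
      have h1: "norm h \<le> \<delta>" using hb el(2) by simp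
      have h2: "norm h \<le> K + C"
      proof -
        have "\<epsilon> * (K + C) \<le> 1 * (K + C)" using el(1) K C by (intro mult_right_mono) auto
        then show ?thesis using hb by simp
      qed
      have zh: "(x t, v t) = z + h" by (simp add: z_def h_def e_def v_def)
      have A: "norm (f (z + h) - f z - f' z h) \<le> \<kappa>' * norm h" by (rule \<delta>(2)[OF zb h1])
      have "norm (z + h) \<le> Q" using norm_triangle_ineq[of z h] zb h2 by (simp add: Q_def)
      moreover have "norm z \<le> Q" using zb K C by (simp add: Q_def)
      ultimately have B: "norm (f (z + h) - f z) \<le> M * norm h" using M(2)[of "z + h" z] by simp
      have B': "norm ((\<epsilon> * a t) *\<^sub>R (f (z + h) - f z)) \<le> \<kappa>' * norm h"
      proof -
        have "norm ((\<epsilon> * a t) *\<^sub>R (f (z + h) - f z)) \<le> (\<epsilon> * C) * (M * norm h)"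
          unfolding norm_scaleR abs_mult using a(2)[OF tT] \<epsilon>(1) C by (intro mult_mono B) auto
        also have "\<dots> = (\<epsilon> * C * M) * norm h" by simp
        also have "\<dots> \<le> \<kappa>' * norm h" by (rule mult_right_mono[OF eCM]) simp
        finally show ?thesis .
      qed
      have "f' z h = f' z (e t, 0) + \<epsilon> *\<^sub>R f' z (0, w t)"
        unfolding h_def blinfun.scaleR_right[symmetric] blinfun.add_right[symmetric] by simp
      \<comment> \<open>After cancellation the error consists of the Taylor remainder of
        \<open>f\<close> and the second-order product of speed change and velocity change.\<close>
      then have eq: "p t \<bullet> r t + - adj t (p t) \<bullet> e t - \<epsilon> * sens p a w t =
          p t \<bullet> ((f (z + h) - f z - f' z h) + (\<epsilon> * a t) *\<^sub>R (f (z + h) - f z))"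
        unfolding r_def zh sens_def inner_minus_left adj_inner z_def[symmetric]
        by (simp add: inner_diff_right inner_add_right algebra_simps)
      have "norm (p t \<bullet> ((f (z + h) - f z - f' z h) + (\<epsilon> * a t) *\<^sub>R (f (z + h) - f z))) \<le>
          norm (p t) * norm ((f (z + h) - f z - f' z h) + (\<epsilon> * a t) *\<^sub>R (f (z + h) - f z))"
        using Cauchy_Schwarz_ineq2 by simp
      also have "\<dots> \<le> P * (\<kappa>' * norm h + \<kappa>' * norm h)"
        by (intro mult_mono P(2)[OF t] order_trans[OF norm_triangle_ineq] add_mono A B') (use P in auto)
      also have "\<dots> = P * ((\<kappa>' + \<kappa>') * norm h)" by (simp add: algebra_simps)
      also have "\<dots> \<le> P * ((\<kappa>' + \<kappa>') * (\<epsilon> * (K + C)))"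
        using P(1) \<kappa>' by (intro mult_left_mono hb) auto
      finally show "norm (p t \<bullet> r t + - adj t (p t) \<bullet> e t - \<epsilon> * sens p a w t) \<le> P * ((\<kappa>' + \<kappa>') * (\<epsilon> * (K + C)))"
        unfolding eq .
    qed
    also have "\<dots> = \<kappa> / 2 * \<epsilon>" using S(1) P(1) K C by (simp add: \<kappa>'_def field_simps add_nonneg_eq_0_iff)
    finally have 1: "\<bar>p S \<bullet> e S - \<epsilon> * integral {0..S} (sens p a w)\<bar> \<le> \<kappa> / 2 * \<epsilon>"
      unfolding integral_unique[OF i3] by simp
    have eS: "norm (e S) \<le> K * \<epsilon>" using bspec[OF xK, of S] S by (simp add: e_def)
    then have "norm (x S - x\<^sub>0 S) < \<delta>2" using el(3) by (simp add: e_def)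
    from \<delta>2(2)[OF this] have "\<bar>\<Phi> (x S) - \<Phi> (x\<^sub>0 S) - p S \<bullet> e S\<bar> \<le> \<kappa> / (2 * K) * norm (e S)" by (simp add: e_def)
    also have "\<dots> \<le> \<kappa> / (2 * K) * (K * \<epsilon>)" using \<kappa> K by (intro mult_left_mono eS) auto
    also have "\<dots> = \<kappa> / 2 * \<epsilon>" using K by simp
    finally show ?thesis using 1 by linarith
  qed
  then show ?thesis using e1 by blast
qed

end

section \<open>Necessary conditions for a penalized extremal\<close>

text \<open>A one-dimensional Farkas lemma: the slope is squeezed between the two families of quotients.\<close>

lemma penalty_slope_exists:
  fixes S :: "(real \<times> real) set"
  assumes cone: "\<And>l r l' r' s t. (l, r) \<in> S \<Longrightarrow> (l', r') \<in> S \<Longrightarrow> s > 0 \<Longrightarrow> t > 0 \<Longrightarrow> (s * l + t * l', s * r + t * r') \<in> S"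
    and pen: "\<And>l r. (l, r) \<in> S \<Longrightarrow> 0 \<le> l + \<Lambda> * max 0 r" and \<Lambda>: "\<Lambda> \<ge> 0"
  shows "\<exists>\<beta>. \<forall>(l, r)\<in>S. 0 \<le> l + \<beta> * r"
proof -
  \<comment> \<open>Inserting 0 makes the set non-empty and covers the elements with r < 0, for
    which the penalty inequality reads 0 \<le> l.\<close>
  define A where "A = insert 0 {- l / r | l r. (l, r) \<in> S \<and> r > 0}"
  have A_le: "x \<le> \<Lambda>" if "x \<in> A" for x
    using that pen \<Lambda> by (force simp: A_def field_simps)
  then have bdd: "bdd_above A" by (rule bdd_aboveI)
  have "0 \<le> l + Sup A * r" if lr: "(l, r) \<in> S" for l r
  proof -
    consider "r > 0" | "r = 0" | "r < 0" by linarith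
    then show ?thesis
    proof cases
      case 1
      then have "- l / r \<in> A" using lr by (auto simp: A_def)
      then have "- l / r \<le> Sup A" by (rule cSup_upper[OF _ bdd])
      then show ?thesis using 1 by (simp add: field_simps)
    next
      case 2
      then show ?thesis using pen[OF lr] by simp
    next
      case 3
      have "Sup A \<le> l / - r"
      proof (rule cSup_least)
        show "A \<noteq> {}" by (auto simp: A_def)
        fix x assume "x \<in> A"
        then consider "x = 0" | l' r' where "x = - l' / r'" "(l', r') \<in> S" "r' > 0" by (auto simp: A_def)
        then show "x \<le> l / - r"
        proof cases
          case 1
          then show ?thesis using pen[OF lr] 3 by (simp add: divide_nonneg_neg)
        next
          case (2 l' r')
          \<comment> \<open>The weights cancel the second coordinate, so the penalty vanishes on
            this combination.\<close>
          have "(r' * l + (- r) * l', r' * r + (- r) * r') \<in> S" using cone[OF lr 2(2), of r' "- r"] 2 3 by simp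
          from pen[OF this] have *: "0 \<le> r' * l + (- r) * l'" by simp
          have r: "- r > 0" using \<open>r < 0\<close> by simp
          have "- l' * - r \<le> l * r'" using * by (simp add: algebra_simps)
          then have "- l' \<le> l * r' / - r" by (simp only: pos_le_divide_eq[OF r])
          then have "- l' \<le> l / - r * r'" by simp
          then show ?thesis unfolding 2(1) by (simp only: pos_divide_le_eq[OF 2(3)])
        qed
      qed
      then show ?thesis using 3 by (simp add: field_simps)
    qed
  qed
  then show ?thesis by blast
qed

text \<open>A variation with speed factor \<open>1 + h * dilation T \<tau> \<theta> t\<close> becomes a trajectory of the original dynamics after
  the time change that fixes \<open>0\<close> and \<open>T\<close> and moves \<open>\<tau>\<close> to \<open>\<tau> + h * \<theta>\<close>.\<close>

definition dilation :: "real \<Rightarrow> real \<Rightarrow> real \<Rightarrow> real \<Rightarrow> real" where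
  "dilation T \<tau> \<theta> t = (if t \<le> \<tau> then \<theta> / \<tau> else - \<theta> / (T - \<tau>))"

text \<open>Interface between crossing analysis and multiplier theory. Only \<open>minimal\<close>
  and g = 0 at the crossing remain of the time crisis problem. The threshold in
  \<open>minimal\<close> may depend on the variation.\<close>

locale penalized_extremal = controlled_trajectory f f' T R x\<^sub>0 u
  for f :: "'a::euclidean_space \<times> 'b::euclidean_space \<Rightarrow> 'a" and f' T R x\<^sub>0 u +
  fixes c :: "'b \<Rightarrow> real^'l" and c' :: "'b \<Rightarrow> 'b \<Rightarrow>\<^sub>L (real^'l)"
    and \<delta> \<epsilon> \<tau> \<Lambda> :: real and \<Phi> g :: "'a \<Rightarrow> real" and d\<Phi> dg :: 'a
  assumes c': "\<And>v. (c has_derivative blinfun_apply (c' v)) (at v)" "continuous_on UNIV c'"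
    and \<delta>: "\<delta> > 0" and \<epsilon>: "\<epsilon> > 0"
    and nonpos: "\<And>t i. t \<in> {0..T} \<Longrightarrow> c (u t) $ i \<le> 0"
    and qual: "\<And>t \<xi>. t \<in> {0..T} \<Longrightarrow> (\<And>i. c (u t) $ i < - \<delta> \<Longrightarrow> \<xi> $ i = 0) \<Longrightarrow>
        \<epsilon> * norm (\<xi> :: real^'l) \<le> norm (\<Sum>i\<in>UNIV. \<xi> $ i *\<^sub>R riesz (\<lambda>b. c' (u t) b $ i))"
    and \<tau>: "\<tau> \<in> {0<..<T}"
    and d\<Phi>: "(\<Phi> has_derivative (\<lambda>h. d\<Phi> \<bullet> h)) (at (x\<^sub>0 T))"
    and dg: "(g has_derivative (\<lambda>h. dg \<bullet> h)) (at (x\<^sub>0 \<tau>))"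
    and g0: "g (x\<^sub>0 \<tau>) = 0"
    and \<Lambda>: "\<Lambda> \<ge> 0"
    and minimal: "\<And>\<theta> w C K. w \<in> borel_measurable (lebesgue_on {0..T}) \<Longrightarrow> (\<And>t. t \<in> {0..T} \<Longrightarrow> norm (w t) \<le> C) \<Longrightarrow> K > 0 \<Longrightarrow>
      \<exists>e>0. \<forall>h x. 0 < h \<and> h < e \<and> variation (dilation T \<tau> \<theta>) w h x \<and> (\<forall>t\<in>{0..T}. norm (x t - x\<^sub>0 t) \<le> K * h) \<and>
        (\<forall>t\<in>{0..T}. \<forall>i. c (u t + h *\<^sub>R w t) $ i \<le> 0) \<longrightarrow>
        \<Phi> (x\<^sub>0 T) \<le> \<Phi> (x T) - h * \<theta> + \<Lambda> * max 0 (g (x \<tau>))"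
begin

definition gc :: "'l \<Rightarrow> real \<Rightarrow> 'b" where
  "gc i t = riesz (\<lambda>b. c' (u t) b $ i)"

definition active_gc :: "'l \<Rightarrow> real \<Rightarrow> 'b" where
  "active_gc i t = (if c (u t) $ i < - \<delta> then 0 else gc i t)"

lemma linear_c'_component: "linear (\<lambda>h. c' v h $ i)"
  by (intro linearI) (simp_all add: blinfun.add_right blinfun.scaleR_right)

lemma gc_inner: "gc i t \<bullet> h = c' (u t) h $ i"
  unfolding gc_def by (rule riesz_inner[OF linear_c'_component])

lemma gc_measurable: "gc i \<in> borel_measurable (lebesgue_on {0..T})"
proof -
  have "continuous_on UNIV (\<lambda>v. c' v b $ i)" for b
    by (intro continuous_intros bounded_bilinear.continuous_on[OF bounded_bilinear_blinfun_apply] c'(2))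
  from borel_measurable_continuous_on[OF this u_meas] show ?thesis
    unfolding gc_def riesz_def by (intro borel_measurable_sum borel_measurable_scaleR borel_measurable_const)
qed

lemma c_measurable: "(\<lambda>t. c (u t) $ i) \<in> borel_measurable (lebesgue_on {0..T})"
proof -
  have "continuous_on UNIV c"
    using c'(1) by (meson continuous_at_imp_continuous_on has_derivative_continuous)
  then have "continuous_on UNIV (\<lambda>v. c v $ i)" by (intro continuous_intros)
  from borel_measurable_continuous_on[OF this u_meas] show ?thesis .
qed

lemma active_gc_measurable: "active_gc i \<in> borel_measurable (lebesgue_on {0..T})"
  unfolding active_gc_def[abs_def] using gc_measurable[of i] c_measurable[of i] by measurable

lemma gc_bounded: "\<exists>B. \<forall>t\<in>{0..T}. \<forall>i. norm (gc i t) \<le> B"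
proof -
  obtain M where M: "M > 0" "\<And>z. norm z \<le> R \<Longrightarrow> norm (c' z) \<le> M"
    by (rule C1_bounds_on_ball[OF c', of R]) blast
  have "norm (gc i t) \<le> M" if t: "t \<in> {0..T}" for i t
    unfolding gc_def
  proof (rule norm_riesz_le[OF linear_c'_component])
    show "c' (u t) h $ i \<le> M * norm h" for h
    proof -
      have "c' (u t) h $ i \<le> norm (c' (u t) h)" using component_le_norm_cart abs_le_D1 by blast
      also have "\<dots> \<le> M * norm h"
        by (intro order_trans[OF norm_blinfun] mult_right_mono M(2) u_bound[OF t]) simp
      finally show ?thesis .
    qed
  qed (use M in simp)
  then show ?thesis by blast
qed

lemma active_qual:
  assumes "t \<in> {0..T}" "\<And>i. c (u t) $ i < - \<delta> \<Longrightarrow> \<xi> $ i = 0"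
  shows "\<epsilon> * norm (\<xi> :: real^'l) \<le> norm (\<Sum>i\<in>UNIV. \<xi> $ i *\<^sub>R active_gc i t)"
proof -
  have "(\<Sum>i\<in>UNIV. \<xi> $ i *\<^sub>R active_gc i t) = (\<Sum>i\<in>UNIV. \<xi> $ i *\<^sub>R riesz (\<lambda>b. c' (u t) b $ i))"
    using assms(2) by (intro sum.cong) (auto simp: active_gc_def gc_def)
  then show ?thesis using qual[OF assms] by simp
qed

text \<open>A uniform Mangasarian-Fromovitz direction: one number k serves both as activity
  threshold and as rate of decrease, so a single step size is feasible at all times.\<close>

definition inward :: "(real \<Rightarrow> 'b) \<Rightarrow> bool" where
  "inward w \<longleftrightarrow> w \<in> borel_measurable (lebesgue_on {0..T}) \<and> (\<exists>C. \<forall>t\<in>{0..T}. norm (w t) \<le> C) \<and>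
     (\<exists>k>0. k \<le> \<delta> \<and> (\<forall>t\<in>{0..T}. \<forall>i. c (u t) $ i \<ge> - k \<longrightarrow> active_gc i t \<bullet> w t \<le> - k))"

text \<open>Stated for all large bounds because the same \<open>B\<close> must later bound the
  control derivative of the Hamiltonian as well.\<close>

lemma active_gradients_eventually:
  "\<exists>B\<^sub>0. \<forall>B\<ge>B\<^sub>0. active_gradients active_gc (\<lambda>i t. c (u t) $ i) 0 T B \<delta> \<epsilon>"
proof -
  obtain B\<^sub>0 where B\<^sub>0: "\<forall>t\<in>{0..T}. \<forall>i. norm (gc i t) \<le> B\<^sub>0" using gc_bounded by blast
  have "active_gradients active_gc (\<lambda>i t. c (u t) $ i) 0 T B \<delta> \<epsilon>" if B: "\<bar>B\<^sub>0\<bar> \<le> B" for B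
  proof
    show "norm (active_gc i t) \<le> B" if "t \<in> {0..T}" for i t
      using order_trans[OF bspec[OF B\<^sub>0 that, THEN spec, of i] abs_ge_self] B order_trans[OF abs_ge_zero B] by (simp add: active_gc_def)
    show "active_gc i t = 0" if "c (u t) $ i < - \<delta>" for i t using that by (simp add: active_gc_def)
    show "\<epsilon> * norm \<xi> \<le> norm (\<Sum>i\<in>UNIV. \<xi> $ i *\<^sub>R active_gc i t)"
      if "t \<in> {0..T}" "\<And>i. c (u t) $ i < - \<delta> \<Longrightarrow> \<xi> $ i = 0" for t \<xi>
      using that by (rule active_qual)
  qed (rule active_gc_measurable c_measurable \<delta> \<epsilon>)+
  then show ?thesis by blast
qed

lemma inward_nonempty: "\<exists>w. inward w"
proof -
  obtain B where "active_gradients active_gc (\<lambda>i t. c (u t) $ i) 0 T B \<delta> \<epsilon>"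
    using active_gradients_eventually by blast
  note active_gradients.inward_direction_exists[OF this]
  then obtain w C where w: "w \<in> borel_measurable (lebesgue_on {0..T})" "\<forall>t\<in>{0..T}. norm (w t) \<le> C"
    "\<forall>i. \<forall>t\<in>{0..T}. c (u t) $ i \<ge> - \<delta> \<longrightarrow> active_gc i t \<bullet> w t = - 1" by blast
  have "active_gc i t \<bullet> w t \<le> - min \<delta> 1" if "t \<in> {0..T}" "c (u t) $ i \<ge> - min \<delta> 1" for t i
  proof -
    have "c (u t) $ i \<ge> - \<delta>" using that(2) by linarith
    then show ?thesis using w(3) that(1) by simp
  qed
  then have "inward w" unfolding inward_def using w(1,2) \<delta> by (intro conjI exI[of _ C] exI[of _ "min \<delta> 1"]) auto
  then show ?thesis by blast
qed

lemma inward_combine: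
  assumes "inward w" "inward w'" and st: "s > 0" "t > 0"
  shows "inward (\<lambda>r. s *\<^sub>R w r + t *\<^sub>R w' r)"
proof -
  obtain C k where w: "w \<in> borel_measurable (lebesgue_on {0..T})" "\<forall>t\<in>{0..T}. norm (w t) \<le> C" "k > 0" "k \<le> \<delta>"
    "\<forall>t\<in>{0..T}. \<forall>i. c (u t) $ i \<ge> - k \<longrightarrow> active_gc i t \<bullet> w t \<le> - k" using assms(1) unfolding inward_def by blast
  obtain C' k' where w': "w' \<in> borel_measurable (lebesgue_on {0..T})" "\<forall>t\<in>{0..T}. norm (w' t) \<le> C'" "k' > 0" "k' \<le> \<delta>"
    "\<forall>t\<in>{0..T}. \<forall>i. c (u t) $ i \<ge> - k' \<longrightarrow> active_gc i t \<bullet> w' t \<le> - k'" using assms(2) unfolding inward_def by blast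
  \<comment> \<open>The first summand alone supplies the decrease s k; the second contributes
    something negative.\<close>
  define m where "m = min (min k k') (s * k)"
  have m: "m > 0" "m \<le> \<delta>" "m \<le> k" "m \<le> k'" "m \<le> s * k" using w w' st by (auto simp: m_def)
  show ?thesis unfolding inward_def
  proof (rule conjI, goal_cases)
    case 1
    show "(\<lambda>r. s *\<^sub>R w r + t *\<^sub>R w' r) \<in> borel_measurable (lebesgue_on {0..T})"
      by (intro borel_measurable_add borel_measurable_scaleR borel_measurable_const w w')
  next
    case 2
    have "norm (s *\<^sub>R w r + t *\<^sub>R w' r) \<le> s * C + t * C'" if "r \<in> {0..T}" for r
      using that w(2) w'(2) st by (intro order_trans[OF norm_triangle_ineq] add_mono) auto
    moreover have "active_gc i r \<bullet> (s *\<^sub>R w r + t *\<^sub>R w' r) \<le> - m"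
      if r: "r \<in> {0..T}" "- m \<le> c (u r) $ i" for r i
    proof -
      have "- k \<le> c (u r) $ i" "- k' \<le> c (u r) $ i" using m r(2) by linarith+
      then have "active_gc i r \<bullet> w r \<le> - k" "active_gc i r \<bullet> w' r \<le> - k'" using w(5) w'(5) r(1) by auto
      then have "s * (active_gc i r \<bullet> w r) \<le> s * - k" and "t * (active_gc i r \<bullet> w' r) \<le> t * - k'"
        using mult_left_mono[OF _ less_imp_le[OF st(1)]] mult_left_mono[OF _ less_imp_le[OF st(2)]] by blast+
      moreover have "t * k' > 0" using st w'(3) by simp
      ultimately show ?thesis using m(5) by (simp add: inner_add_right)
    qed
    ultimately show ?case using m(1,2) by blast
  qed
qed

text \<open>Where a constraint is at least -k, the linear decrease h k pays for the remainder h k.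
  Elsewhere the slack k absorbs any change of order h.\<close>

lemma inward_feasible:
  assumes "inward w"
  shows "\<exists>e>0. \<forall>h. 0 < h \<and> h < e \<longrightarrow> (\<forall>t\<in>{0..T}. \<forall>i. c (u t + h *\<^sub>R w t) $ i \<le> 0)"
proof -
  obtain C0 k where w: "\<forall>t\<in>{0..T}. norm (w t) \<le> C0" "k > 0" "k \<le> \<delta>"
    "\<forall>t\<in>{0..T}. \<forall>i. c (u t) $ i \<ge> - k \<longrightarrow> active_gc i t \<bullet> w t \<le> - k" using assms unfolding inward_def by blast
  define C where "C = \<bar>C0\<bar> + 1"
  have C: "C > 0" "\<And>t. t \<in> {0..T} \<Longrightarrow> norm (w t) \<le> C" using w(1) by (force simp: C_def)+
  have kC: "k / C > 0" using w(2) C by simp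
  obtain d where d: "d > 0" "\<And>z h. norm z \<le> R \<Longrightarrow> norm h \<le> d \<Longrightarrow> norm (c (z + h) - c z - c' z h) \<le> k / C * norm h"
    by (rule C1_uniform_expansion[OF c' kC]) blast
  obtain M where M: "M > 0" "\<And>z. norm z \<le> R \<Longrightarrow> norm (c' z) \<le> M"
    by (rule C1_bounds_on_ball[OF c', of R]) blast
  \<comment> \<open>d/C brings \<open>h *\<^sub>R w t\<close> into the range of the expansion; k/(M
    C + k) keeps linear term and remainder together below the slack.\<close>
  define e where "e = min (d / C) (k / (M * C + k))"
  have "e > 0" using d(1) C w(2) M by (auto simp: e_def intro!: divide_pos_pos add_nonneg_pos)
  moreover have "c (u t + h *\<^sub>R w t) $ i \<le> 0" if h: "0 < h" "h < e" and t: "t \<in> {0..T}" for h t i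
  proof -
    have hw: "norm (h *\<^sub>R w t) \<le> h * C" using C(2)[OF t] h(1) by simp
    have "h * C \<le> d" using h C by (simp add: e_def field_simps)
    then have "norm (c (u t + h *\<^sub>R w t) - c (u t) - c' (u t) (h *\<^sub>R w t)) \<le> k / C * norm (h *\<^sub>R w t)"
      using hw by (intro d(2) u_bound[OF t]) simp
    also have "\<dots> \<le> k / C * (h * C)" using kC by (intro mult_left_mono hw) simp
    also have "\<dots> = h * k" using C by simp
    finally have n: "norm (c (u t + h *\<^sub>R w t) - c (u t) - c' (u t) (h *\<^sub>R w t)) \<le> h * k" .
    have "c (u t + h *\<^sub>R w t) $ i - c (u t) $ i - c' (u t) (h *\<^sub>R w t) $ i \<le> h * k"
      using component_le_norm_cart[of "c (u t + h *\<^sub>R w t) - c (u t) - c' (u t) (h *\<^sub>R w t)" i] n by simp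
    then have main: "c (u t + h *\<^sub>R w t) $ i \<le> c (u t) $ i + h * (gc i t \<bullet> w t) + h * k"
      by (simp add: gc_inner blinfun.scaleR_right)
    show ?thesis
    proof (cases "c (u t) $ i \<ge> - k")
      case True
      then have "active_gc i t = gc i t" using w(3) by (simp add: active_gc_def)
      then have "gc i t \<bullet> w t \<le> - k" using w(4) t True by force
      then have "h * (gc i t \<bullet> w t) \<le> h * - k" using h(1) by (intro mult_left_mono) auto
      then show ?thesis using main nonpos[OF t, of i] by simp
    next
      case False
      have "gc i t \<bullet> w t \<le> norm (c' (u t) (w t))" unfolding gc_inner
        using component_le_norm_cart abs_le_D1 by blast
      also have "\<dots> \<le> norm (c' (u t)) * norm (w t)" by (rule norm_blinfun)
      also have "\<dots> \<le> M * C" using M C(2)[OF t] by (intro mult_mono M(2) u_bound[OF t]) auto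
      finally have "h * (gc i t \<bullet> w t) \<le> h * (M * C)" using h(1) by (intro mult_left_mono) auto
      moreover have "h * (M * C + k) \<le> k"
      proof -
        have "M * C + k > 0" using M(1) C(1) w(2) by (simp add: add_pos_pos)
        moreover have "h < k / (M * C + k)" using h(2) by (simp add: e_def)
        ultimately show ?thesis by (simp add: pos_less_divide_eq)
      qed
      then have "h * (M * C) + h * k \<le> k" by (simp add: algebra_simps)
      ultimately show ?thesis using main False by linarith
    qed
  qed
  ultimately show ?thesis by blast
qed

lemma dilation_measurable: "dilation T \<tau> \<theta> \<in> borel_measurable (lebesgue_on {0..T})"
proof -
  have "dilation T \<tau> \<theta> \<in> borel_measurable lborel" unfolding dilation_def[abs_def] by measurable
  then have "dilation T \<tau> \<theta> \<in> borel_measurable lebesgue" by (rule measurable_completion)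
  then show ?thesis by (rule measurable_restrict_space1)
qed

lemma dilation_bound: "\<bar>dilation T \<tau> \<theta> t\<bar> \<le> \<bar>\<theta> / \<tau>\<bar> + \<bar>\<theta> / (T - \<tau>)\<bar>"
  by (simp add: dilation_def)

lemma sens_split:
  "sens p (dilation T \<tau> \<theta>) w t = \<theta> * sens p (dilation T \<tau> 1) (\<lambda>_. 0) t + sens p (\<lambda>_. 0) w t"
proof -
  have "dilation T \<tau> \<theta> t = \<theta> * dilation T \<tau> 1 t" by (simp add: dilation_def)
  then show ?thesis by (simp add: sens_def inner_add_right blinfun.zero_right zero_prod_def[symmetric])
qed

lemma sens_combine:
  "sens p (\<lambda>_. 0) (\<lambda>t. s *\<^sub>R w t + r *\<^sub>R w' t) t = s * sens p (\<lambda>_. 0) w t + r * sens p (\<lambda>_. 0) w' t"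
proof -
  have "(0::'a, s *\<^sub>R w t + r *\<^sub>R w' t) = s *\<^sub>R (0, w t) + r *\<^sub>R (0, w' t)" by simp
  then have "f' z (0, s *\<^sub>R w t + r *\<^sub>R w' t) = s *\<^sub>R f' z (0, w t) + r *\<^sub>R f' z (0, w' t)" for z
    by (simp only: blinfun.add_right blinfun.scaleR_right)
  then show ?thesis by (simp add: sens_def inner_add_right)
qed

text \<open>The quotients by \<tau> and T - \<tau> are mean values of p \<bullet> f over the two
  pieces. They have opposite signs because a shift of \<tau> lengthens one piece and shortens the
  other, and the 1 comes from the term - h \<theta> in the penalized cost. The jump of the costate
  at \<tau> is the crossing multiplier times the gradient of \<open>g\<close>.\<close>

lemma normal_multiplier:
  "\<exists>p1 p2 \<beta> I1 I2 (\<mu> :: 'l \<Rightarrow> real \<Rightarrow> real) B N.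
    lip_primitive 0 T (\<lambda>t. - adj t (p2 t)) p2 \<and> p2 T = d\<Phi> \<and>
    lip_primitive 0 \<tau> (\<lambda>t. - adj t (p1 t)) p1 \<and> p1 \<tau> = p2 \<tau> + \<beta> *\<^sub>R dg \<and>
    ((\<lambda>t. p1 t \<bullet> f (x\<^sub>0 t, u t)) has_integral I1) {0..\<tau>} \<and>
    ((\<lambda>t. p2 t \<bullet> f (x\<^sub>0 t, u t)) has_integral I2) {\<tau>..T} \<and> I1 / \<tau> - I2 / (T - \<tau>) = 1 \<and>
    (\<forall>i. \<mu> i \<in> borel_measurable (lebesgue_on {0..T})) \<and> (\<forall>i. \<forall>t\<in>{0..T}. \<bar>\<mu> i t\<bar> \<le> B) \<and>
    negligible N \<and> (\<forall>t\<in>{0..T} - N. (\<forall>i. 0 \<le> \<mu> i t \<and> \<mu> i t * c (u t) $ i = 0) \<and>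
      (\<forall>h. (if t \<le> \<tau> then p1 t else p2 t) \<bullet> f' (x\<^sub>0 t, u t) (0, h) + (\<Sum>i\<in>UNIV. \<mu> i t * c' (u t) h $ i) = 0))"
proof -
  have \<tau>': "0 < \<tau>" "\<tau> \<le> T" "\<tau> < T" using \<tau> by auto
  obtain pa where pa: "lip_primitive 0 T (\<lambda>t. - adj t (pa t)) pa" "pa T = d\<Phi>"
    by (rule adjoint_exists[OF T order_refl])
  obtain pb where pb: "lip_primitive 0 \<tau> (\<lambda>t. - adj t (pb t)) pb" "pb \<tau> = dg"
    by (rule adjoint_exists[OF \<tau>'(1,2)])
  note pac = lip_primitive_continuous[OF pa(1)] and pbc = lip_primitive_continuous[OF pb(1)]
  have pa\<tau>: "lip_primitive 0 \<tau> (\<lambda>t. - adj t (pa t)) pa"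
    by (rule lip_primitive_subinterval[OF pa(1)]) (use \<tau>' in auto)
  \<comment> \<open>\<open>Ea\<close> and \<open>Eb\<close> are the coefficients of \<theta> in the
    first-order changes of \<Phi>(x(T)) and g(x(\<tau>)); \<open>Fa\<close> and \<open>Fb\<close>
    are the contributions of the control.\<close>
  define Ea where "Ea = integral {0..T} (sens pa (dilation T \<tau> 1) (\<lambda>_. 0))"
  define Eb where "Eb = integral {0..\<tau>} (sens pb (dilation T \<tau> 1) (\<lambda>_. 0))"
  define Fa where "Fa = (\<lambda>w. integral {0..T} (sens pa (\<lambda>_. 0) w))"
  define Fb where "Fb = (\<lambda>w. integral {0..\<tau>} (sens pb (\<lambda>_. 0) w))"
  have int0: "sens p (dilation T \<tau> 1) (\<lambda>_. 0) integrable_on {0..S}" if "S \<le> T" "continuous_on {0..S} p" for p S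
    by (rule sens_integrable[OF that dilation_measurable dilation_bound]) auto
  have intw: "sens p (\<lambda>_. 0) w integrable_on {0..S}" if "S \<le> T" "continuous_on {0..S} p"
    "w \<in> borel_measurable (lebesgue_on {0..T})" "\<And>t. t \<in> {0..T} \<Longrightarrow> norm (w t) \<le> C" for p S w C
  proof (rule sens_integrable[OF that(1,2), of _ "\<bar>C\<bar>"])
    show "norm (w t) \<le> \<bar>C\<bar>" if "t \<in> {0..T}" for t using \<open>\<And>t. t \<in> {0..T} \<Longrightarrow> norm (w t) \<le> C\<close>[OF that] by simp
  qed (use that in auto)
  have split: "integral {0..S} (sens p (dilation T \<tau> \<theta>) w) =
      \<theta> * integral {0..S} (sens p (dilation T \<tau> 1) (\<lambda>_. 0)) + integral {0..S} (sens p (\<lambda>_. 0) w)"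
    if "S \<le> T" "continuous_on {0..S} p" "w \<in> borel_measurable (lebesgue_on {0..T})" "\<And>t. t \<in> {0..T} \<Longrightarrow> norm (w t) \<le> C" for p S w C \<theta>
    unfolding sens_split[of p \<theta> w, THEN ext]
    by (intro integral_unique has_integral_add has_integral_mult_right integrable_integral int0[OF that(1,2)] intw[OF that])
  have claimA: "0 \<le> (\<theta> * (Ea - 1) + Fa w) + \<Lambda> * max 0 (\<theta> * Eb + Fb w)" if w: "inward w" for \<theta> w
  proof -
    obtain C where wm: "w \<in> borel_measurable (lebesgue_on {0..T})" and C: "\<And>t. t \<in> {0..T} \<Longrightarrow> norm (w t) \<le> C"
      using w unfolding inward_def by blast
    define D where "D = max C (\<bar>\<theta> / \<tau>\<bar> + \<bar>\<theta> / (T - \<tau>)\<bar>)"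
    let ?a = "dilation T \<tau> \<theta>"
    have wD: "norm (w t) \<le> D" if "t \<in> {0..T}" for t using C[OF that] by (simp add: D_def)
    have aD: "\<bar>?a t\<bar> \<le> D" for t using dilation_bound[of \<theta> t] unfolding D_def by (rule max.coboundedI2)
    obtain K e0 where K: "K > 0" and e0: "e0 > 0" and ex: "\<And>h. 0 < h \<Longrightarrow> h < e0 \<Longrightarrow>
        \<exists>x. variation ?a w h x \<and> (\<forall>t\<in>{0..T}. norm (x t - x\<^sub>0 t) \<le> K * h)"
      using variation_exists[OF dilation_measurable[of \<theta>] aD wm wD] by metis
    obtain e1 where e1: "e1 > 0" "\<And>h. 0 < h \<Longrightarrow> h < e1 \<Longrightarrow> (\<forall>t\<in>{0..T}. \<forall>i. c (u t + h *\<^sub>R w t) $ i \<le> 0)"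
      using inward_feasible[OF w] by blast
    obtain e2 where e2: "e2 > 0" "\<And>h x. 0 < h \<Longrightarrow> h < e2 \<Longrightarrow> variation ?a w h x \<Longrightarrow>
        (\<forall>t\<in>{0..T}. norm (x t - x\<^sub>0 t) \<le> K * h) \<Longrightarrow> (\<forall>t\<in>{0..T}. \<forall>i. c (u t + h *\<^sub>R w t) $ i \<le> 0) \<Longrightarrow>
        \<Phi> (x\<^sub>0 T) \<le> \<Phi> (x T) - h * \<theta> + \<Lambda> * max 0 (g (x \<tau>))"
      using minimal[OF wm C K, of \<theta>] by blast
    define l where "l = \<theta> * (Ea - 1) + Fa w"
    define r where "r = \<theta> * Eb + Fb w"
    have la: "integral {0..T} (sens pa ?a w) = l + \<theta>"
      using split[OF order_refl pac wm C, of \<theta>] by (simp add: l_def Ea_def Fa_def algebra_simps)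
    have rb: "integral {0..\<tau>} (sens pb ?a w) = r"
      using split[OF \<tau>'(2) pbc wm C, of \<theta>] by (simp add: r_def Eb_def Fb_def)
    \<comment> \<open>After division by h the first-order errors count \<kappa> for \<Phi> and
      \<Lambda> \<kappa> for the penalty. Since l and r do not depend on \<kappa>, it can be sent to
      0.\<close>
    have "0 \<le> l + \<Lambda> * max 0 r + \<kappa> * (1 + \<Lambda>)" if \<kappa>: "\<kappa> > 0" for \<kappa>
    proof -
      have d\<Phi>': "(\<Phi> has_derivative (\<lambda>h. pa T \<bullet> h)) (at (x\<^sub>0 T))" using d\<Phi> pa(2) by simp
      have dg': "(g has_derivative (\<lambda>h. pb \<tau> \<bullet> h)) (at (x\<^sub>0 \<tau>))" using dg pb(2) by simp
      obtain e3 where e3: "e3 > 0" "\<And>h x. 0 < h \<Longrightarrow> h < e3 \<Longrightarrow> variation ?a w h x \<Longrightarrow>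
          (\<forall>t\<in>{0..T}. norm (x t - x\<^sub>0 t) \<le> K * h) \<Longrightarrow> \<bar>\<Phi> (x T) - \<Phi> (x\<^sub>0 T) - h * (l + \<theta>)\<bar> \<le> \<kappa> * h"
        using variation_first_order[OF T order_refl pa(1) d\<Phi>' dilation_measurable[of \<theta>] aD wm wD K \<kappa>]
        unfolding la by blast
      obtain e4 where e4: "e4 > 0" "\<And>h x. 0 < h \<Longrightarrow> h < e4 \<Longrightarrow> variation ?a w h x \<Longrightarrow>
          (\<forall>t\<in>{0..T}. norm (x t - x\<^sub>0 t) \<le> K * h) \<Longrightarrow> \<bar>g (x \<tau>) - g (x\<^sub>0 \<tau>) - h * r\<bar> \<le> \<kappa> * h"
        using variation_first_order[OF \<tau>'(1,2) pb(1) dg' dilation_measurable[of \<theta>] aD wm wD K \<kappa>]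
        unfolding rb by blast
      define h where "h = min (min e0 e1) (min e2 (min e3 e4)) / 2"
      have h: "0 < h" "h < e0" "h < e1" "h < e2" "h < e3" "h < e4"
        using e0 e1(1) e2(1) e3(1) e4(1) by (auto simp: h_def)
      obtain x where x: "variation ?a w h x" "\<forall>t\<in>{0..T}. norm (x t - x\<^sub>0 t) \<le> K * h" using ex[OF h(1,2)] by blast
      have A: "\<Phi> (x\<^sub>0 T) \<le> \<Phi> (x T) - h * \<theta> + \<Lambda> * max 0 (g (x \<tau>))" by (rule e2(2)[OF h(1,4) x e1(2)[OF h(1,3)]])
      have B: "\<Phi> (x T) - \<Phi> (x\<^sub>0 T) \<le> h * (l + \<theta>) + \<kappa> * h" using e3(2)[OF h(1,5) x] by linarith
      have G: "g (x \<tau>) \<le> h * r + \<kappa> * h" using e4(2)[OF h(1,6) x] g0 by linarith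
      have "max 0 (g (x \<tau>)) \<le> h * (max 0 r + \<kappa>)"
      proof -
        have "h * r \<le> h * max 0 r" "0 \<le> h * max 0 r" "0 < \<kappa> * h"
          using h(1) \<kappa> by (auto intro!: mult_left_mono)
        then show ?thesis using G by (simp add: algebra_simps)
      qed
      then have "\<Lambda> * max 0 (g (x \<tau>)) \<le> \<Lambda> * (h * (max 0 r + \<kappa>))" by (rule mult_left_mono[OF _ \<Lambda>])
      then have "0 \<le> h * (l + \<theta>) + \<kappa> * h - h * \<theta> + \<Lambda> * (h * (max 0 r + \<kappa>))" using A B by linarith
      also have "\<dots> = h * (l + \<Lambda> * max 0 r + \<kappa> * (1 + \<Lambda>))" by (simp add: algebra_simps)
      finally show ?thesis using h(1) by (simp add: zero_le_mult_iff)
    qed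
    have "0 \<le> l + \<Lambda> * max 0 r"
    proof (rule field_le_epsilon)
      fix e :: real assume e: "e > 0"
      have "e / (1 + \<Lambda>) > 0" using e \<Lambda> by simp
      from \<open>\<And>\<kappa>. \<kappa> > 0 \<Longrightarrow> 0 \<le> l + \<Lambda> * max 0 r + \<kappa> * (1 + \<Lambda>)\<close>[OF this]
      show "0 \<le> l + \<Lambda> * max 0 r + e" using \<Lambda> by simp
    qed
    then show ?thesis by (simp add: l_def r_def)
  qed
  define S where "S = {(\<theta> * (Ea - 1) + Fa w, \<theta> * Eb + Fb w) | \<theta> w. inward w}"
  have Flin: "Fa (\<lambda>t. s *\<^sub>R w t + r *\<^sub>R w' t) = s * Fa w + r * Fa w'" "Fb (\<lambda>t. s *\<^sub>R w t + r *\<^sub>R w' t) = s * Fb w + r * Fb w'"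
    if ww: "inward w" "inward w'" for w w' s r
  proof -
    obtain C where wm: "w \<in> borel_measurable (lebesgue_on {0..T})" and C: "\<And>t. t \<in> {0..T} \<Longrightarrow> norm (w t) \<le> C"
      using ww(1) unfolding inward_def by blast
    obtain C' where wm': "w' \<in> borel_measurable (lebesgue_on {0..T})" and C': "\<And>t. t \<in> {0..T} \<Longrightarrow> norm (w' t) \<le> C'"
      using ww(2) unfolding inward_def by blast
    show "Fa (\<lambda>t. s *\<^sub>R w t + r *\<^sub>R w' t) = s * Fa w + r * Fa w'"
      unfolding Fa_def sens_combine[THEN ext]
      by (intro integral_unique has_integral_add has_integral_mult_right integrable_integral
          intw[OF order_refl pac wm C] intw[OF order_refl pac wm' C'])
    show "Fb (\<lambda>t. s *\<^sub>R w t + r *\<^sub>R w' t) = s * Fb w + r * Fb w'"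
      unfolding Fb_def sens_combine[THEN ext]
      by (intro integral_unique has_integral_add has_integral_mult_right integrable_integral
          intw[OF \<tau>'(2) pbc wm C] intw[OF \<tau>'(2) pbc wm' C'])
  qed
  have "\<exists>\<beta>. \<forall>(l, r)\<in>S. 0 \<le> l + \<beta> * r"
  proof (rule penalty_slope_exists[of S \<Lambda>, OF _ _ \<Lambda>])
    show "0 \<le> l + \<Lambda> * max 0 r" if "(l, r) \<in> S" for l r using that claimA by (auto simp: S_def)
    fix l r l' r' and s t :: real assume "(l, r) \<in> S" "(l', r') \<in> S" and st: "s > 0" "t > 0"
    then obtain \<theta> w \<theta>' w' where w: "inward w" "inward w'" and
      eq: "l = \<theta> * (Ea - 1) + Fa w" "r = \<theta> * Eb + Fb w" "l' = \<theta>' * (Ea - 1) + Fa w'" "r' = \<theta>' * Eb + Fb w'"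
      unfolding S_def by blast
    have "s * l + t * l' = (s * \<theta> + t * \<theta>') * (Ea - 1) + Fa (\<lambda>\<sigma>. s *\<^sub>R w \<sigma> + t *\<^sub>R w' \<sigma>)"
      "s * r + t * r' = (s * \<theta> + t * \<theta>') * Eb + Fb (\<lambda>\<sigma>. s *\<^sub>R w \<sigma> + t *\<^sub>R w' \<sigma>)"
      unfolding Flin[OF w] eq by (simp_all add: algebra_simps)
    then show "(s * l + t * l', s * r + t * r') \<in> S" using inward_combine[OF w st] unfolding S_def by blast
  qed
  then obtain \<beta> where \<beta>: "\<forall>(l, r)\<in>S. 0 \<le> l + \<beta> * r" by blast
  have \<beta>': "0 \<le> \<theta> * (Ea + \<beta> * Eb - 1) + (Fa w + \<beta> * Fb w)" if "inward w" for \<theta> w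
  proof -
    have "(\<theta> * (Ea - 1) + Fa w, \<theta> * Eb + Fb w) \<in> S" using that by (auto simp: S_def)
    from bspec[OF \<beta> this] show ?thesis by (simp add: algebra_simps)
  qed
  have F_nonneg: "0 \<le> Fa w + \<beta> * Fb w" if "inward w" for w using \<beta>'[OF that, of 0] by simp
  have E1: "Ea + \<beta> * Eb = 1"
  proof (rule ccontr)
    assume ne: "Ea + \<beta> * Eb \<noteq> 1"
    obtain w where w: "inward w" using inward_nonempty by (elim exE)
    \<comment> \<open>Shifts of either sign are allowed; this one makes the functional equal to
      -1.\<close>
    define \<theta> where "\<theta> = - (Fa w + \<beta> * Fb w + 1) / (Ea + \<beta> * Eb - 1)"
    have "\<theta> * (Ea + \<beta> * Eb - 1) = - (Fa w + \<beta> * Fb w + 1)" using ne by (simp add: \<theta>_def)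
    then show False using \<beta>'[OF w, of \<theta>] by simp
  qed
  \<comment> \<open>Both costates solve the same linear equation on [0,\<tau>], so objective and
    \<beta>-weighted constraint merge into one costate there.\<close>
  define p1 where "p1 = (\<lambda>t. pa t + \<beta> *\<^sub>R pb t)"
  have adj_lin: "adj t (q + \<beta> *\<^sub>R q') = adj t q + \<beta> *\<^sub>R adj t q'" for t q q'
    by (simp add: adj_def riesz_def inner_add_left scaleR_add_left sum.distrib scaleR_sum_right)
  have p1: "lip_primitive 0 \<tau> (\<lambda>t. - adj t (p1 t)) p1"
  proof (rule lip_primitive_cong[OF lip_primitive_add[OF pa\<tau> lip_primitive_bounded_linear[OF bounded_linear_scaleR_right[of \<beta>] pb(1)]] negligible_empty])
  qed (simp_all add: p1_def adj_lin)
  note p1c = lip_primitive_continuous[OF p1]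
  have p1\<tau>: "p1 \<tau> = pa \<tau> + \<beta> *\<^sub>R dg" by (simp add: p1_def pb(2))
  have ident: "integral {0..T} (sens pa a w) + \<beta> * integral {0..\<tau>} (sens pb a w) =
      integral {0..\<tau>} (sens p1 a w) + integral {\<tau>..T} (sens pa a w)"
    if i: "sens pa a w integrable_on {0..T}" "sens pb a w integrable_on {0..\<tau>}" for a w
  proof -
    have i1: "sens pa a w integrable_on {0..\<tau>}" by (rule integrable_on_subinterval[OF i(1)]) (use \<tau>' in auto)
    have "integral {0..T} (sens pa a w) = integral {0..\<tau>} (sens pa a w) + integral {\<tau>..T} (sens pa a w)"
      using Henstock_Kurzweil_Integration.integral_combine[where a=0 and c=\<tau> and b=T and f="sens pa a w"] \<tau>' i(1) by simp
    moreover have "integral {0..\<tau>} (sens p1 a w) = integral {0..\<tau>} (sens pa a w) + \<beta> * integral {0..\<tau>} (sens pb a w)"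
    proof -
      have "sens p1 a w t = sens pa a w t + \<beta> * sens pb a w t" for t by (simp add: sens_def p1_def inner_add_left)
      then have "sens p1 a w = (\<lambda>t. sens pa a w t + \<beta> * sens pb a w t)" by (rule ext)
      then show ?thesis
        by (simp only:) (intro integral_unique has_integral_add has_integral_mult_right integrable_integral i1 i(2))
    qed
    ultimately show ?thesis by simp
  qed
  define z where "z = (\<lambda>t. (x\<^sub>0 t, u t))"
  have if1: "(\<lambda>t. p1 t \<bullet> f (z t)) integrable_on {0..\<tau>}"
  proof -
    have "sens p1 (\<lambda>_. 1) (\<lambda>_. 0) integrable_on {0..\<tau>}"
      by (rule sens_integrable[OF \<tau>'(2) p1c, of _ 1]) auto
    moreover have "sens p1 (\<lambda>_. 1) (\<lambda>_. 0) = (\<lambda>t. p1 t \<bullet> f (z t))"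
      by (rule ext) (simp add: sens_def z_def zero_prod_def[symmetric] blinfun.zero_right)
    ultimately show ?thesis by simp
  qed
  have if2: "(\<lambda>t. pa t \<bullet> f (z t)) integrable_on {\<tau>..T}"
  proof -
    have "sens pa (\<lambda>_. 1) (\<lambda>_. 0) integrable_on {0..T}"
      by (rule sens_integrable[OF order_refl pac, of _ 1]) auto
    moreover have "sens pa (\<lambda>_. 1) (\<lambda>_. 0) = (\<lambda>t. pa t \<bullet> f (z t))"
      by (rule ext) (simp add: sens_def z_def zero_prod_def[symmetric] blinfun.zero_right)
    ultimately have "(\<lambda>t. pa t \<bullet> f (z t)) integrable_on {0..T}" by simp
    then show ?thesis by (rule integrable_on_subinterval) (use \<tau>' in auto)
  qed
  define I1 where "I1 = integral {0..\<tau>} (\<lambda>t. p1 t \<bullet> f (z t))"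
  define I2 where "I2 = integral {\<tau>..T} (\<lambda>t. pa t \<bullet> f (z t))"
  have J1: "integral {0..\<tau>} (sens p1 (dilation T \<tau> 1) (\<lambda>_. 0)) = I1 / \<tau>"
  proof (rule integral_unique)
    have "((\<lambda>t. (1 / \<tau>) * (p1 t \<bullet> f (z t))) has_integral (1 / \<tau>) * I1) {0..\<tau>}"
      unfolding I1_def by (intro has_integral_mult_right integrable_integral if1)
    then have "((\<lambda>t. (1 / \<tau>) * (p1 t \<bullet> f (z t))) has_integral I1 / \<tau>) {0..\<tau>}" by simp
    then show "(sens p1 (dilation T \<tau> 1) (\<lambda>_. 0) has_integral I1 / \<tau>) {0..\<tau>}"
      by (rule has_integral_spike[OF negligible_empty, rotated])
         (simp add: sens_def z_def dilation_def zero_prod_def[symmetric] blinfun.zero_right)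
  qed
  have J2: "integral {\<tau>..T} (sens pa (dilation T \<tau> 1) (\<lambda>_. 0)) = - I2 / (T - \<tau>)"
  proof (rule integral_unique)
    have "((\<lambda>t. (- 1 / (T - \<tau>)) * (pa t \<bullet> f (z t))) has_integral (- 1 / (T - \<tau>)) * I2) {\<tau>..T}"
      unfolding I2_def by (intro has_integral_mult_right integrable_integral if2)
    then have "((\<lambda>t. (- 1 / (T - \<tau>)) * (pa t \<bullet> f (z t))) has_integral - I2 / (T - \<tau>)) {\<tau>..T}" by simp
    then show "(sens pa (dilation T \<tau> 1) (\<lambda>_. 0) has_integral - I2 / (T - \<tau>)) {\<tau>..T}"
      \<comment> \<open>At \<tau> itself \<open>dilation\<close> takes the value of the left
        piece.\<close>
      by (rule has_integral_spike[of "{\<tau>}", rotated 2])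
         (auto simp: sens_def z_def dilation_def zero_prod_def[symmetric] blinfun.zero_right)
  qed
  have I12: "I1 / \<tau> - I2 / (T - \<tau>) = 1"
    using ident[OF int0[OF order_refl pac] int0[OF \<tau>'(2) pbc]] E1 unfolding J1 J2 Ea_def Eb_def by simp
  define p where "p = (\<lambda>t. if t \<le> \<tau> then p1 t else pa t)"
  define P where "P = (\<lambda>t. riesz (\<lambda>b. p t \<bullet> f' (z t) (0, b)))"
  have P_inner: "P t \<bullet> h = p t \<bullet> f' (z t) (0, h)" for t h
    unfolding P_def by (rule riesz_inner[OF linear_inner_partial(2)])
  have pm: "p \<in> borel_measurable (lebesgue_on {0..T})"
  proof -
    \<comment> \<open>\<open>pb\<close> is controlled only up to \<tau>; freezing it afterwards
      gives a continuous function on [0,T], from which the glued costate is seen to be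
      measurable.\<close>
    define q where "q = (\<lambda>t. pb (min t \<tau>))"
    have "continuous_on {0..T} q" unfolding q_def
      by (rule continuous_on_compose2[OF pbc]) (use \<tau>' in \<open>auto intro!: continuous_intros\<close>)
    then have qm: "q \<in> borel_measurable (lebesgue_on {0..T})" by (rule continuous_measurable)
    have "(\<lambda>t::real. if t \<le> \<tau> then \<beta> else 0) \<in> borel_measurable lborel" by measurable
    then have "(\<lambda>t::real. if t \<le> \<tau> then \<beta> else 0) \<in> borel_measurable (lebesgue_on {0..T})"
      by (intro measurable_restrict_space1 measurable_completion)
    then have "(\<lambda>t. pa t + (if t \<le> \<tau> then \<beta> else 0) *\<^sub>R q t) \<in> borel_measurable (lebesgue_on {0..T})"
      by (intro borel_measurable_add borel_measurable_scaleR qm continuous_measurable[OF pac])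
    moreover have "p = (\<lambda>t. pa t + (if t \<le> \<tau> then \<beta> else 0) *\<^sub>R q t)"
      by (rule ext) (simp add: p_def p1_def q_def)
    ultimately show ?thesis by simp
  qed
  obtain Ma where Ma: "Ma > 0" "\<And>t. t \<in> {0..T} \<Longrightarrow> norm (pa t) \<le> Ma" by (rule continuous_on_Icc_bounded[OF pac]) blast
  obtain M1 where M1: "M1 > 0" "\<And>t. t \<in> {0..\<tau>} \<Longrightarrow> norm (p1 t) \<le> M1" by (rule continuous_on_Icc_bounded[OF p1c]) blast
  have pbd: "norm (p t) \<le> Ma + M1" if "t \<in> {0..T}" for t
    using Ma(1) M1(1) Ma(2)[OF that] M1(2)[of t] that by (auto simp: p_def)
  have Pm: "P \<in> borel_measurable (lebesgue_on {0..T})"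
    unfolding P_def z_def riesz_def
    by (intro borel_measurable_sum borel_measurable_scaleR borel_measurable_inner borel_measurable_const
        f'_measurable pm u_meas x\<^sub>0_meas)
  obtain Mf where Mf: "Mf > 0" "\<And>y. norm y \<le> R + R \<Longrightarrow> norm (f' y) \<le> Mf"
    by (rule C1_bounds_on_ball[OF f', of "R + R"]) blast
  have Pb: "norm (P t) \<le> (Ma + M1) * Mf" if t: "t \<in> {0..T}" for t
  proof -
    have zb: "norm (z t) \<le> R + R"
      using norm_Pair_le[of "x\<^sub>0 t" "u t"] x\<^sub>0_bound[OF t] u_bound[OF t] unfolding z_def by linarith
    show ?thesis unfolding P_def
    proof (rule norm_riesz_le[OF linear_inner_partial(2)])
      fix h
      have "p t \<bullet> f' (z t) (0, h) \<le> Mf * norm (p t) * norm h"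
        using inner_blinfun_le[OF Mf(2)[OF zb], of "p t" "(0, h)"] by (simp add: norm_Pair)
      also have "\<dots> \<le> Mf * (Ma + M1) * norm h"
        using Mf(1) by (intro mult_right_mono mult_left_mono pbd[OF t]) auto
      finally show "p t \<bullet> f' (z t) (0, h) \<le> (Ma + M1) * Mf * norm h" by (simp add: mult_ac)
    qed (use Ma M1 Mf in simp)
  qed
  have testP: "0 \<le> integral {0..T} (\<lambda>t. P t \<bullet> w t)" if w: "inward w" for w
  proof -
    obtain C where wm: "w \<in> borel_measurable (lebesgue_on {0..T})" and C: "\<And>t. t \<in> {0..T} \<Longrightarrow> norm (w t) \<le> C"
      using w unfolding inward_def by blast
    have i1: "sens p1 (\<lambda>_. 0) w integrable_on {0..\<tau>}" by (rule intw[OF \<tau>'(2) p1c wm C])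
    have i2: "sens pa (\<lambda>_. 0) w integrable_on {\<tau>..T}"
      by (rule integrable_on_subinterval[OF intw[OF order_refl pac wm C]]) (use \<tau>' in auto)
    have P1: "((\<lambda>t. P t \<bullet> w t) has_integral integral {0..\<tau>} (sens p1 (\<lambda>_. 0) w)) {0..\<tau>}"
      by (rule has_integral_spike[OF negligible_empty _ integrable_integral[OF i1]])
         (simp add: P_inner sens_def z_def p_def)
    have P2: "((\<lambda>t. P t \<bullet> w t) has_integral integral {\<tau>..T} (sens pa (\<lambda>_. 0) w)) {\<tau>..T}"
      by (rule has_integral_spike[of "{\<tau>}", OF _ _ integrable_integral[OF i2]])
         (auto simp: P_inner sens_def z_def p_def)
    have "integral {0..T} (\<lambda>t. P t \<bullet> w t) = integral {0..\<tau>} (sens p1 (\<lambda>_. 0) w) + integral {\<tau>..T} (sens pa (\<lambda>_. 0) w)"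
      by (rule integral_unique[OF has_integral_combine[OF _ \<tau>'(2) P1 P2]]) (use \<tau>' in simp)
    also have "\<dots> = Fa w + \<beta> * Fb w"
      unfolding Fa_def Fb_def
      by (rule ident[symmetric, OF intw[OF order_refl pac wm C] intw[OF \<tau>'(2) pbc wm C]])
    finally show ?thesis using F_nonneg[OF w] by simp
  qed
  obtain Bg where Bg: "\<forall>B\<ge>Bg. active_gradients active_gc (\<lambda>i t. c (u t) $ i) 0 T B \<delta> \<epsilon>"
    using active_gradients_eventually by blast
  define B where "B = max ((Ma + M1) * Mf) Bg"
  interpret active_gradients active_gc "\<lambda>i t. c (u t) $ i" 0 T B \<delta> \<epsilon>
    using Bg by (simp add: B_def)
  have "\<exists>(\<mu> :: 'l \<Rightarrow> real \<Rightarrow> real) C N. (\<forall>i. \<mu> i \<in> borel_measurable (lebesgue_on {0..T})) \<and> (\<forall>i. \<forall>t\<in>{0..T}. \<bar>\<mu> i t\<bar> \<le> C) \<and>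
      negligible N \<and> (\<forall>t\<in>{0..T} - N. (\<forall>i. 0 \<le> \<mu> i t \<and> \<mu> i t * c (u t) $ i = 0) \<and>
        P t + (\<Sum>i\<in>UNIV. \<mu> i t *\<^sub>R active_gc i t) = 0)" (is ?ex)
  proof (rule bounded_multiplier_exists[of P])
    show "norm (P t) \<le> B" if "t \<in> {0..T}" for t using Pb[OF that] by (simp add: B_def)
    show "0 \<le> integral {0..T} (\<lambda>t. P t \<bullet> w t)"
      if "w \<in> borel_measurable (lebesgue_on {0..T})" "\<And>t. t \<in> {0..T} \<Longrightarrow> norm (w t) \<le> C"
        "k > 0" "k \<le> \<delta>" "\<And>t i. t \<in> {0..T} \<Longrightarrow> - k \<le> c (u t) $ i \<Longrightarrow> active_gc i t \<bullet> w t \<le> - k" for w C k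
      by (rule testP, unfold inward_def) (use that in blast)
    fix \<mu> :: "'l \<Rightarrow> real \<Rightarrow> real" and C N
    assume *: "\<And>i. \<mu> i \<in> borel_measurable (lebesgue_on {0..T})" "\<And>i t. t \<in> {0..T} \<Longrightarrow> \<bar>\<mu> i t\<bar> \<le> C"
      "negligible N" "\<And>i t. t \<in> {0..T} - N \<Longrightarrow> 0 \<le> \<mu> i t" "\<And>i t. t \<in> {0..T} - N \<Longrightarrow> \<mu> i t * c (u t) $ i = 0"
      "\<And>t. t \<in> {0..T} - N \<Longrightarrow> P t + (\<Sum>i\<in>UNIV. \<mu> i t *\<^sub>R active_gc i t) = 0"
    show ?ex by (rule exI[of _ \<mu>], rule exI[of _ C], rule exI[of _ N]) (intro conjI allI ballI *; assumption)
  qed (fact Pm | (rule nonpos, assumption))+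
  then obtain \<mu> :: "'l \<Rightarrow> real \<Rightarrow> real" and C N where \<mu>: "\<forall>i. \<mu> i \<in> borel_measurable (lebesgue_on {0..T})"
    "\<forall>i. \<forall>t\<in>{0..T}. \<bar>\<mu> i t\<bar> \<le> C" "negligible N" "\<forall>t\<in>{0..T} - N. (\<forall>i. 0 \<le> \<mu> i t \<and> \<mu> i t * c (u t) $ i = 0) \<and>
        P t + (\<Sum>i\<in>UNIV. \<mu> i t *\<^sub>R active_gc i t) = 0" by (elim exE conjE)
  have stat: "p t \<bullet> f' (z t) (0, h) + (\<Sum>i\<in>UNIV. \<mu> i t * c' (u t) h $ i) = 0" if t: "t \<in> {0..T} - N" for t h
  proof -
    note m = bspec[OF \<mu>(4) t]
    \<comment> \<open>At an inactive index the truncated and the true gradient differ, but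
      complementarity makes the multiplier zero there.\<close>
    have "\<mu> i t * (active_gc i t \<bullet> h) = \<mu> i t * c' (u t) h $ i" for i
    proof (cases "c (u t) $ i < - \<delta>")
      case True
      then have "c (u t) $ i \<noteq> 0" using \<delta> by linarith
      then have "\<mu> i t = 0" using m by (metis mult_eq_0_iff)
      then show ?thesis by simp
    qed (simp add: active_gc_def gc_inner)
    then have "(\<Sum>i\<in>UNIV. \<mu> i t * (active_gc i t \<bullet> h)) = (\<Sum>i\<in>UNIV. \<mu> i t * c' (u t) h $ i)"
      by (rule sum.cong[OF refl])
    then have "(P t + (\<Sum>i\<in>UNIV. \<mu> i t *\<^sub>R active_gc i t)) \<bullet> h = p t \<bullet> f' (z t) (0, h) + (\<Sum>i\<in>UNIV. \<mu> i t * c' (u t) h $ i)"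
      by (simp add: inner_add_left inner_sum_left P_inner)
    then show ?thesis using conjunct2[OF m] by simp
  qed
  show ?thesis
    by (rule exI[of _ p1], rule exI[of _ pa], rule exI[of _ \<beta>], rule exI[of _ I1], rule exI[of _ I2],
        rule exI[of _ \<mu>], rule exI[of _ C], rule exI[of _ N])
      (use pa p1 p1\<tau> if1 if2 I12 \<mu> stat in \<open>simp add: I1_def I2_def z_def p_def integrable_integral\<close>)
qed

end

section \<open>Exact penalization of the crossing constraint\<close>

lemma lip_primitive_compose_C1:
  fixes g :: "'a::euclidean_space \<Rightarrow> 'b::euclidean_space"
  assumes x: "lip_primitive a b r x"
    and g': "\<And>x. (g has_derivative blinfun_apply (g' x)) (at x)" "continuous_on UNIV g'"
  shows "lip_primitive a b (\<lambda>t. g' (x t) (r t)) (\<lambda>t. g (x t))"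
proof -
  obtain L M where L: "L-lipschitz_on {a..b} x" and M: "negligible M"
    "\<And>t. t\<in>{a..b} - M \<Longrightarrow> (x has_vector_derivative r t) (at t within {a..b})"
    using x unfolding lip_primitive_def by blast
  obtain R where R: "R > 0" "\<And>t. t \<in> {a..b} \<Longrightarrow> norm (x t) \<le> R"
    by (rule continuous_on_Icc_bounded[OF lip_primitive_continuous[OF x]]) blast
  obtain Q where Q: "Q > 0" "\<And>x y. norm x \<le> R \<Longrightarrow> norm y \<le> R \<Longrightarrow> norm (g x - g y) \<le> Q * norm (x - y)"
    by (rule C1_bounds_on_ball[OF g', of R]) blast
  have "Q-lipschitz_on (x ` {a..b}) g"
    by (rule lipschitz_onI) (use Q R in \<open>auto simp: dist_norm\<close>)
  from lipschitz_on_compose2[OF L this] have "(Q * L)-lipschitz_on {a..b} (\<lambda>t. g (x t))" .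
  moreover have "((\<lambda>t. g (x t)) has_vector_derivative g' (x t) (r t)) (at t within {a..b})" if t: "t \<in> {a..b} - M" for t
    using vector_derivative_diff_chain_within[OF M(2)[OF t] has_derivative_at_withinI[OF g'(1)]] by (simp add: o_def)
  ultimately show ?thesis unfolding lip_primitive_def using M(1) by blast
qed

lemma lip_primitive_growth:
  fixes y :: "real \<Rightarrow> real"
  assumes y: "lip_primitive a b r y" and ab: "a \<le> b" and N: "negligible N" and d: "\<And>t. t \<in> {a..b} - N \<Longrightarrow> d \<le> r t"
  shows "d * (b - a) \<le> y b - y a"
proof -
  have "(r has_integral (y b - y a)) {a..b}" by (rule lip_primitive_has_integral[OF y order_refl ab order_refl])
  then have i: "((\<lambda>t. if t \<in> N then d else r t) has_integral (y b - y a)) {a..b}"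
    by (rule has_integral_spike[OF N, rotated]) auto
  have "((\<lambda>t. d) has_integral (b - a) * d) {a..b}" using has_integral_const_real[of d a b] ab by simp
  from has_integral_le[OF this i] d show ?thesis by (simp add: mult.commute)
qed

text \<open>The piecewise linear change of time fixing 0 and T and sending \<open>a\<close> to
  \<open>b\<close>; its inverse is \<open>warp T b a\<close>. The form with \<open>min\<close> and
  \<open>max\<close> makes sense on the whole line and is Lipschitz there, as the reparametrization
  lemmas ask of the inverse.\<close>

definition warp :: "real \<Rightarrow> real \<Rightarrow> real \<Rightarrow> real \<Rightarrow> real" where
  "warp T a b s = b + (b / a) * min 0 (s - a) + ((T - b) / (T - a)) * max 0 (s - a)"

lemma warp_simps:
  assumes "0 < a" "a < T"
  shows "s \<le> a \<Longrightarrow> warp T a b s = (b / a) * s" "a \<le> s \<Longrightarrow> warp T a b s = b + ((T - b) / (T - a)) * (s - a)"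
  using assms by (auto simp: warp_def min_def max_def field_simps)

lemma warp_lipschitz:
  assumes "0 < a" "a < T" "0 < b" "b < T"
  shows "(b / a + (T - b) / (T - a))-lipschitz_on S (warp T a b)"
proof (rule lipschitz_onI)
  fix x y
  have pos: "0 \<le> b / a" "0 \<le> (T - b) / (T - a)" using assms by auto
  have "warp T a b x - warp T a b y = (b / a) * (min 0 (x - a) - min 0 (y - a)) + ((T - b) / (T - a)) * (max 0 (x - a) - max 0 (y - a))"
    by (simp add: warp_def right_diff_distrib)
  also have "\<bar>\<dots>\<bar> \<le> (b / a) * \<bar>x - y\<bar> + ((T - b) / (T - a)) * \<bar>x - y\<bar>"
    by (intro order_trans[OF abs_triangle_ineq] add_mono) (auto simp only: abs_mult abs_of_nonneg[OF pos(1)] abs_of_nonneg[OF pos(2)] intro!: mult_left_mono pos)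
  finally show "dist (warp T a b x) (warp T a b y) \<le> (b / a + (T - b) / (T - a)) * dist x y"
    by (simp add: dist_real_def distrib_right)
qed (use assms in simp)

lemma warp_mono:
  assumes "0 < a" "a < T" "0 < b" "b < T" "x \<le> y"
  shows "warp T a b x \<le> warp T a b y"
  unfolding warp_def using assms by (intro add_mono mult_left_mono) auto

lemma warp_ends:
  assumes "0 < a" "a < T"
  shows "warp T a b 0 = 0" "warp T a b a = b" "warp T a b T = T"
  using warp_simps(1)[OF assms, of 0 b] warp_simps(2)[OF assms, of a b] warp_simps(2)[OF assms, of T b] assms by auto

lemma warp_inverse:
  assumes "0 < a" "a < T" "0 < b" "b < T"
  shows "warp T b a (warp T a b s) = s"
proof (cases "s \<le> a")
  case True
  then have "warp T a b s \<le> b" using warp_mono[OF assms True] warp_ends(2)[OF assms(1,2)] by metis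
  then have "warp T b a (warp T a b s) = (a / b) * ((b / a) * s)"
    using warp_simps(1)[OF assms(3,4)] warp_simps(1)[OF assms(1,2) True] by metis
  moreover have "(a / b) * ((b / a) * s) = s" using assms(1,3) by (simp add: field_simps)
  ultimately show ?thesis by simp
next
  case False
  then have s: "a \<le> s" by simp
  then have "b \<le> warp T a b s" using warp_mono[OF assms s] warp_ends(2)[OF assms(1,2)] by metis
  then have "warp T b a (warp T a b s) = a + ((T - a) / (T - b)) * (b + ((T - b) / (T - a)) * (s - a) - b)"
    using warp_simps(2)[OF assms(3,4)] warp_simps(2)[OF assms(1,2) s] by metis
  moreover have "T - a \<noteq> 0" "T - b \<noteq> 0" using assms by auto
  then have "((T - a) / (T - b)) * (b + ((T - b) / (T - a)) * (s - a) - b) = s - a" by simp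
  ultimately show ?thesis by simp
qed

lemma warp_image:
  assumes "0 < a" "a < T" "0 < b" "b < T"
  shows "warp T a b ` {0..T} \<subseteq> {0..T}"
  using warp_mono[OF assms, of 0] warp_mono[OF assms, of _ T] warp_ends[OF assms(1,2)] by fastforce

lemma warp_deriv:
  assumes "0 < a" "a < T" "s \<noteq> a"
  shows "(warp T a b has_real_derivative (if s \<le> a then b / a else (T - b) / (T - a))) (at s within S)"
proof (cases "s < a")
  case True
  have "((\<lambda>s. (b / a) * s) has_real_derivative b / a) (at s)" by (rule DERIV_cmult_Id)
  then have "(warp T a b has_real_derivative b / a) (at s)"
    by (rule has_field_derivative_transform_within_open[where S="{..<a}"]) (use True warp_simps(1)[OF assms(1,2)] in auto)
  then show ?thesis using True by (simp add: has_field_derivative_at_within)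
next
  case False
  then have sa: "a < s" using assms by simp
  have "((\<lambda>s. b + ((T - b) / (T - a)) * (s - a)) has_real_derivative 0 + (T - b) / (T - a) * (1 - 0)) (at s)"
    by (intro DERIV_add DERIV_const DERIV_cmult DERIV_diff DERIV_ident)
  then have "(warp T a b has_real_derivative (T - b) / (T - a)) (at s)"
    unfolding add_0 diff_zero mult_1_right
    by (rule has_field_derivative_transform_within_open[where S="{a<..}"]) (use sa warp_simps(2)[OF assms(1,2)] in auto)
  then show ?thesis using sa by (simp add: has_field_derivative_at_within)
qed

section \<open>Time spent outside K\<close>

lemma crossing_cost_le:
  assumes s: "0 \<le> s" "s \<le> T" and K: "\<And>t. t \<in> {0..s} \<Longrightarrow> x t \<in> K"
  shows "(LINT t|lebesgue_on {0..T}. indicat_real (- K) (x t)) \<le> T - s"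
proof (cases "integrable (lebesgue_on {0..T}) (\<lambda>t. indicat_real (- K) (x t))")
  case True
  have "emeasure (lebesgue_on {0..T}) {s<..T} = emeasure lebesgue {s<..T}"
    by (rule emeasure_restrict_space) (use s in auto)
  then have i: "integrable (lebesgue_on {0..T}) (indicat_real {s<..T})"
    by (intro integrable_real_indicator) (use s in \<open>auto simp: sets_restrict_space_iff\<close>)
  have "(LINT t|lebesgue_on {0..T}. indicat_real (- K) (x t)) \<le> (LINT t|lebesgue_on {0..T}. indicat_real {s<..T} t)"
  proof (rule integral_mono[OF True i])
    fix t assume "t \<in> space (lebesgue_on {0..T})"
    then have "t \<in> {s<..T}" if "x t \<notin> K" using K[of t] that by (cases "t \<le> s") auto
    then show "indicat_real (- K) (x t) \<le> indicat_real {s<..T} t" by (simp add: indicator_def)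
  qed
  also have "\<dots> = measure (lebesgue_on {0..T}) ({s<..T} \<inter> {0..T})" by simp
  also have "{s<..T} \<inter> {0..T} = {s<..T}" using s by auto
  also have "measure (lebesgue_on {0..T}) {s<..T} = T - s" using s by (subst measure_restrict_space) auto
  finally show ?thesis .
next
  case False
  \<comment> \<open>A non-integrable integrand has integral 0 by convention, and T - s is
    nonnegative.\<close>
  then show ?thesis using s by (simp add: not_integrable_integral_eq)
qed

lemma crossing_cost_eq:
  assumes s: "0 \<le> s" "s \<le> T" and K: "\<And>t. t \<in> {0..s} \<Longrightarrow> x t \<in> K" "\<And>t. t \<in> {s<..T} \<Longrightarrow> x t \<notin> K"
  shows "(LINT t|lebesgue_on {0..T}. indicat_real (- K) (x t)) = T - s"
proof -
  have "(LINT t|lebesgue_on {0..T}. indicat_real (- K) (x t)) = (LINT t|lebesgue_on {0..T}. indicat_real {s<..T} t)"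
  proof (rule Bochner_Integration.integral_cong[OF refl])
    fix t assume "t \<in> space (lebesgue_on {0..T})"
    then have "x t \<notin> K \<longleftrightarrow> t \<in> {s<..T}" using K(1)[of t] K(2)[of t] by (cases "t \<le> s") auto
    then show "indicat_real (- K) (x t) = indicat_real {s<..T} t" by (simp add: indicator_def)
  qed
  also have "\<dots> = measure (lebesgue_on {0..T}) ({s<..T} \<inter> {0..T})" by simp
  also have "{s<..T} \<inter> {0..T} = {s<..T}" using s by auto
  also have "measure (lebesgue_on {0..T}) {s<..T} = T - s" using s by (subst measure_restrict_space) auto
  finally show ?thesis .
qed

text \<open>\<open>optimal\<close> has the reference cost already evaluated, the time outside K
  being T - \<tau>. The left limit is required up to null sets so that a modification of the control
  is covered.\<close>

locale crossing_minimizer = controlled_trajectory "\<lambda>(x, v). f x v" f' T R x\<^sub>0 u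
  for f :: "real^'n \<Rightarrow> real^'m \<Rightarrow> real^'n" and f' T R x\<^sub>0 u +
  fixes g :: "real^'n \<Rightarrow> real" and g' :: "real^'n \<Rightarrow> (real^'n) \<Rightarrow>\<^sub>L real" and \<phi> :: "real^'n \<Rightarrow> real"
    and U :: "(real^'m) set" and \<tau> :: real and u\<^sub>l :: "real^'m"
  assumes g': "\<And>x. (g has_derivative blinfun_apply (g' x)) (at x)" "continuous_on UNIV g'"
    and \<tau>: "\<tau> \<in> {0<..<T}"
    and g0: "g (x\<^sub>0 \<tau>) = 0" and neg: "\<And>t. t \<in> {0..<\<tau>} \<Longrightarrow> g (x\<^sub>0 t) < 0"
    and u_left: "\<And>e. e > 0 \<Longrightarrow> \<exists>b<\<tau>. \<exists>N. negligible N \<and> (\<forall>t\<in>{b<..<\<tau>} - N. norm (u t - u\<^sub>l) < e)"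
    and transverse: "g' (x\<^sub>0 \<tau>) (f (x\<^sub>0 \<tau>) u\<^sub>l) \<noteq> 0"
    and optimal: "\<And>v x. v \<in> controls 0 T U \<Longrightarrow> state_of f T (x\<^sub>0 0) v x \<Longrightarrow>
      \<phi> (x\<^sub>0 T) + (T - \<tau>) \<le> time_crisis_cost \<phi> {x. g x \<le> 0} T x"
begin

lemma g_cont: "continuous_on UNIV g"
  using g'(1) by (meson continuous_at_imp_continuous_on has_derivative_continuous)

lemma speed_near:
  assumes "e > 0"
  shows "\<exists>r>0. \<forall>y v. norm (y - x\<^sub>0 \<tau>) < r \<and> norm (v - u\<^sub>l) < r \<longrightarrow> \<bar>g' y (f y v) - g' (x\<^sub>0 \<tau>) (f (x\<^sub>0 \<tau>) u\<^sub>l)\<bar> < e"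
proof -
  have fc: "continuous_on UNIV (\<lambda>z. f (fst z) (snd z))" using f_cont by (simp add: case_prod_unfold)
  have "continuous_on UNIV (\<lambda>z. g' (fst z) (f (fst z) (snd z)))"
    by (intro bounded_bilinear.continuous_on[OF bounded_bilinear_blinfun_apply] fc
        continuous_on_compose2[OF g'(2)] continuous_intros) auto
  then have "isCont (\<lambda>z. g' (fst z) (f (fst z) (snd z))) (x\<^sub>0 \<tau>, u\<^sub>l)"
    by (simp add: continuous_on_eq_continuous_at)
  then obtain d where d: "d > 0" "\<And>z. dist z (x\<^sub>0 \<tau>, u\<^sub>l) < d \<Longrightarrow>
      dist (g' (fst z) (f (fst z) (snd z))) (g' (x\<^sub>0 \<tau>) (f (x\<^sub>0 \<tau>) u\<^sub>l)) < e"
    using assms unfolding continuous_at_eps_delta by (metis fst_conv snd_conv)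
  have "\<bar>g' y (f y v) - g' (x\<^sub>0 \<tau>) (f (x\<^sub>0 \<tau>) u\<^sub>l)\<bar> < e" if "norm (y - x\<^sub>0 \<tau>) < d / 2" "norm (v - u\<^sub>l) < d / 2" for y v
  proof -
    have "dist (y, v) (x\<^sub>0 \<tau>, u\<^sub>l) < d"
      using norm_Pair_le[of "y - x\<^sub>0 \<tau>" "v - u\<^sub>l"] that by (simp add: dist_norm)
    from d(2)[OF this] show ?thesis by (simp add: dist_norm)
  qed
  then show ?thesis using d(1) by (intro exI[of _ "d / 2"]) auto
qed

lemma x\<^sub>0_left:
  assumes "e > 0"
  shows "\<exists>b. 0 \<le> b \<and> b < \<tau> \<and> (\<exists>N. negligible N \<and> (\<forall>t\<in>{b..\<tau>} - N. norm (x\<^sub>0 t - x\<^sub>0 \<tau>) < e \<and> norm (u t - u\<^sub>l) < e)) \<and>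
    (\<forall>t\<in>{b..\<tau>}. norm (x\<^sub>0 t - x\<^sub>0 \<tau>) < e)"
proof -
  have xc: "continuous_on {0..T} x\<^sub>0" by (rule lip_primitive_continuous[OF x\<^sub>0])
  have "\<tau> \<in> {0..T}" using \<tau> by auto
  from bspec[OF xc[unfolded continuous_on_iff] this, rule_format, OF assms]
  obtain d where d: "d > 0" "\<And>t. t \<in> {0..T} \<Longrightarrow> dist t \<tau> < d \<Longrightarrow> dist (x\<^sub>0 t) (x\<^sub>0 \<tau>) < e"
    by blast
  obtain b N where b: "b < \<tau>" "negligible N" "\<forall>t\<in>{b<..<\<tau>} - N. norm (u t - u\<^sub>l) < e"
    using u_left[OF assms] by blast
  define b' where "b' = max 0 (max b (\<tau> - d / 2))"
  have b': "0 \<le> b'" "b \<le> b'" "\<tau> - d / 2 \<le> b'" "b' < \<tau>" using b(1) d(1) \<tau> by (auto simp: b'_def)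
  have x: "norm (x\<^sub>0 t - x\<^sub>0 \<tau>) < e" if t: "t \<in> {b'..\<tau>}" for t
  proof -
    have "t \<in> {0..T}" using t b' \<tau> by auto
    moreover have "dist t \<tau> < d" using t b' d(1) by (auto simp: dist_real_def)
    ultimately show ?thesis using d(2) by (simp add: dist_norm)
  qed
  have "norm (u t - u\<^sub>l) < e" if "t \<in> {b'..\<tau>} - (N \<union> {b', \<tau>})" for t
    using b(3) that b' by auto
  moreover have "negligible (N \<union> {b', \<tau>})" by (rule negligible_Un[OF b(2) negligible_finite]) simp
  ultimately have "\<exists>N. negligible N \<and> (\<forall>t\<in>{b'..\<tau>} - N. norm (x\<^sub>0 t - x\<^sub>0 \<tau>) < e \<and> norm (u t - u\<^sub>l) < e)"
    using x by (intro exI[of _ "N \<union> {b', \<tau>}"]) auto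
  then show ?thesis using x b' by blast
qed

text \<open>Transversality only says that the speed is non-zero. A negative speed would make
  \<open>g\<close> decrease to 0 just before \<tau>, while \<open>g\<close> is negative
  there.\<close>

lemma speed_pos: "g' (x\<^sub>0 \<tau>) (f (x\<^sub>0 \<tau>) u\<^sub>l) > 0"
proof (rule ccontr)
  let ?D = "g' (x\<^sub>0 \<tau>) (f (x\<^sub>0 \<tau>) u\<^sub>l)"
  assume "\<not> ?D > 0"
  then have D: "?D < 0" using transverse by simp
  then obtain r where r: "r > 0" "\<forall>y v. norm (y - x\<^sub>0 \<tau>) < r \<and> norm (v - u\<^sub>l) < r \<longrightarrow> \<bar>g' y (f y v) - ?D\<bar> < - ?D"
    using speed_near[of "- ?D"] by auto
  obtain b N where b: "0 \<le> b" "b < \<tau>" "negligible N"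
    "\<forall>t\<in>{b..\<tau>} - N. norm (x\<^sub>0 t - x\<^sub>0 \<tau>) < r \<and> norm (u t - u\<^sub>l) < r" using x\<^sub>0_left[OF r(1)] by blast
  have A: "lip_primitive 0 T (\<lambda>t. g' (x\<^sub>0 t) (f (x\<^sub>0 t) (u t))) (\<lambda>t. g (x\<^sub>0 t))"
    using lip_primitive_compose_C1[OF x\<^sub>0 g'] unfolding prod.case .
  have "\<tau> \<le> T" using \<tau> by simp
  note A = lip_primitive_bounded_linear[OF bounded_linear_minus[OF bounded_linear_ident]
      lip_primitive_subinterval[OF A b(1) this]]
  have "0 \<le> - g' (x\<^sub>0 t) (f (x\<^sub>0 t) (u t))" if "t \<in> {b..\<tau>} - N" for t
  proof -
    have "\<bar>g' (x\<^sub>0 t) (f (x\<^sub>0 t) (u t)) - ?D\<bar> < - ?D" using r(2) bspec[OF b(4) that] by blast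
    then show ?thesis by linarith
  qed
  from lip_primitive_growth[OF A less_imp_le[OF b(2)] b(3) this]
  have "0 * (\<tau> - b) \<le> - g (x\<^sub>0 \<tau>) - - g (x\<^sub>0 b)" .
  then show False using g0 neg[of b] b by simp
qed

text \<open>A nearby trajectory with \<open>g (x \<tau>) > 0\<close> has left \<open>K\<close> at most \<open>g (x \<tau>) / d\<close> before \<open>\<tau>\<close>, where \<open>d\<close> is a lower
  bound of the speed of \<open>g\<close> just before \<open>\<tau>\<close>.\<close>

lemma stays_in_K:
  "\<exists>d>0. \<forall>\<theta> w C K. K > 0 \<and> (\<forall>t\<in>{0..T}. norm (w t) \<le> C) \<longrightarrow> (\<exists>e>0. \<forall>h x. 0 < h \<and> h < e \<and>
    variation (dilation T \<tau> \<theta>) w h x \<and> (\<forall>t\<in>{0..T}. norm (x t - x\<^sub>0 t) \<le> K * h) \<longrightarrow>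
      max 0 (g (x \<tau>)) / d \<le> \<tau> \<and> (\<forall>t\<in>{0..\<tau> - max 0 (g (x \<tau>)) / d}. g (x t) \<le> 0))"
proof -
  let ?D = "g' (x\<^sub>0 \<tau>) (f (x\<^sub>0 \<tau>) u\<^sub>l)"
  \<comment> \<open>A quarter of the reference speed: nearby states and controls keep at least half
    of it, and the dilation factor may halve it once more.\<close>
  define d where "d = ?D / 4"
  have d: "d > 0" "?D = 4 * d" using speed_pos by (auto simp: d_def)
  obtain r where r: "r > 0" "\<forall>y v. norm (y - x\<^sub>0 \<tau>) < r \<and> norm (v - u\<^sub>l) < r \<longrightarrow> \<bar>g' y (f y v) - ?D\<bar> < 2 * d"
    using speed_near[of "2 * d"] d by auto
  have r2: "r / 2 > 0" using r(1) by simp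
  obtain b N where b: "0 \<le> b" "b < \<tau>" "negligible N"
    "\<forall>t\<in>{b..\<tau>} - N. norm (x\<^sub>0 t - x\<^sub>0 \<tau>) < r / 2 \<and> norm (u t - u\<^sub>l) < r / 2" using x\<^sub>0_left[OF r2] by blast
  have gx0c: "continuous_on {0..T} (\<lambda>t. g (x\<^sub>0 t))"
    by (rule continuous_on_compose2[OF g_cont lip_primitive_continuous[OF x\<^sub>0]]) auto
  \<comment> \<open>Away from \<tau> a compactness margin keeps nearby trajectories inside K; the
    speed estimate is used only on [b,\<tau>].\<close>
  obtain t\<^sub>1 where t1: "t\<^sub>1 \<in> {0..b}" "\<forall>t\<in>{0..b}. g (x\<^sub>0 t) \<le> g (x\<^sub>0 t\<^sub>1)"
    using continuous_attains_sup[of "{0..b}" "\<lambda>t. g (x\<^sub>0 t)"] continuous_on_subset[OF gx0c, of "{0..b}"] b \<tau> by auto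
  define c0 where "c0 = - g (x\<^sub>0 t\<^sub>1)"
  have c0: "c0 > 0" "\<And>t. t \<in> {0..b} \<Longrightarrow> g (x\<^sub>0 t) \<le> - c0" using t1 neg[of t\<^sub>1] b by (auto simp: c0_def)
  obtain Q where Q: "Q > 0" "\<And>x y. norm x \<le> R + 1 \<Longrightarrow> norm y \<le> R + 1 \<Longrightarrow> norm (g x - g y) \<le> Q * norm (x - y)"
    by (rule C1_bounds_on_ball[OF g', of "R + 1"]) blast
  have "\<exists>e>0. \<forall>h x. 0 < h \<and> h < e \<and>
    variation (dilation T \<tau> \<theta>) w h x \<and> (\<forall>t\<in>{0..T}. norm (x t - x\<^sub>0 t) \<le> K * h) \<longrightarrow>
      max 0 (g (x \<tau>)) / d \<le> \<tau> \<and> (\<forall>t\<in>{0..\<tau> - max 0 (g (x \<tau>)) / d}. g (x t) \<le> 0)"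
    if K: "K > 0" and w: "\<forall>t\<in>{0..T}. norm (w t) \<le> C" for \<theta> w C K
  proof -
    have C: "C \<ge> 0" using order_trans[OF norm_ge_zero bspec[OF w, of 0]] T by simp
    define A where "A = \<bar>\<theta> / \<tau>\<bar> + \<bar>\<theta> / (T - \<tau>)\<bar>"
    have A: "A \<ge> 0" by (simp add: A_def)
    \<comment> \<open>In order: bounded states; state near x(\<tau>); control near the left limit;
      dilation factor at least 1/2; g below 0 up to \<open>b\<close>; g(x(\<tau>)) at most d
      \<tau>.\<close>
    define e where "e = min (min (1 / K) (r / (2 * K))) (min (min (r / (2 * (C + 1))) (1 / (2 * (A + 1)))) (min (c0 / (Q * K)) (d * \<tau> / (Q * K))))"
    have "e > 0" using K r(1) C A c0(1) Q(1) d(1) \<tau> by (simp add: e_def)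
    moreover have "max 0 (g (x \<tau>)) / d \<le> \<tau> \<and> (\<forall>t\<in>{0..\<tau> - max 0 (g (x \<tau>)) / d}. g (x t) \<le> 0)"
      if h: "0 < h" "h < e" and x: "variation (dilation T \<tau> \<theta>) w h x" and xK: "\<forall>t\<in>{0..T}. norm (x t - x\<^sub>0 t) \<le> K * h" for h x
    proof -
      have "h < 1 / K" "h < r / (2 * K)" "h < r / (2 * (C + 1))" "h < 1 / (2 * (A + 1))" "h < c0 / (Q * K)" "h < d * \<tau> / (Q * K)"
        using h(2) by (auto simp: e_def)
      moreover have "2 * K > 0" "2 * (C + 1) > 0" "2 * (A + 1) > 0" "Q * K > 0" using K C A Q(1) by auto
      ultimately have hh: "h * K < 1" "h * (2 * K) < r" "h * (2 * (C + 1)) < r" "h * (2 * (A + 1)) < 1" "h * (Q * K) < c0" "h * (Q * K) < d * \<tau>"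
        using K by (simp_all only: pos_less_divide_eq)
      have hh': "K * h < 1" "K * h < r / 2" "h * C < r / 2" "h * A \<le> 1 / 2" "Q * (K * h) < c0" "Q * (K * h) < d * \<tau>"
        using hh h(1) by (simp_all add: algebra_simps)
      have xR: "norm (x t) \<le> R + 1" if "t \<in> {0..T}" for t
        using norm_triangle_sub[of "x t" "x\<^sub>0 t"] bspec[OF xK that] x\<^sub>0_bound[OF that] hh'(1) by linarith
      have gd: "\<bar>g (x t) - g (x\<^sub>0 t)\<bar> \<le> Q * (K * h)" if t: "t \<in> {0..T}" for t
      proof -
        have "norm (g (x t) - g (x\<^sub>0 t)) \<le> Q * norm (x t - x\<^sub>0 t)"
          by (rule Q(2)[OF xR[OF t]]) (use x\<^sub>0_bound[OF t] in simp)
        also have "\<dots> \<le> Q * (K * h)" using bspec[OF xK t] Q(1) by (intro mult_left_mono) auto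
        finally show ?thesis by simp
      qed
      let ?m = "max 0 (g (x \<tau>))"
      have "g (x \<tau>) \<le> d * \<tau>" using gd[of \<tau>] g0 hh'(6) \<tau> by auto
      then have m\<tau>: "?m / d \<le> \<tau>" using d(1) \<tau> by (auto simp: field_simps)
      have "g (x t) \<le> 0" if t: "t \<in> {0..\<tau> - ?m / d}" for t
      proof (cases "t \<le> b")
        case True
        then have "g (x\<^sub>0 t) \<le> - c0" using c0(2) t by auto
        moreover have "t \<in> {0..T}" using t True b \<tau> by auto
        ultimately show ?thesis using gd[of t] hh'(5) by linarith
      next
        case False
        have "?m / d \<ge> 0" using d(1) by simp
        then have t\<tau>: "t \<le> \<tau>" using t by (auto simp: algebra_simps)
        have lx: "lip_primitive 0 T (\<lambda>s. (1 + h * dilation T \<tau> \<theta> s) *\<^sub>R (case (x s, u s + h *\<^sub>R w s) of (x, v) \<Rightarrow> f x v)) x"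
          using x unfolding variation_def by blast
        have "lip_primitive 0 T (\<lambda>s. g' (x s) ((1 + h * dilation T \<tau> \<theta> s) *\<^sub>R f (x s) (u s + h *\<^sub>R w s))) (\<lambda>t. g (x t))"
          using lip_primitive_compose_C1[OF lx g'] by simp
        then have lg: "lip_primitive t \<tau> (\<lambda>s. g' (x s) ((1 + h * dilation T \<tau> \<theta> s) *\<^sub>R f (x s) (u s + h *\<^sub>R w s))) (\<lambda>t. g (x t))"
          by (rule lip_primitive_subinterval[of 0 T]) (use t \<tau> in auto)
        have "d * (\<tau> - t) \<le> g (x \<tau>) - g (x t)"
        proof (rule lip_primitive_growth[OF lg t\<tau> b(3)])
          fix s assume s: "s \<in> {t..\<tau>} - N"
          have sb: "s \<in> {b..\<tau>} - N" and sT: "s \<in> {0..T}" using s False t \<tau> by auto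
          have "norm (x s - x\<^sub>0 \<tau>) \<le> norm (x s - x\<^sub>0 s) + norm (x\<^sub>0 s - x\<^sub>0 \<tau>)"
            using norm_triangle_ineq[of "x s - x\<^sub>0 s" "x\<^sub>0 s - x\<^sub>0 \<tau>"] by simp
          then have n1: "norm (x s - x\<^sub>0 \<tau>) < r" using bspec[OF xK sT] hh'(2) bspec[OF b(4) sb] by linarith
          have "norm (h *\<^sub>R w s) \<le> h * C" using bspec[OF w sT] h(1) by simp
          moreover have "norm (u s + h *\<^sub>R w s - u\<^sub>l) \<le> norm (u s - u\<^sub>l) + norm (h *\<^sub>R w s)"
            using norm_triangle_ineq[of "u s - u\<^sub>l" "h *\<^sub>R w s"] by (simp add: algebra_simps)
          ultimately have n2: "norm (u s + h *\<^sub>R w s - u\<^sub>l) < r" using hh'(3) bspec[OF b(4) sb] by linarith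
          have sp: "g' (x s) (f (x s) (u s + h *\<^sub>R w s)) \<ge> 2 * d"
            using r(2)[rule_format, OF conjI[OF n1 n2]] d(2) by linarith
          have "\<bar>dilation T \<tau> \<theta> s\<bar> \<le> A" by (simp add: dilation_def A_def)
          then have "\<bar>h * dilation T \<tau> \<theta> s\<bar> \<le> h * A" unfolding abs_mult using h(1) by (simp add: mult_left_mono)
          then have "1 + h * dilation T \<tau> \<theta> s \<ge> 1 / 2" using hh'(4) by linarith
          then have "1 / 2 * (2 * d) \<le> (1 + h * dilation T \<tau> \<theta> s) * g' (x s) (f (x s) (u s + h *\<^sub>R w s))"
            using sp d(1) by (intro mult_mono) auto
          then show "d \<le> g' (x s) ((1 + h * dilation T \<tau> \<theta> s) *\<^sub>R f (x s) (u s + h *\<^sub>R w s))"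
            by (simp add: blinfun.scaleR_right)
        qed
        \<comment> \<open>From t to \<tau> the function g gains at least its positive part at
          \<tau>, so it is at most 0 at t.\<close>
        moreover have "d * (\<tau> - t) \<ge> ?m"
        proof -
          have "?m / d \<le> \<tau> - t" using t by auto
          then show ?thesis using d(1) by (simp add: field_simps)
        qed
        ultimately show ?thesis by linarith
      qed
      then show ?thesis using m\<tau> by blast
    qed
    ultimately show ?thesis by blast
  qed
  then show ?thesis using d(1) by blast
qed

text \<open>Reparametrized, the varied trajectory is admissible. It stays in K up to \<tau> + h
  \<theta> minus a multiple of the violation, so its cost exceeds \<phi>(x(T)) by at most the rest
  of the interval. Comparison with the reference cost gives the claim.\<close>

lemma penalized_minimal:
  "\<exists>\<Lambda>\<ge>0. \<forall>\<theta> w C K. w \<in> borel_measurable (lebesgue_on {0..T}) \<and> (\<forall>t\<in>{0..T}. norm (w t) \<le> C) \<and> K > 0 \<longrightarrow>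
      (\<exists>e>0. \<forall>h x. 0 < h \<and> h < e \<and> variation (dilation T \<tau> \<theta>) w h x \<and> (\<forall>t\<in>{0..T}. norm (x t - x\<^sub>0 t) \<le> K * h) \<and>
        (\<forall>t\<in>{0..T}. u t + h *\<^sub>R w t \<in> U) \<longrightarrow>
        \<phi> (x\<^sub>0 T) \<le> \<phi> (x T) - h * \<theta> + \<Lambda> * max 0 (g (x \<tau>)))"
proof -
  obtain d where d: "d > 0" and st: "\<And>\<theta> w C K. K > 0 \<Longrightarrow> (\<forall>t\<in>{0..T}. norm (w t) \<le> C) \<Longrightarrow> (\<exists>e>0. \<forall>h x. 0 < h \<and> h < e \<and>
    variation (dilation T \<tau> \<theta>) w h x \<and> (\<forall>t\<in>{0..T}. norm (x t - x\<^sub>0 t) \<le> K * h) \<longrightarrow>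
      max 0 (g (x \<tau>)) / d \<le> \<tau> \<and> (\<forall>t\<in>{0..\<tau> - max 0 (g (x \<tau>)) / d}. g (x t) \<le> 0))"
    using stays_in_K by metis
  have "\<exists>e>0. \<forall>h x. 0 < h \<and> h < e \<and> variation (dilation T \<tau> \<theta>) w h x \<and> (\<forall>t\<in>{0..T}. norm (x t - x\<^sub>0 t) \<le> K * h) \<and>
        (\<forall>t\<in>{0..T}. u t + h *\<^sub>R w t \<in> U) \<longrightarrow>
        \<phi> (x\<^sub>0 T) \<le> \<phi> (x T) - h * \<theta> + 2 / d * max 0 (g (x \<tau>))"
    if w: "w \<in> borel_measurable (lebesgue_on {0..T})" "\<forall>t\<in>{0..T}. norm (w t) \<le> C" and K: "K > 0" for \<theta> w C K
  proof -
    obtain e0 where e0: "e0 > 0" "\<And>h x. 0 < h \<Longrightarrow> h < e0 \<Longrightarrow> variation (dilation T \<tau> \<theta>) w h x \<Longrightarrow>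
      (\<forall>t\<in>{0..T}. norm (x t - x\<^sub>0 t) \<le> K * h) \<Longrightarrow>
      max 0 (g (x \<tau>)) / d \<le> \<tau> \<and> (\<forall>t\<in>{0..\<tau> - max 0 (g (x \<tau>)) / d}. g (x t) \<le> 0)"
      using st[OF K w(2), of \<theta>] by blast
    \<comment> \<open>Keeps the shifted switching time in (0,T) and below 2 \<tau>; the latter
      bounds the stretching factor by 2.\<close>
    define e where "e = min e0 (min (\<tau> / (\<bar>\<theta>\<bar> + 1)) ((T - \<tau>) / (\<bar>\<theta>\<bar> + 1)))"
    have "e > 0" using e0(1) \<tau> by (simp add: e_def)
    moreover have "\<phi> (x\<^sub>0 T) \<le> \<phi> (x T) - h * \<theta> + 2 / d * max 0 (g (x \<tau>))"
      if h: "0 < h" "h < e" and x: "variation (dilation T \<tau> \<theta>) w h x" and xK: "\<forall>t\<in>{0..T}. norm (x t - x\<^sub>0 t) \<le> K * h"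
        and feas: "\<forall>t\<in>{0..T}. u t + h *\<^sub>R w t \<in> U" for h x
    proof -
      define \<tau>' where "\<tau>' = \<tau> + h * \<theta>"
      have "h < \<tau> / (\<bar>\<theta>\<bar> + 1)" "h < (T - \<tau>) / (\<bar>\<theta>\<bar> + 1)" using h(2) by (auto simp: e_def)
      then have "h * (\<bar>\<theta>\<bar> + 1) < \<tau>" "h * (\<bar>\<theta>\<bar> + 1) < T - \<tau>" by (simp_all add: pos_less_divide_eq)
      moreover have "\<bar>h * \<theta>\<bar> \<le> h * (\<bar>\<theta>\<bar> + 1)" using h(1) by (simp add: abs_mult algebra_simps)
      ultimately have h\<theta>: "\<bar>h * \<theta>\<bar> < \<tau>" "\<bar>h * \<theta>\<bar> < T - \<tau>" by linarith+
      have \<tau>': "0 < \<tau>'" "\<tau>' < T" "\<tau>' \<le> 2 * \<tau>" using h\<theta> unfolding \<tau>'_def by linarith+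
      have \<tau>0: "0 < \<tau>" "\<tau> < T" using \<tau> by auto
      \<comment> \<open>\<rho> sends new time to old time, hence \<tau>' to \<tau>; \<sigma> is its
        inverse.\<close>
      define \<rho> where "\<rho> = warp T \<tau>' \<tau>"
      define \<sigma> where "\<sigma> = warp T \<tau> \<tau>'"
      define v where "v = (\<lambda>t. u t + h *\<^sub>R w t)"
      have inv: "\<sigma> (\<rho> s) = s" "\<rho> (\<sigma> s) = s" for s
        unfolding \<rho>_def \<sigma>_def by (rule warp_inverse[OF \<tau>'(1,2) \<tau>0], rule warp_inverse[OF \<tau>0 \<tau>'(1,2)])
      have \<rho>i: "\<rho> ` {0..T} \<subseteq> {0..T}" unfolding \<rho>_def by (rule warp_image[OF \<tau>'(1,2) \<tau>0])
      have \<rho>l: "(\<tau> / \<tau>' + (T - \<tau>) / (T - \<tau>'))-lipschitz_on S \<rho>" for S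
        unfolding \<rho>_def by (rule warp_lipschitz[OF \<tau>'(1,2) \<tau>0])
      have \<sigma>l: "(\<tau>' / \<tau> + (T - \<tau>') / (T - \<tau>))-lipschitz_on S \<sigma>" for S
        unfolding \<sigma>_def by (rule warp_lipschitz[OF \<tau>0 \<tau>'(1,2)])
      have vm: "v \<in> borel_measurable (lebesgue_on {0..T})" unfolding v_def
        by (intro borel_measurable_add borel_measurable_scaleR borel_measurable_const u_meas w(1))
      have V: "(\<lambda>s. v (\<rho> s)) \<in> controls 0 T U"
        unfolding controls_def
      proof (intro CollectI conjI ballI)
        show "(\<lambda>s. v (\<rho> s)) \<in> borel_measurable (lebesgue_on {0..T})"
          by (rule borel_measurable_lebesgue_on_reparam[OF vm lipschitz_on_continuous_on[OF \<rho>l] \<rho>i \<sigma>l inv(1)])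
        show "v (\<rho> s) \<in> U" if "s \<in> {0..T}" for s using feas \<rho>i that unfolding v_def by blast
      qed
      have lx: "lip_primitive 0 T (\<lambda>t. (1 + h * dilation T \<tau> \<theta> t) *\<^sub>R f (x t) (v t)) x" and x0: "x 0 = x\<^sub>0 0"
        using x unfolding variation_def v_def by auto
      have "lip_primitive 0 T (\<lambda>s. (if s \<le> \<tau>' then \<tau> / \<tau>' else (T - \<tau>) / (T - \<tau>')) *\<^sub>R
          ((1 + h * dilation T \<tau> \<theta> (\<rho> s)) *\<^sub>R f (x (\<rho> s)) (v (\<rho> s)))) (\<lambda>s. x (\<rho> s))"
      proof (rule lip_primitive_reparam[OF lx \<rho>l \<rho>i \<sigma>l inv(1), of "{\<tau>'}"])
        show "(\<rho> has_real_derivative (if s \<le> \<tau>' then \<tau> / \<tau>' else (T - \<tau>) / (T - \<tau>'))) (at s within {0..T})"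
          if "s \<in> {0..T} - {\<tau>'}" for s unfolding \<rho>_def by (rule warp_deriv[OF \<tau>'(1,2)]) (use that in auto)
      qed simp_all
      then have "lip_primitive 0 T (\<lambda>s. f (x (\<rho> s)) (v (\<rho> s))) (\<lambda>s. x (\<rho> s))"
      proof (rule lip_primitive_cong[OF _ negligible_empty])
        \<comment> \<open>On each piece the slope of \<rho> is the reciprocal of the dilation
          factor, so the speed factor cancels.\<close>
        fix s
        show "(if s \<le> \<tau>' then \<tau> / \<tau>' else (T - \<tau>) / (T - \<tau>')) *\<^sub>R
          ((1 + h * dilation T \<tau> \<theta> (\<rho> s)) *\<^sub>R f (x (\<rho> s)) (v (\<rho> s))) = f (x (\<rho> s)) (v (\<rho> s))"
        proof (cases "s \<le> \<tau>'")
          case True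
          then have "\<rho> s \<le> \<tau>" unfolding \<rho>_def using warp_mono[OF \<tau>'(1,2) \<tau>0 True] warp_ends(2)[OF \<tau>'(1,2)] by metis
          then have "1 + h * dilation T \<tau> \<theta> (\<rho> s) = \<tau>' / \<tau>" using \<tau>0 by (simp add: dilation_def \<tau>'_def field_simps)
          then show ?thesis using True \<tau>0 \<tau>' by simp
        next
          case False
          have "\<not> \<rho> s \<le> \<tau>"
          proof
            assume "\<rho> s \<le> \<tau>"
            then have "\<sigma> (\<rho> s) \<le> \<tau>'" unfolding \<sigma>_def using warp_mono[OF \<tau>0 \<tau>'(1,2)] warp_ends(2)[OF \<tau>0] by metis
            then show False using False inv by simp
          qed
          then have "1 + h * dilation T \<tau> \<theta> (\<rho> s) = (T - \<tau>') / (T - \<tau>)" using \<tau>0 by (simp add: dilation_def \<tau>'_def field_simps)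
          then show ?thesis using False \<tau>0 \<tau>' by simp
        qed
      qed simp
      then have ode: "ode_solution 0 T (\<lambda>s z. f z (v (\<rho> s))) (\<lambda>s. x (\<rho> s))"
        by (rule lip_primitive_imp_ode_solution)
      have \<rho>e: "\<rho> 0 = 0" "\<rho> T = T" unfolding \<rho>_def by (rule warp_ends[OF \<tau>'(1,2)])+
      have "state_of f T (x\<^sub>0 0) (\<lambda>s. v (\<rho> s)) (\<lambda>s. x (\<rho> s))"
        unfolding state_of_def using ode x0 \<rho>e by simp
      from optimal[OF V this]
      have opt: "\<phi> (x\<^sub>0 T) + (T - \<tau>) \<le> time_crisis_cost \<phi> {x. g x \<le> 0} T (\<lambda>s. x (\<rho> s))" .
      define m where "m = max 0 (g (x \<tau>))"
      have he0: "h < e0" using h(2) by (simp add: e_def)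
      note stay = e0(2)[OF h(1) he0 x xK, folded m_def]
      note m = conjunct1[OF stay] conjunct2[OF stay]
      have m0: "m \<ge> 0" by (simp add: m_def)
      \<comment> \<open>Last time, on the old clock, at which staying in K is guaranteed; \<sigma>
        t' is the same moment on the new clock.\<close>
      define t' where "t' = \<tau> - m / d"
      have t': "0 \<le> t'" "t' \<le> \<tau>" using m(1) m0 d by (simp_all add: t'_def)
      have \<sigma>t: "\<sigma> t' = (\<tau>' / \<tau>) * t'" unfolding \<sigma>_def by (rule warp_simps(1)[OF \<tau>0 t'(2)])
      have s0: "0 \<le> \<sigma> t'" unfolding \<sigma>t using t' \<tau>' \<tau>0 by simp
      have sT: "\<sigma> t' \<le> T" using warp_mono[OF \<tau>0 \<tau>'(1,2) t'(2)] warp_ends(2)[OF \<tau>0] \<tau>'(2) unfolding \<sigma>_def by (simp add: order_trans)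
      have "(LINT s|lebesgue_on {0..T}. indicat_real (- {x. g x \<le> 0}) (x (\<rho> s))) \<le> T - \<sigma> t'"
      proof (rule crossing_cost_le[OF s0 sT])
        fix s assume s: "s \<in> {0..\<sigma> t'}"
        have "\<rho> s \<le> \<rho> (\<sigma> t')" unfolding \<rho>_def by (rule warp_mono[OF \<tau>'(1,2) \<tau>0]) (use s in auto)
        moreover have "\<rho> s \<in> {0..T}" using \<rho>i s sT by (meson atLeastAtMost_iff image_subset_iff order_trans)
        ultimately have "\<rho> s \<in> {0..t'}" using inv by simp
        then show "x (\<rho> s) \<in> {x. g x \<le> 0}" using m(2) unfolding t'_def by blast
      qed
      then have "\<phi> (x\<^sub>0 T) + (T - \<tau>) \<le> \<phi> (x T) + (T - \<sigma> t')"
        using opt \<rho>e unfolding time_crisis_cost_def by simp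
      moreover have "\<sigma> t' \<ge> \<tau>' - 2 / d * m"
      proof -
        have "\<tau>' / \<tau> \<le> 2" using \<tau>'(3) \<tau>0 by (simp add: field_simps)
        moreover have "m / d \<ge> 0" using m0 d by simp
        ultimately have "(\<tau>' / \<tau>) * (m / d) \<le> 2 * (m / d)" by (rule mult_right_mono)
        moreover have "\<sigma> t' = \<tau>' - (\<tau>' / \<tau>) * (m / d)" unfolding \<sigma>t using \<tau>0 by (simp add: t'_def right_diff_distrib)
        ultimately show ?thesis by simp
      qed
      ultimately show ?thesis unfolding m_def[symmetric] \<tau>'_def by linarith
    qed
    ultimately show ?thesis by blast
  qed
  moreover have "2 / d \<ge> 0" using d by simp
  ultimately show ?thesis by blast
qed

end

section \<open>Multipliers of the transformed problem\<close>

lemma grad_eqI: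
  assumes "(h has_derivative (\<lambda>v. D \<bullet> v)) (at x)"
  shows "grad h x = D"
  unfolding grad_def
proof (rule the_equality)
  show "GDERIV h x :> D" using assms by (simp add: gderiv_def inner_commute)
  fix E assume "GDERIV h x :> E"
  then have "(h has_derivative (\<lambda>v. v \<bullet> E)) (at x)" by (simp add: gderiv_def)
  from has_derivative_unique[OF this assms] have "v \<bullet> E = D \<bullet> v" for v by (rule fun_cong)
  then have "v \<bullet> E = v \<bullet> D" for v by (metis inner_commute)
  then show "E = D" by (metis vector_eq_ldot)
qed

lemma grad_eq_riesz:
  fixes h :: "'a::euclidean_space \<Rightarrow> real"
  assumes "(h has_derivative l) (at x)"
  shows "grad h x = riesz l"
proof (rule grad_eqI)
  have "l = (\<lambda>v. riesz l \<bullet> v)" by (rule ext) (rule riesz_inner[OF has_derivative_linear[OF assms], symmetric])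
  then show "(h has_derivative (\<lambda>v. riesz l \<bullet> v)) (at x)" using assms by simp
qed

lemma grad_inner:
  fixes h :: "'a::euclidean_space \<Rightarrow> real"
  assumes "(h has_derivative l) (at x)"
  shows "grad h x \<bullet> v = l v"
  unfolding grad_eq_riesz[OF assms] by (rule riesz_inner[OF has_derivative_linear[OF assms]])

lemma transposed_jacobian_eqI:
  fixes h :: "'a::euclidean_space \<Rightarrow> 'b::euclidean_space"
  assumes "(h has_derivative l) (at x)" "\<And>v w. l v \<bullet> w = v \<bullet> m w"
  shows "transposed_jacobian h x = m"
  unfolding transposed_jacobian_def frechet_derivative_at[OF assms(1), symmetric]
  by (rule adjoint_unique) (use assms(2) in blast)

section \<open>Affine passage from the two pieces to the unit interval\<close>

lemma negligible_affine_preimage: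
  fixes a b :: real
  assumes N: "negligible N" and a: "a \<noteq> 0"
  shows "negligible {s. b + a * s \<in> N}"
proof -
  have "negligible ((\<lambda>t. (t - b) / a) ` N)"
  proof (rule negligible_locally_Lipschitz_image[OF _ N])
    show "\<exists>T B. open T \<and> t \<in> T \<and> (\<forall>y\<in>N \<inter> T. norm ((y - b) / a - (t - b) / a) \<le> B * norm (y - t))" for t
    proof (intro exI[of _ UNIV] exI[of _ "1 / \<bar>a\<bar>"] conjI ballI open_UNIV UNIV_I)
      fix y
      have "(y - b) / a - (t - b) / a = (y - t) / a" by (simp add: diff_divide_distrib)
      then show "norm ((y - b) / a - (t - b) / a) \<le> 1 / \<bar>a\<bar> * norm (y - t)" by (simp add: abs_divide)
    qed
  qed (rule order_refl)
  moreover have "{s. b + a * s \<in> N} \<subseteq> (\<lambda>t. (t - b) / a) ` N"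
  proof
    fix s assume "s \<in> {s. b + a * s \<in> N}"
    moreover have "s = ((b + a * s) - b) / a" using a by simp
    ultimately show "s \<in> (\<lambda>t. (t - b) / a) ` N" by blast
  qed
  ultimately show ?thesis by (rule negligible_subset)
qed

lemma affine_lipschitz: "\<bar>a\<bar>-lipschitz_on S (\<lambda>s. b + a * s :: real)"
proof (rule lipschitz_onI)
  show "dist (b + a * x) (b + a * y) \<le> \<bar>a\<bar> * dist x y" for x y
    by (simp add: dist_real_def abs_mult flip: right_diff_distrib)
qed simp

lemma affine_inverse_lipschitz:
  fixes a b :: real
  shows "\<bar>1 / a\<bar>-lipschitz_on S (\<lambda>t. (t - b) / a)"
  using affine_lipschitz[of "1 / a" S "- b / a"] by (simp add: diff_divide_distrib add.commute)

lemma lip_primitive_affine: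
  fixes x :: "real \<Rightarrow> 'a::euclidean_space"
  assumes x: "lip_primitive b (b + a) r x" and a: "a > 0"
  shows "lip_primitive 0 1 (\<lambda>s. a *\<^sub>R r (b + a * s)) (\<lambda>s. x (b + a * s))"
proof (rule lip_primitive_reparam[OF x affine_lipschitz _ affine_inverse_lipschitz _ finite.emptyI])
  show "(\<lambda>s. b + a * s) ` {0..1} \<subseteq> {b..b + a}"
  proof (rule image_subsetI)
    fix s :: real assume s: "s \<in> {0..1}"
    then have "a * s \<le> a * 1" by (intro mult_left_mono) (use a in auto)
    then show "b + a * s \<in> {b..b + a}" using s a by simp
  qed
  show "(b + a * s - b) / a = s" for s using a by simp
  show "((\<lambda>s. b + a * s) has_real_derivative a) (at s within {0..1})" for s
    by (auto intro!: derivative_eq_intros)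
qed

lemma measurable_affine:
  fixes g :: "real \<Rightarrow> 'b::topological_space"
  assumes g: "g \<in> borel_measurable (lebesgue_on {0..T})" and a: "a > 0" "0 \<le> b" "b + a \<le> T"
  shows "(\<lambda>s. g (b + a * s)) \<in> borel_measurable (lebesgue_on {0..1})"
proof (rule borel_measurable_lebesgue_on_reparam[OF g lipschitz_on_continuous_on[OF affine_lipschitz] _ affine_inverse_lipschitz])
  show "(\<lambda>s. b + a * s) ` {0..1} \<subseteq> {0..T}"
  proof (rule image_subsetI)
    fix s :: real assume s: "s \<in> {0..1}"
    then have "a * s \<le> a * 1" by (intro mult_left_mono) (use a in auto)
    then have "a * s \<le> a" "0 \<le> a * s" using s a by simp_all
    then show "b + a * s \<in> {0..T}" unfolding atLeastAtMost_iff using a by linarith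
  qed
  show "(b + a * s - b) / a = s" for s using a by simp
qed

lemma bounded_in_Linf:
  assumes "h \<in> borel_measurable (lebesgue_on {a..b})" "\<And>t. t \<in> {a..b} \<Longrightarrow> norm (h t) \<le> B"
  shows "h \<in> Linf a b"
proof -
  have "esssup (lebesgue_on {a..b}) (\<lambda>t. ereal (norm (h t))) \<le> ereal B"
    by (rule esssup_I) (use assms in \<open>auto intro!: AE_I2\<close>)
  also have "\<dots> < \<infinity>" by simp
  finally show ?thesis using assms(1) by (simp add: Linf_def Linf_norm_def)
qed

lemma Linf_essentially_bounded:
  assumes "h \<in> Linf a b"
  shows "\<exists>B. AE t in lebesgue_on {a..b}. norm (h t) \<le> B"
proof -
  let ?e = "esssup (lebesgue_on {a..b}) (\<lambda>t. ereal (norm (h t)))"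
  have "?e < \<infinity>" using assms by (simp add: Linf_def Linf_norm_def)
  then obtain n :: nat where n: "?e < ereal (real n)" using less_PInf_Ex_of_nat by auto
  have "AE t in lebesgue_on {a..b}. ereal (norm (h t)) \<le> ?e" by (rule esssup_AE)
  then have "AE t in lebesgue_on {a..b}. norm (h t) \<le> real n"
  proof (rule AE_mp, intro AE_I2 impI)
    fix t assume "ereal (norm (h t)) \<le> ?e"
    then have "ereal (norm (h t)) \<le> ereal (real n)" using n by (simp only: order_trans less_imp_le)
    then show "norm (h t) \<le> real n" by simp
  qed
  then show ?thesis by blast
qed

text \<open>Transport to [0,1]. The conditions at 0 merely define \<beta>1 and \<beta>3 as minus the
  initial costates and give \<lambda>(0) = 0. Those at 1 become the jump at \<tau>, the terminal
  value at T and \<lambda>(1) = -1.\<close>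

lemma Lagrange_multipliers_nonempty:
  fixes f :: "real^'n \<Rightarrow> real^'m \<Rightarrow> real^'n" and g \<phi> :: "real^'n \<Rightarrow> real" and c :: "real^'m \<Rightarrow> real^'l"
    and f' :: "(real^'n) \<times> (real^'m) \<Rightarrow> ((real^'n) \<times> (real^'m)) \<Rightarrow>\<^sub>L (real^'n)"
    and xbar p1 p2 :: "real \<Rightarrow> real^'n" and ubar :: "real \<Rightarrow> real^'m" and \<mu> :: "'l \<Rightarrow> real \<Rightarrow> real"
    and L1 L2 :: "real \<Rightarrow> real"
  assumes \<tau>: "0 < \<tau>" "\<tau> < T"
    and f': "\<And>z. ((\<lambda>(x, v). f x v) has_derivative blinfun_apply (f' z)) (at z)"
    and g': "\<And>x. (g has_derivative blinfun_apply (g' x)) (at x)"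
    and \<phi>': "\<And>x. (\<phi> has_derivative blinfun_apply (\<phi>' x)) (at x)"
    and c': "\<And>v. (c has_derivative blinfun_apply (c' v)) (at v)"
    and p1: "lip_primitive 0 \<tau> (\<lambda>t. - riesz (\<lambda>b. p1 t \<bullet> f' (xbar t, ubar t) (b, 0))) p1"
    and p2: "lip_primitive \<tau> T (\<lambda>t. - riesz (\<lambda>b. p2 t \<bullet> f' (xbar t, ubar t) (b, 0))) p2"
    and L1: "lip_primitive 0 \<tau> (\<lambda>t. p1 t \<bullet> f (xbar t) (ubar t)) L1" "L1 0 = 0"
    and L2: "lip_primitive \<tau> T (\<lambda>t. p2 t \<bullet> f (xbar t) (ubar t)) L2" "L2 \<tau> = 0"
    and ends: "p2 T = grad \<phi> (xbar T)" "p1 \<tau> = p2 \<tau> + \<beta> *\<^sub>R grad g (xbar \<tau>)" "L1 \<tau> / \<tau> - L2 T / (T - \<tau>) = 1"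
    and \<mu>: "\<And>i. \<mu> i \<in> borel_measurable (lebesgue_on {0..T})" "\<And>i t. t \<in> {0..T} \<Longrightarrow> \<bar>\<mu> i t\<bar> \<le> B"
    and N: "negligible N" and \<mu>N: "\<And>t i. t \<in> {0..T} - N \<Longrightarrow> 0 \<le> \<mu> i t" "\<And>t i. t \<in> {0..T} - N \<Longrightarrow> \<mu> i t * c (ubar t) $ i = 0"
    and stat: "\<And>t h. t \<in> {0..T} - N \<Longrightarrow>
      (if t \<le> \<tau> then p1 t else p2 t) \<bullet> f' (xbar t, ubar t) (0, h) + (\<Sum>i\<in>UNIV. \<mu> i t * c' (ubar t) h $ i) = 0"
  shows "Lagrange_multipliers f g c \<phi> T (P_ref_state T \<tau> xbar) (P_ref_control T \<tau> ubar) \<noteq> {}"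
proof -
  define \<kappa> where "\<kappa> = T - \<tau>"
  have \<kappa>: "\<kappa> > 0" "\<tau> + \<kappa> = T" using \<tau> by (auto simp: \<kappa>_def)
  define \<rho>1 where "\<rho>1 = (\<lambda>s. \<tau> * s)"
  define \<rho>2 where "\<rho>2 = (\<lambda>s. \<tau> + \<kappa> * s)"
  define y where "y = (\<lambda>s. (xbar (\<rho>1 s), xbar (\<rho>2 s), \<tau>))"
  define v where "v = (\<lambda>s. (ubar (\<rho>1 s), ubar (\<rho>2 s)))"
  have tc: "time_change T \<tau> s = \<rho>1 s" "time_change T \<tau> (s + 1) = \<rho>2 s" if "s \<in> {0..1}" for s
    using that by (auto simp: time_change_def \<rho>1_def \<rho>2_def \<kappa>_def algebra_simps)
  have yb: "P_ref_state T \<tau> xbar s = y s" and vb: "P_ref_control T \<tau> ubar s = v s" if "s \<in> {0..1}" for s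
    using tc[OF that] by (simp_all add: P_ref_state_def P_ref_control_def y_def v_def)
  have \<rho>in: "\<rho>1 s \<in> {0..\<tau>}" "\<rho>2 s \<in> {\<tau>..T}" if "s \<in> {0..1}" for s
  proof -
    have "\<tau> * s \<le> \<tau> * 1" "\<kappa> * s \<le> \<kappa> * 1" using that \<tau> \<kappa> by (auto intro!: mult_left_mono simp del: mult_1_right)
    then show "\<rho>1 s \<in> {0..\<tau>}" "\<rho>2 s \<in> {\<tau>..T}" using that \<tau> \<kappa> by (auto simp: \<rho>1_def \<rho>2_def)
  qed
  define q1 where "q1 = (\<lambda>s. p1 (\<rho>1 s))"
  define q2 where "q2 = (\<lambda>s. p2 (\<rho>2 s))"
  \<comment> \<open>Third costate. Its derivative is q2 \<bullet> f - q1 \<bullet> f, minus the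
    \<xi>-derivative of the Hamiltonian, and the balance of mean values in \<open>ends\<close> makes
    its final value -1.\<close>
  define lam where "lam = (\<lambda>s. (1 / \<kappa>) * L2 (\<rho>2 s) - (1 / \<tau>) * L1 (\<rho>1 s))"
  define q where "q = (\<lambda>s. (q1 s, q2 s, lam s))"
  define ad where "ad = (\<lambda>x v p. riesz (\<lambda>b. p \<bullet> f' (x, v) (b, 0)))"
  have ad_inner: "ad x v p \<bullet> h = p \<bullet> f' (x, v) (h, 0)" for x v p h
    unfolding ad_def by (rule riesz_inner[OF linear_inner_partial(1)])
  have f_comp: "((\<lambda>y. f (X y) (V y)) has_derivative (\<lambda>h. f' (X y, V y) (X' h, V' h))) (at y)"
    if "(X has_derivative X') (at y)" "(V has_derivative V') (at y)" for X V X' V' and y :: "'z::real_normed_vector"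
    using has_derivative_compose[OF has_derivative_Pair[OF that] f'] by simp
  have ham: "((\<lambda>y. P_ham f T y p w) has_derivative (\<lambda>h. (\<xi> *\<^sub>R ad y1 (fst w) (fst p), (T - \<xi>) *\<^sub>R ad y2 (snd w) (fst (snd p)),
      fst p \<bullet> f y1 (fst w) - fst (snd p) \<bullet> f y2 (snd w)) \<bullet> h)) (at (y1, y2, \<xi>))"
    for p :: "'n pstate" and w :: "'m pcontrol" and y1 y2 \<xi>
  proof -
    have eq: "P_ham f T y p w = fst p \<bullet> (snd (snd y) *\<^sub>R f (fst y) (fst w)) + fst (snd p) \<bullet> ((T - snd (snd y)) *\<^sub>R f (fst (snd y)) (snd w))" for y
      by (cases y; cases p; cases w) (simp add: P_ham_def P_dyn_def)
    have bl: "bounded_linear (\<lambda>y::'n pstate. snd (snd y))" "bounded_linear (\<lambda>y::'n pstate. fst (snd y))"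
      by (intro bounded_linear_compose[OF bounded_linear_snd bounded_linear_snd],
          intro bounded_linear_compose[OF bounded_linear_fst bounded_linear_snd])
    note d = bounded_linear_imp_has_derivative[OF bl(1)] bounded_linear_imp_has_derivative[OF bl(2)]
      bounded_linear_imp_has_derivative[OF bounded_linear_fst]
    show ?thesis unfolding eq
    proof (rule has_derivative_eq_rhs)
      show "((\<lambda>y. fst p \<bullet> (snd (snd y) *\<^sub>R f (fst y) (fst w)) + fst (snd p) \<bullet> ((T - snd (snd y)) *\<^sub>R f (fst (snd y)) (snd w)))
         has_derivative (\<lambda>h. fst p \<bullet> (snd (snd (y1, y2, \<xi>)) *\<^sub>R f' (fst (y1, y2, \<xi>), fst w) (fst h, 0) + snd (snd h) *\<^sub>R f (fst (y1, y2, \<xi>)) (fst w)) +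
            fst (snd p) \<bullet> ((T - snd (snd (y1, y2, \<xi>))) *\<^sub>R f' (fst (snd (y1, y2, \<xi>)), snd w) (fst (snd h), 0) + (0 - snd (snd h)) *\<^sub>R f (fst (snd (y1, y2, \<xi>))) (snd w)))) (at (y1, y2, \<xi>))"
        by (intro has_derivative_add has_derivative_inner_right has_derivative_scaleR f_comp has_derivative_diff has_derivative_const d)
    qed (auto simp: fun_eq_iff ad_inner inner_add_right inner_diff_left algebra_simps)
  qed
  have \<phi>lip: "lip_primitive 0 1 (\<lambda>s. (\<tau> *\<^sub>R (- ad (xbar (\<rho>1 s)) (ubar (\<rho>1 s)) (q1 s)), \<kappa> *\<^sub>R (- ad (xbar (\<rho>2 s)) (ubar (\<rho>2 s)) (q2 s)),
      q2 s \<bullet> f (xbar (\<rho>2 s)) (ubar (\<rho>2 s)) - q1 s \<bullet> f (xbar (\<rho>1 s)) (ubar (\<rho>1 s)))) q"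
  proof -
    have from0: "lip_primitive 0 1 (\<lambda>s. \<tau> *\<^sub>R r (\<rho>1 s)) (\<lambda>s. x (\<rho>1 s))" if "lip_primitive 0 \<tau> r x"
      for r x :: "real \<Rightarrow> 'z::euclidean_space"
      using lip_primitive_affine[of 0 \<tau> r x] that \<tau> by (simp add: \<rho>1_def)
    have to1: "lip_primitive 0 1 (\<lambda>s. \<kappa> *\<^sub>R r (\<rho>2 s)) (\<lambda>s. x (\<rho>2 s))" if "lip_primitive \<tau> T r x"
      for r x :: "real \<Rightarrow> 'z::euclidean_space"
      using lip_primitive_affine[of \<tau> \<kappa> r x] that \<kappa> by (simp add: \<rho>2_def)
    have 1: "lip_primitive 0 1 (\<lambda>s. \<tau> *\<^sub>R (- ad (xbar (\<rho>1 s)) (ubar (\<rho>1 s)) (q1 s))) q1"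
      using from0[OF p1] unfolding ad_def q1_def .
    have 2: "lip_primitive 0 1 (\<lambda>s. \<kappa> *\<^sub>R (- ad (xbar (\<rho>2 s)) (ubar (\<rho>2 s)) (q2 s))) q2"
      using to1[OF p2] unfolding ad_def q2_def .
    have 3: "lip_primitive 0 1 (\<lambda>s. q1 s \<bullet> f (xbar (\<rho>1 s)) (ubar (\<rho>1 s))) (\<lambda>s. (1 / \<tau>) * L1 (\<rho>1 s))"
      using lip_primitive_bounded_linear[OF bounded_linear_mult_right[of "1 / \<tau>"] from0[OF L1(1)]] \<tau>
      by (simp add: q1_def)
    have 4: "lip_primitive 0 1 (\<lambda>s. q2 s \<bullet> f (xbar (\<rho>2 s)) (ubar (\<rho>2 s))) (\<lambda>s. (1 / \<kappa>) * L2 (\<rho>2 s))"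
      using lip_primitive_bounded_linear[OF bounded_linear_mult_right[of "1 / \<kappa>"] to1[OF L2(1)]] \<kappa>
      by (simp add: q2_def)
    show ?thesis unfolding q_def lam_def by (intro lip_primitive_Pair 1 2 lip_primitive_diff[OF 4 3])
  qed
  have ode: "ode_solution 0 1 (\<lambda>s p. - grad (\<lambda>y. P_ham f T y p (P_ref_control T \<tau> ubar s)) (P_ref_state T \<tau> xbar s)) q"
  proof (rule lip_primitive_imp_ode_solution, rule lip_primitive_cong[OF \<phi>lip negligible_empty])
    fix s :: real assume "s \<in> {0..1} - {}"
    then have s: "s \<in> {0..1}" by simp
    show "(\<tau> *\<^sub>R (- ad (xbar (\<rho>1 s)) (ubar (\<rho>1 s)) (q1 s)), \<kappa> *\<^sub>R (- ad (xbar (\<rho>2 s)) (ubar (\<rho>2 s)) (q2 s)),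
      q2 s \<bullet> f (xbar (\<rho>2 s)) (ubar (\<rho>2 s)) - q1 s \<bullet> f (xbar (\<rho>1 s)) (ubar (\<rho>1 s))) =
      - grad (\<lambda>y. P_ham f T y (q s) (P_ref_control T \<tau> ubar s)) (P_ref_state T \<tau> xbar s)"
      unfolding yb[OF s] vb[OF s] unfolding y_def grad_eqI[OF ham] unfolding v_def q_def fst_conv snd_conv \<kappa>_def by simp
  qed simp
  \<comment> \<open>The rescaled dynamics carry the factors \<tau> and T - \<tau>, so \<mu> is
    scaled in the same way on each piece.\<close>
  define M where "M = (\<lambda>s. (\<chi> i. \<tau> * \<mu> i (\<rho>1 s), \<chi> i. \<kappa> * \<mu> i (\<rho>2 s)) :: (real^'l) \<times> (real^'l))"
  have M_Linf: "M \<in> Linf 0 1"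
  proof (rule bounded_in_Linf[of _ _ _ "real CARD('l) * (\<tau> * B) + real CARD('l) * (\<kappa> * B)"])
    have m1: "(\<lambda>s. \<mu> i (\<rho>1 s)) \<in> borel_measurable (lebesgue_on {0..1})" for i
      using measurable_affine[OF \<mu>(1)[of i], of \<tau> 0] \<tau> by (simp add: \<rho>1_def)
    have m2: "(\<lambda>s. \<mu> i (\<rho>2 s)) \<in> borel_measurable (lebesgue_on {0..1})" for i
      using measurable_affine[OF \<mu>(1)[of i], of \<kappa> \<tau>] \<tau> \<kappa> by (simp add: \<rho>2_def)
    have vec: "(\<lambda>s. \<chi> i. F i s) \<in> borel_measurable (lebesgue_on {0..1})"
      if "\<And>i. F i \<in> borel_measurable (lebesgue_on {0..1})" for F :: "'l \<Rightarrow> real \<Rightarrow> real"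
    proof -
      have "(\<lambda>s. \<Sum>i\<in>UNIV. F i s *\<^sub>R (axis i 1 :: real^'l)) \<in> borel_measurable (lebesgue_on {0..1})"
        by (intro borel_measurable_sum borel_measurable_scaleR borel_measurable_const that)
      moreover have "(\<Sum>i\<in>UNIV. F i s *\<^sub>R (axis i 1 :: real^'l)) = (\<chi> i. F i s)" for s
        by (simp add: vec_eq_iff axis_def if_distrib[where f="\<lambda>x. _ * x"] cong: if_cong)
      ultimately show ?thesis by simp
    qed
    show "M \<in> borel_measurable (lebesgue_on {0..1})" unfolding M_def
      by (intro borel_measurable_Pair vec borel_measurable_times borel_measurable_const m1 m2)
    fix s :: real assume s: "s \<in> {0..1}"
    have r: "\<rho>1 s \<in> {0..T}" "\<rho>2 s \<in> {0..T}" using \<rho>in[OF s] \<tau> by auto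
    have "norm (\<chi> i. a * \<mu> i t) \<le> real CARD('l) * (a * B)" if "t \<in> {0..T}" "a \<ge> 0" for a t
    proof -
      have "norm (\<chi> i. a * \<mu> i t) \<le> (\<Sum>i\<in>UNIV. \<bar>(\<chi> i. a * \<mu> i t) $ i\<bar>)" by (rule norm_le_l1_cart)
      also have "\<dots> \<le> (\<Sum>i\<in>(UNIV::'l set). a * B)"
        by (rule sum_mono) (use \<mu>(2)[OF that(1)] that(2) in \<open>simp add: abs_mult mult_left_mono\<close>)
      finally show ?thesis by simp
    qed
    from this[OF r(1), of \<tau>] this[OF r(2), of \<kappa>] \<tau> \<kappa>
    show "norm (M s) \<le> real CARD('l) * (\<tau> * B) + real CARD('l) * (\<kappa> * B)"
      unfolding M_def by (intro order_trans[OF norm_Pair_le] add_mono) auto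
  qed
  \<comment> \<open>0 is excluded because it is mapped to \<tau> by \<rho>2, where the stationarity
    hypothesis refers to the costate of the first piece.\<close>
  define NN where "NN = {s. 0 + \<tau> * s \<in> N} \<union> {s. \<tau> + \<kappa> * s \<in> N} \<union> {0}"
  have NN: "negligible NN" unfolding NN_def
    using negligible_affine_preimage[OF N, of \<tau> 0] negligible_affine_preimage[OF N, of \<kappa> \<tau>] \<tau> \<kappa>
    by (intro negligible_Un) auto
  have off: "\<rho>1 s \<in> {0..T} - N" "\<rho>2 s \<in> {0..T} - N" "\<rho>1 s \<le> \<tau>" "\<not> \<rho>2 s \<le> \<tau>" if "s \<in> {0..1} - NN" for s
  proof -
    have s: "s \<in> {0..1}" "s > 0" using that by (auto simp: NN_def less_le)
    then have pos: "\<kappa> * s > 0" using \<kappa> by simp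
    have "\<rho>1 s \<notin> N" "\<rho>2 s \<notin> N" using that by (auto simp: NN_def \<rho>1_def \<rho>2_def)
    moreover have "\<rho>1 s \<in> {0..T}" "\<rho>2 s \<in> {0..T}" "\<rho>1 s \<le> \<tau>" using \<rho>in[OF s(1)] \<tau> by auto
    moreover have "\<not> \<rho>2 s \<le> \<tau>" using pos by (simp add: \<rho>2_def)
    ultimately show "\<rho>1 s \<in> {0..T} - N" "\<rho>2 s \<in> {0..T} - N" "\<rho>1 s \<le> \<tau>" "\<not> \<rho>2 s \<le> \<tau>" by auto
  qed
  have compl: "AE s in lebesgue_on {0..1}. (\<forall>i. 0 \<le> fst (M s) $ i \<and> 0 \<le> snd (M s) $ i) \<and>
        fst (M s) \<bullet> c (fst (P_ref_control T \<tau> ubar s)) + snd (M s) \<bullet> c (snd (P_ref_control T \<tau> ubar s)) = 0"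
  proof (subst AE_lebesgue_on_iff, simp, rule exI[of _ NN], intro conjI NN ballI)
    fix s assume sN: "s \<in> {0..1} - NN"
    then have s: "s \<in> {0..1}" by simp
    note o = off[OF sN]
    show "\<forall>i. 0 \<le> fst (M s) $ i \<and> 0 \<le> snd (M s) $ i"
      using \<mu>N(1)[OF o(1)] \<mu>N(1)[OF o(2)] \<tau> \<kappa> by (simp add: M_def)
    have "(\<Sum>i\<in>UNIV. a * \<mu> i t * c (ubar t) $ i) = 0" if "t \<in> {0..T} - N" for a t
      using \<mu>N(2)[OF that] by (intro sum.neutral) (simp add: mult.assoc)
    from this[OF o(1)] this[OF o(2)]
    show "fst (M s) \<bullet> c (fst (P_ref_control T \<tau> ubar s)) + snd (M s) \<bullet> c (snd (P_ref_control T \<tau> ubar s)) = 0"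
      unfolding vb[OF s] v_def by (simp add: M_def inner_vec_def)
  qed
  have station: "AE s in lebesgue_on {0..1}.
      grad (\<lambda>v. P_aug_ham f c T (P_ref_state T \<tau> xbar s) (q s) v (M s)) (P_ref_control T \<tau> ubar s) = 0"
  proof (subst AE_lebesgue_on_iff, simp, rule exI[of _ NN], intro conjI NN ballI)
    fix s assume sN: "s \<in> {0..1} - NN"
    then have s: "s \<in> {0..1}" by simp
    note o = off[OF sN]
    have eq: "P_aug_ham f c T (y s) (q s) w (M s) = q1 s \<bullet> (\<tau> *\<^sub>R f (xbar (\<rho>1 s)) (fst w)) + q2 s \<bullet> (\<kappa> *\<^sub>R f (xbar (\<rho>2 s)) (snd w))
        + fst (M s) \<bullet> c (fst w) + snd (M s) \<bullet> c (snd w)" for w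
      by (cases w) (simp add: P_aug_ham_def P_ham_def P_dyn_def y_def q_def \<kappa>_def)
    have c_comp: "((\<lambda>y. c (V y)) has_derivative (\<lambda>h. c' (V y) (V' h))) (at y)"
      if "(V has_derivative V') (at y)" for V V' and y :: "'m pcontrol"
      using has_derivative_compose[OF that c'] .
    have z: "a * (p \<bullet> f' (xbar t, ubar t) (0, h)) + (\<chi> i. a * \<mu> i t) \<bullet> c' (ubar t) h = 0"
      if t: "t \<in> {0..T} - N" and p: "p = (if t \<le> \<tau> then p1 t else p2 t)" for a t h p
    proof -
      have "a * (p \<bullet> f' (xbar t, ubar t) (0, h)) + (\<chi> i. a * \<mu> i t) \<bullet> c' (ubar t) h =
          a * (p \<bullet> f' (xbar t, ubar t) (0, h) + (\<Sum>i\<in>UNIV. \<mu> i t * c' (ubar t) h $ i))"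
        by (simp add: inner_vec_def sum_distrib_left distrib_left mult.assoc)
      then show ?thesis using stat[OF t, of h] p by simp
    qed
    have z1: "\<tau> * (q1 s \<bullet> f' (xbar (\<rho>1 s), ubar (\<rho>1 s)) (0, h)) + fst (M s) \<bullet> c' (ubar (\<rho>1 s)) h = 0" for h
      unfolding M_def fst_conv by (rule z[OF o(1)]) (use o in \<open>simp add: q1_def\<close>)
    have z2: "\<kappa> * (q2 s \<bullet> f' (xbar (\<rho>2 s), ubar (\<rho>2 s)) (0, h)) + snd (M s) \<bullet> c' (ubar (\<rho>2 s)) h = 0" for h
      unfolding M_def snd_conv by (rule z[OF o(2)]) (use o in \<open>simp add: q2_def\<close>)
    show "grad (\<lambda>v. P_aug_ham f c T (P_ref_state T \<tau> xbar s) (q s) v (M s)) (P_ref_control T \<tau> ubar s) = 0"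
      unfolding yb[OF s] vb[OF s]
    proof (rule grad_eqI)
      show "((\<lambda>w. P_aug_ham f c T (y s) (q s) w (M s)) has_derivative (\<lambda>h. 0 \<bullet> h)) (at (v s))"
        unfolding eq
      proof (rule has_derivative_eq_rhs)
        show "((\<lambda>w. q1 s \<bullet> (\<tau> *\<^sub>R f (xbar (\<rho>1 s)) (fst w)) + q2 s \<bullet> (\<kappa> *\<^sub>R f (xbar (\<rho>2 s)) (snd w)) + fst (M s) \<bullet> c (fst w) + snd (M s) \<bullet> c (snd w))
          has_derivative (\<lambda>h. q1 s \<bullet> (\<tau> *\<^sub>R f' (xbar (\<rho>1 s), fst (v s)) (0, fst h)) + q2 s \<bullet> (\<kappa> *\<^sub>R f' (xbar (\<rho>2 s), snd (v s)) (0, snd h))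
            + fst (M s) \<bullet> c' (fst (v s)) (fst h) + snd (M s) \<bullet> c' (snd (v s)) (snd h))) (at (v s))"
          by (intro has_derivative_add has_derivative_inner_right has_derivative_scaleR_right f_comp c_comp has_derivative_const
              bounded_linear_imp_has_derivative bounded_linear_fst bounded_linear_snd)
        show "(\<lambda>h. q1 s \<bullet> (\<tau> *\<^sub>R f' (xbar (\<rho>1 s), fst (v s)) (0, fst h)) + q2 s \<bullet> (\<kappa> *\<^sub>R f' (xbar (\<rho>2 s), snd (v s)) (0, snd h))
            + fst (M s) \<bullet> c' (fst (v s)) (fst h) + snd (M s) \<bullet> c' (snd (v s)) (snd h)) = (\<lambda>h. 0 \<bullet> h)"
        proof
          fix h
          show "q1 s \<bullet> (\<tau> *\<^sub>R f' (xbar (\<rho>1 s), fst (v s)) (0, fst h)) + q2 s \<bullet> (\<kappa> *\<^sub>R f' (xbar (\<rho>2 s), snd (v s)) (0, snd h))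
            + fst (M s) \<bullet> c' (fst (v s)) (fst h) + snd (M s) \<bullet> c' (snd (v s)) (snd h) = 0 \<bullet> h"
            using z1[of "fst h"] z2[of "snd h"] by (simp add: v_def)
        qed
      qed
    qed
  qed
  have gG: "grad g (xbar \<tau>) \<bullet> h = g' (xbar \<tau>) h" for h by (rule grad_inner[OF g'])
  have y01: "P_ref_state T \<tau> xbar 0 = (xbar 0, xbar \<tau>, \<tau>)" "P_ref_state T \<tau> xbar 1 = (xbar \<tau>, xbar T, \<tau>)"
    using yb[of 0] yb[of 1] \<kappa> by (simp_all add: y_def \<rho>1_def \<rho>2_def)
  have q01: "q 0 = (p1 0, p2 \<tau>, 0)" "q 1 = (p1 \<tau>, p2 T, - 1)"
    using L1(2) L2(2) ends(3) \<kappa> by (simp_all add: q_def q1_def q2_def lam_def \<rho>1_def \<rho>2_def \<kappa>_def)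
  have J0: "transposed_jacobian (\<lambda>y0. P_constr g y0 (P_ref_state T \<tau> xbar 1)) (P_ref_state T \<tau> xbar 0) =
      (\<lambda>(b1, b2, b3, b4). (b1, b3, b2))"
    unfolding y01
  proof (rule transposed_jacobian_eqI)
    have eq: "P_constr g y0 (xbar \<tau>, xbar T, \<tau>) = (fst y0, snd (snd y0), fst (snd y0) - xbar \<tau>, g (xbar \<tau>))" for y0
      by (cases y0) (simp add: P_constr_def)
    show "((\<lambda>y0. P_constr g y0 (xbar \<tau>, xbar T, \<tau>)) has_derivative (\<lambda>h. (fst h, snd (snd h), fst (snd h) - 0, 0))) (at (xbar 0, xbar \<tau>, \<tau>))"
      unfolding eq
      by (intro has_derivative_Pair has_derivative_diff has_derivative_const has_derivative_fst has_derivative_snd has_derivative_ident)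
    show "(fst h, snd (snd h), fst (snd h) - 0, 0) \<bullet> w = h \<bullet> (case w of (b1, b2, b3, b4) \<Rightarrow> (b1, b3, b2))"
      for h :: "'n pstate" and w :: "'n pconstr"
      by (cases h; cases w) simp
  qed
  have J1: "transposed_jacobian (\<lambda>y1. P_constr g (P_ref_state T \<tau> xbar 0) y1) (P_ref_state T \<tau> xbar 1) =
      (\<lambda>(b1, b2, b3, b4). (b4 *\<^sub>R grad g (xbar \<tau>) - b3, 0, 0))"
    unfolding y01
  proof (rule transposed_jacobian_eqI)
    have eq: "P_constr g (xbar 0, xbar \<tau>, \<tau>) y1 = (xbar 0, \<tau>, xbar \<tau> - fst y1, g (fst y1))" for y1
      by (cases y1) (simp add: P_constr_def)
    show "((\<lambda>y1. P_constr g (xbar 0, xbar \<tau>, \<tau>) y1) has_derivative (\<lambda>h. (0, 0, 0 - fst h, g' (xbar \<tau>) (fst h)))) (at (xbar \<tau>, xbar T, \<tau>))"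
      unfolding eq
      using has_derivative_compose[OF has_derivative_fst[OF has_derivative_ident] g'[of "fst (xbar \<tau>, xbar T, \<tau>)"]]
      by (intro has_derivative_Pair has_derivative_diff has_derivative_const has_derivative_fst has_derivative_ident) simp
    show "(0, 0, 0 - fst h, g' (xbar \<tau>) (fst h)) \<bullet> w = h \<bullet> (case w of (b1, b2, b3, b4) \<Rightarrow> (b4 *\<^sub>R grad g (xbar \<tau>) - b3, 0, 0))"
      for h :: "'n pstate" and w :: "'n pconstr"
    proof -
      obtain h1 h2 h3 b1 b2 b3 b4 where hw: "h = (h1, h2, h3)" "w = (b1, b2, b3, b4)" by (metis prod_cases3 prod_cases4)
      have "h1 \<bullet> grad g (xbar \<tau>) = g' (xbar \<tau>) h1" using gG[of h1] by (simp add: inner_commute)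
      then show ?thesis unfolding hw by (simp add: inner_diff_right)
    qed
  qed
  have cost: "grad (P_cost \<phi> T) (P_ref_state T \<tau> xbar 1) = (0, grad \<phi> (xbar T), - 1)"
    unfolding y01
  proof (rule grad_eqI)
    have eq: "P_cost \<phi> T = (\<lambda>y. \<phi> (fst (snd y)) + T - snd (snd y))" by (auto simp: P_cost_def)
    have "((\<lambda>y. \<phi> (fst (snd y)) + T - snd (snd y)) has_derivative (\<lambda>h. \<phi>' (xbar T) (fst (snd h)) + 0 - snd (snd h))) (at (xbar \<tau>, xbar T, \<tau>))"
      using has_derivative_compose[OF has_derivative_fst[OF has_derivative_snd[OF has_derivative_ident]] \<phi>'[of "fst (snd (xbar \<tau>, xbar T, \<tau>))"]]
      by (intro has_derivative_diff has_derivative_add has_derivative_const has_derivative_snd has_derivative_ident) simp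
    then show "(P_cost \<phi> T has_derivative (\<lambda>h. (0, grad \<phi> (xbar T), - 1) \<bullet> h)) (at (xbar \<tau>, xbar T, \<tau>))"
      unfolding eq by (rule has_derivative_eq_rhs) (auto simp: fun_eq_iff grad_inner[OF \<phi>'])
  qed
  define \<beta>' where "\<beta>' = (- p1 0, 0 :: real, - p2 \<tau>, \<beta>)"
  have "(1, \<beta>', M) \<in> Lagrange_multipliers f g c \<phi> T (P_ref_state T \<tau> xbar) (P_ref_control T \<tau> ubar)"
    unfolding Lagrange_multipliers_def mem_Collect_eq prod.case
  proof (intro conjI exI[of _ q])
    show "- q 0 = transposed_jacobian (\<lambda>y0. P_constr g y0 (P_ref_state T \<tau> xbar 1)) (P_ref_state T \<tau> xbar 0) \<beta>'"
      unfolding J0 q01 by (simp add: \<beta>'_def)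
    show "q 1 = transposed_jacobian (\<lambda>y1. P_constr g (P_ref_state T \<tau> xbar 0) y1) (P_ref_state T \<tau> xbar 1) \<beta>'
              + 1 *\<^sub>R grad (P_cost \<phi> T) (P_ref_state T \<tau> xbar 1)"
      unfolding J1 q01 cost by (simp add: \<beta>'_def ends(1,2))
    show "case \<beta>' of (\<beta>1, \<beta>2, \<beta>3, \<beta>4) \<Rightarrow> \<beta>2 = 0" by (simp add: \<beta>'_def)
    show "AE s in lebesgue_on {0..1}. (\<forall>i. 0 \<le> fst (M s) $ i \<and> 0 \<le> snd (M s) $ i) \<and>
        fst (M s) \<bullet> c (fst (P_ref_control T \<tau> ubar s)) + snd (M s) \<bullet> c (snd (P_ref_control T \<tau> ubar s)) = 0"
      by (rule compl)
  qed (simp_all add: M_Linf ode station)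
  then show ?thesis by blast
qed

section \<open>Regularity facts for the data of the theorem\<close>

lemma C1_funD:
  assumes "C1_fun f"
  obtains f' where "\<And>x. (f has_derivative blinfun_apply (f' x)) (at x)" "continuous_on UNIV f'"
  using assms unfolding C1_fun_def by blast

lemma C1_fun_continuous: "C1_fun f \<Longrightarrow> continuous_on UNIV f"
  unfolding C1_fun_def by (meson continuous_at_imp_continuous_on has_derivative_continuous)

lemma C2_imp_C1: "C2_fun f \<Longrightarrow> C1_fun f"
  unfolding C2_fun_def by (subst C1_fun_def) (blast intro: C1_fun_continuous)

lemma abs_continuous_imp_continuous_on:
  assumes "abs_continuous a b x"
  shows "continuous_on {a..b} x"
  unfolding continuous_on_iff
proof (intro ballI allI impI)
  fix t e :: real assume t: "t \<in> {a..b}" and e: "0 < e"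
  obtain d where d: "d > 0" "\<And>D S. D division_of S \<Longrightarrow> S \<subseteq> {a..b} \<Longrightarrow> (\<Sum>k\<in>D. Sup k - Inf k) < d \<Longrightarrow>
      (\<Sum>k\<in>D. norm (x (Sup k) - x (Inf k))) < e"
    using assms e unfolding abs_continuous_def by metis
  have *: "norm (x v - x u) < e" if "u \<in> {a..b}" "v \<in> {a..b}" "u \<le> v" "v - u < d" for u v
  proof -
    have "{cbox u v} division_of cbox u v" by (rule division_of_self) (use that in simp)
    from d(2)[OF this] that show ?thesis by simp
  qed
  show "\<exists>d>0. \<forall>s\<in>{a..b}. dist s t < d \<longrightarrow> dist (x s) (x t) < e"
  proof (intro exI[of _ d] conjI d(1) ballI impI)
    fix s assume s: "s \<in> {a..b}" "dist s t < d"
    show "dist (x s) (x t) < e"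
    proof (cases "s \<le> t")
      case True
      then show ?thesis using *[OF s(1) t] s by (simp add: dist_norm norm_minus_commute)
    next
      case False
      then show ?thesis using *[OF t s(1)] s by (simp add: dist_norm)
    qed
  qed
qed

lemma measurable_lebesgue_modify:
  assumes u: "u \<in> borel_measurable (lebesgue_on {a..b::real})" and N: "negligible N"
  shows "(\<lambda>t. if t \<in> N then k else u t) \<in> borel_measurable (lebesgue_on {a..b})"
proof (rule measurable_If_set)
  have "N \<inter> {a..b} \<in> sets lebesgue"
    by (rule sets.Int[OF negligible_imp_sets[OF N]]) simp
  then show "N \<inter> space (lebesgue_on {a..b}) \<in> sets (lebesgue_on {a..b})"
    by (simp add: sets_restrict_space_iff)
qed (use u in simp_all)

lemma no_sign_change:
  fixes h :: "real \<Rightarrow> real"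
  assumes "continuous_on S h" "connected S" "\<And>t. t \<in> S \<Longrightarrow> h t \<noteq> 0" "s \<in> S" "h s < 0" "t \<in> S"
  shows "h t < 0"
proof (rule ccontr)
  assume "\<not> h t < 0"
  moreover have "connected (h ` S)" using assms by (intro connected_continuous_image)
  ultimately have "0 \<in> h ` S"
    using assms(4-6) connectedD_interval[of "h ` S" "h s" "h t" 0] by auto
  then show False using assms(3) by auto
qed

theorem lemma4p1:
  fixes f :: "real^'n \<Rightarrow> real^'m \<Rightarrow> real^'n"
    and g :: "real^'n \<Rightarrow> real"
    and c :: "real^'m \<Rightarrow> real^'l"
    and \<phi> :: "real^'n \<Rightarrow> real"
    and K :: "(real^'n) set"
    and U :: "(real^'m) set"
    and T c1 c2 \<epsilon> \<delta> \<tau> :: real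
    and x0 :: "real^'n"
    and ubar :: "real \<Rightarrow> real^'m"
    and xbar :: "real \<Rightarrow> real^'n"
  assumes T: "T > 0"
    and U: "U \<noteq> {}" "closed U"
    and f_C2: "C2_fun (\<lambda>(x, u). f x u)"
    and growth: "c1 > 0" "c2 > 0" "\<And>x u. u \<in> U \<Longrightarrow> norm (f x u) \<le> c1 * norm x + c2"
    and velocities: "\<And>x. (\<lambda>u. f x u) ` U \<noteq> {}" "\<And>x. compact ((\<lambda>u. f x u) ` U)"
      "\<And>x. convex ((\<lambda>u. f x u) ` U)"
    and phi_C2: "C2_fun \<phi>"
    and K: "closed K" "interior K \<noteq> {}"
    and minimizer: "global_minimizer f \<phi> K U T x0 ubar xbar"
    and ubar_bounded: "ubar \<in> Linf 0 T"
    and c_C2: "C2_fun c"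
    and U_eq: "U = {u. \<forall>i. c u $ i \<le> 0}"
    and qualification: "\<epsilon> > 0" "\<delta> > 0"
      "AE t in lebesgue_on {0<..<T}. let I = {i. c (ubar t) $ i \<ge> - \<delta>} in
         \<forall>\<xi> :: real^'l. (\<forall>i. i \<notin> I \<longrightarrow> \<xi> $ i = 0) \<longrightarrow>
           \<epsilon> * norm \<xi> \<le> norm (\<Sum>i\<in>I. \<xi> $ i *\<^sub>R grad (\<lambda>u. c u $ i) (ubar t))"
    and g_C1: "C1_fun g"
    and K_eq: "K = {x. g x \<le> 0}"
    and tau: "\<tau> \<in> {0<..<T}" "transverse_exit_crossing f g K ubar xbar \<tau>"
      "\<And>t. t \<in> {0<..<T} \<Longrightarrow> crossing_time K xbar t \<Longrightarrow> t = \<tau>"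
      "\<And>t. t \<in> {0..T} - {\<tau>} \<Longrightarrow> g (xbar t) \<noteq> 0"
    and weak_min: "weak_minimum f g \<phi> U T x0 (P_ref_state T \<tau> xbar) (P_ref_control T \<tau> ubar)"
  shows "Lagrange_multipliers f g c \<phi> T (P_ref_state T \<tau> xbar) (P_ref_control T \<tau> ubar) \<noteq> {}"
proof -
  have tau_bounds: "0 < \<tau>" "\<tau> < T" using tau(1) by auto
  obtain f' where f': "\<And>z. ((\<lambda>(x, v). f x v) has_derivative blinfun_apply (f' z)) (at z)" "continuous_on UNIV f'"
    by (rule C1_funD[OF C2_imp_C1[OF f_C2]]) blast
  obtain c' where c': "\<And>v. (c has_derivative blinfun_apply (c' v)) (at v)" "continuous_on UNIV c'"
    by (rule C1_funD[OF C2_imp_C1[OF c_C2]]) blast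
  obtain \<phi>' where \<phi>': "\<And>x. (\<phi> has_derivative blinfun_apply (\<phi>' x)) (at x)" "continuous_on UNIV \<phi>'"
    by (rule C1_funD[OF C2_imp_C1[OF phi_C2]]) blast
  obtain g' where g': "\<And>x. (g has_derivative blinfun_apply (g' x)) (at x)" "continuous_on UNIV g'"
    by (rule C1_funD[OF g_C1]) blast
  have ubar: "ubar \<in> borel_measurable (lebesgue_on {0..T})" "\<And>t. t \<in> {0..T} \<Longrightarrow> ubar t \<in> U"
    and xbar0: "xbar 0 = x0" and xac: "abs_continuous 0 T xbar"
    and xae: "AE t in lebesgue_on {0..T}. (xbar has_vector_derivative f (xbar t) (ubar t)) (at t within {0..T})"
    and opt: "\<And>u x. u \<in> controls 0 T U \<Longrightarrow> state_of f T x0 u x \<Longrightarrow> time_crisis_cost \<phi> K T xbar \<le> time_crisis_cost \<phi> K T x"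
    using minimizer by (auto simp: global_minimizer_def controls_def state_of_def ode_solution_def)
  have gradc: "grad (\<lambda>u. c u $ i) v = riesz (\<lambda>b. c' v b $ i)" for i v
    by (rule grad_eq_riesz[OF bounded_linear.has_derivative[OF bounded_linear_vec_nth c'(1)]])
  \<comment> \<open>The qualification, with its sum extended to all indices; the coefficients vanish
    at the inactive ones.\<close>
  define Q where "Q = (\<lambda>v. \<forall>\<xi> :: real^'l. (\<forall>i. c v $ i < - \<delta> \<longrightarrow> \<xi> $ i = 0) \<longrightarrow>
      \<epsilon> * norm \<xi> \<le> norm (\<Sum>i\<in>UNIV. \<xi> $ i *\<^sub>R riesz (\<lambda>b. c' v b $ i)))"
  obtain B0 where B0: "AE t in lebesgue_on {0..T}. norm (ubar t) \<le> B0"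
    using Linf_essentially_bounded[OF ubar_bounded] by blast
  obtain N1 where N1: "negligible N1" "\<forall>t\<in>{0..T} - N1. (xbar has_vector_derivative f (xbar t) (ubar t)) (at t within {0..T})"
    using xae by (auto simp: AE_lebesgue_on_iff)
  obtain N2 where N2: "negligible N2" "\<forall>t\<in>{0..T} - N2. norm (ubar t) \<le> B0"
    using B0 by (auto simp: AE_lebesgue_on_iff)
  obtain N3 where N3: "negligible N3" "\<forall>t\<in>{0<..<T} - N3. let I = {i. c (ubar t) $ i \<ge> - \<delta>} in
         \<forall>\<xi> :: real^'l. (\<forall>i. i \<notin> I \<longrightarrow> \<xi> $ i = 0) \<longrightarrow>
           \<epsilon> * norm \<xi> \<le> norm (\<Sum>i\<in>I. \<xi> $ i *\<^sub>R grad (\<lambda>u. c u $ i) (ubar t))"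
    using qualification(3) by (subst (asm) AE_lebesgue_on_iff) auto
  \<comment> \<open>The end points are added because the qualification is given on the open interval
    only.\<close>
  define N where "N = N1 \<union> N2 \<union> N3 \<union> {0, T}"
  have N: "negligible N" unfolding N_def by (intro negligible_Un N1 N2 N3 negligible_finite) simp
  have Qbar: "Q (ubar t)" if t: "t \<in> {0..T} - N" for t
    unfolding Q_def
  proof (intro allI impI)
    fix \<xi> :: "real^'l" assume \<xi>: "\<forall>i. c (ubar t) $ i < - \<delta> \<longrightarrow> \<xi> $ i = 0"
    let ?I = "{i. c (ubar t) $ i \<ge> - \<delta>}"
    have "t \<in> {0<..<T} - N3" using t by (auto simp: N_def)
    then have "\<epsilon> * norm \<xi> \<le> norm (\<Sum>i\<in>?I. \<xi> $ i *\<^sub>R grad (\<lambda>u. c u $ i) (ubar t))"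
      using bspec[OF N3(2)] \<xi> unfolding Let_def by auto
    also have "(\<Sum>i\<in>?I. \<xi> $ i *\<^sub>R grad (\<lambda>u. c u $ i) (ubar t)) = (\<Sum>i\<in>UNIV. \<xi> $ i *\<^sub>R grad (\<lambda>u. c u $ i) (ubar t))"
      by (rule sum.mono_neutral_left) (use \<xi> in \<open>auto simp: not_le\<close>)
    finally show "\<epsilon> * norm \<xi> \<le> norm (\<Sum>i\<in>UNIV. \<xi> $ i *\<^sub>R riesz (\<lambda>b. c' (ubar t) b $ i))"
      by (simp only: gradc)
  qed
  \<comment> \<open>An interval of positive length contains a good time, whose control value can
    replace all bad ones.\<close>
  have "\<not> negligible {0..T}" using negligible_iff_measure0 T by (simp add: negligible_iff_measure)
  then have "\<not> {0..T} \<subseteq> N" using N negligible_subset by blast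
  then obtain ts where ts: "ts \<in> {0..T} - N" by blast
  \<comment> \<open>After a modification on a null set the almost everywhere hypotheses on the control hold everywhere.\<close>
  define u where "u = (\<lambda>t. if t \<in> N then ubar ts else ubar t)"
  have uN: "u t = ubar t" if "t \<notin> N" for t using that by (simp add: u_def)
  have u_cases: "\<exists>s\<in>{0..T} - N. u t = ubar s" if "t \<in> {0..T}" for t
    using that ts by (cases "t \<in> N") (auto simp: u_def)
  have um: "u \<in> borel_measurable (lebesgue_on {0..T})" unfolding u_def by (rule measurable_lebesgue_modify[OF ubar(1) N])
  have uB: "norm (u t) \<le> B0" if "t \<in> {0..T}" for t using u_cases[OF that] N2(2) by (auto simp: N_def)
  have uU: "u t \<in> U" if "t \<in> {0..T}" for t using u_cases[OF that] ubar(2) by auto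
  have uQ: "Q (u t)" if "t \<in> {0..T}" for t using u_cases[OF that] Qbar by auto
  have xc: "continuous_on {0..T} xbar" by (rule abs_continuous_imp_continuous_on[OF xac])
  obtain B1 where B1: "B1 > 0" "\<And>t. t \<in> {0..T} \<Longrightarrow> norm (xbar t) \<le> B1" by (rule continuous_on_Icc_bounded[OF xc]) blast
  define R where "R = max B0 B1"
  have xl: "lip_primitive 0 T (\<lambda>t. f (xbar t) (u t)) xbar"
  proof (rule abs_continuous_lip_primitive[OF xac N])
    fix t assume t: "t \<in> {0..T} - N"
    show "(xbar has_vector_derivative f (xbar t) (u t)) (at t within {0..T})"
      using N1(2) t uN[of t] by (auto simp: N_def)
    have "norm (f (xbar t) (u t)) \<le> c1 * norm (xbar t) + c2" by (rule growth(3)) (use uU t in auto)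
    also have "\<dots> \<le> c1 * B1 + c2" using B1(2)[of t] t growth(1) by (simp add: mult_left_mono)
    finally show "norm (f (xbar t) (u t)) \<le> c1 * B1 + c2" .
  qed
  interpret controlled_trajectory "\<lambda>(x, v). f x v" f' T R xbar u
  proof unfold_locales
    show "lip_primitive 0 T (\<lambda>t. case (xbar t, u t) of (x, v) \<Rightarrow> f x v) xbar" using xl by simp
    show "norm (u t) \<le> R" if "t \<in> {0..T}" for t using uB[OF that] by (simp add: R_def)
    show "norm (xbar t) \<le> R" if "t \<in> {0..T}" for t using B1(2)[OF that] by (simp add: R_def)
  qed (use T f' um in auto)
  have g_cont: "continuous_on UNIV g" by (rule C1_fun_continuous[OF g_C1])
  have gx_cont: "continuous_on S (\<lambda>t. g (xbar t))" if "S \<subseteq> {0..T}" for S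
    by (rule continuous_on_compose2[OF g_cont continuous_on_subset[OF xc that]]) simp
  have g0: "g (xbar \<tau>) = 0"
    using weak_min by (simp add: weak_minimum_def P_constr_def P_target_def P_ref_state_def time_change_def)
  obtain \<eta> ul where \<eta>: "\<eta> > 0" "\<forall>t\<in>{\<tau>-\<eta><..\<tau>}. xbar t \<in> K" "\<forall>t\<in>{\<tau><..<\<tau>+\<eta>}. xbar t \<notin> K"
    and ul: "(ubar \<longlongrightarrow> ul) (at_left \<tau>)" "f (xbar \<tau>) ul \<bullet> grad g (xbar \<tau>) \<noteq> 0"
    using tau(2) unfolding transverse_exit_crossing_def exit_crossing_def by blast
  \<comment> \<open>The crossing fixes the sign of g just before \<tau>. As g does not vanish
    elsewhere along the reference, connectedness spreads this sign to all earlier times;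
    \<open>pos\<close> does the same after \<tau>.\<close>
  have neg: "g (xbar t) < 0" if t: "t \<in> {0..<\<tau>}" for t
  proof -
    define s where "s = max (\<tau> / 2) (\<tau> - \<eta> / 2)"
    have s: "s \<in> {0..<\<tau>}" "s \<in> {\<tau>-\<eta><..\<tau>}" using tau_bounds \<eta>(1) by (auto simp: s_def max_def)
    have nz: "g (xbar r) \<noteq> 0" if "r \<in> {0..<\<tau>}" for r using tau(4)[of r] that tau_bounds by auto
    have "g (xbar s) < 0" using \<eta>(2) s(2) nz[OF s(1)] unfolding K_eq by force
    moreover have "{0..<\<tau>} \<subseteq> {0..T}" using tau_bounds by auto
    ultimately show ?thesis
      using no_sign_change[of "{0..<\<tau>}" "\<lambda>t. g (xbar t)" s t] gx_cont nz s(1) t by simp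
  qed
  have pos: "g (xbar t) > 0" if t: "t \<in> {\<tau><..T}" for t
  proof -
    define s where "s = min ((\<tau> + T) / 2) (\<tau> + \<eta> / 2)"
    have s: "s \<in> {\<tau><..T}" "s \<in> {\<tau><..<\<tau>+\<eta>}" using tau_bounds \<eta>(1) by (auto simp: s_def min_def field_simps)
    have nz: "- g (xbar r) \<noteq> 0" if "r \<in> {\<tau><..T}" for r using tau(4)[of r] that tau_bounds by auto
    have "\<not> g (xbar s) \<le> 0" using \<eta>(3) s(2) unfolding K_eq by blast
    then have "- g (xbar s) < 0" by simp
    moreover have "{\<tau><..T} \<subseteq> {0..T}" using tau_bounds by auto
    ultimately have "- g (xbar t) < 0"
      using no_sign_change[of "{\<tau><..T}" "\<lambda>t. - g (xbar t)" s t] continuous_on_minus[OF gx_cont] nz s(1) t by simp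
    then show ?thesis by simp
  qed
  have Jbar: "time_crisis_cost \<phi> K T xbar = \<phi> (xbar T) + (T - \<tau>)"
  proof -
    have "(LINT t|lebesgue_on {0..T}. indicat_real (- K) (xbar t)) = T - \<tau>"
    proof (rule crossing_cost_eq)
      show "xbar t \<in> K" if "t \<in> {0..\<tau>}" for t
        using neg[of t] g0 that unfolding K_eq by (cases "t = \<tau>") auto
      show "xbar t \<notin> K" if "t \<in> {\<tau><..T}" for t using pos[OF that] unfolding K_eq by auto
    qed (use tau_bounds in auto)
    then show ?thesis by (simp add: time_crisis_cost_def)
  qed
  have g'grad: "grad g (xbar \<tau>) \<bullet> h = g' (xbar \<tau>) h" for h by (rule grad_inner[OF g'(1)])
  interpret crossing_minimizer f f' T R xbar u g g' \<phi> U \<tau> ul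
  proof unfold_locales
    show "\<exists>b<\<tau>. \<exists>N. negligible N \<and> (\<forall>t\<in>{b<..<\<tau>} - N. norm (u t - ul) < e)" if e: "e > 0" for e
    proof -
      have "\<forall>\<^sub>F t in at_left \<tau>. dist (ubar t) ul < e" using tendstoD[OF ul(1) e] .
      then obtain b where b: "b < \<tau>" "\<And>t. b < t \<Longrightarrow> t < \<tau> \<Longrightarrow> dist (ubar t) ul < e"
        unfolding eventually_at_left_field by blast
      have "\<forall>t\<in>{b<..<\<tau>} - N. norm (u t - ul) < e"
        using b(2) by (auto simp: uN dist_norm)
      then show ?thesis using b(1) N by blast
    qed
    show "g' (xbar \<tau>) (f (xbar \<tau>) ul) \<noteq> 0" using ul(2) g'grad[of "f (xbar \<tau>) ul"] by (simp add: inner_commute)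
    show "\<phi> (xbar T) + (T - \<tau>) \<le> time_crisis_cost \<phi> {x. g x \<le> 0} T x"
      if "v \<in> controls 0 T U" "state_of f T (xbar 0) v x" for v x
      using opt[of v x] that unfolding Jbar xbar0 K_eq[symmetric] by simp
  qed (use g' tau(1) g0 neg in auto)
  obtain \<Lambda> where \<Lambda>: "\<Lambda> \<ge> 0" "\<forall>\<theta> w C K. w \<in> borel_measurable (lebesgue_on {0..T}) \<and> (\<forall>t\<in>{0..T}. norm (w t) \<le> C) \<and> K > 0 \<longrightarrow>
      (\<exists>e>0. \<forall>h x. 0 < h \<and> h < e \<and> variation (dilation T \<tau> \<theta>) w h x \<and> (\<forall>t\<in>{0..T}. norm (x t - xbar t) \<le> K * h) \<and>
        (\<forall>t\<in>{0..T}. u t + h *\<^sub>R w t \<in> U) \<longrightarrow>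
        \<phi> (xbar T) \<le> \<phi> (x T) - h * \<theta> + \<Lambda> * max 0 (g (x \<tau>)))"
    using penalized_minimal by blast
  interpret penalized_extremal "\<lambda>(x, v). f x v" f' T R xbar u c c' \<delta> \<epsilon> \<tau> \<Lambda> \<phi> g "grad \<phi> (xbar T)" "grad g (xbar \<tau>)"
  proof unfold_locales
    show "c (u t) $ i \<le> 0" if "t \<in> {0..T}" for t i using uU[OF that] unfolding U_eq by blast
    show "\<epsilon> * norm \<xi> \<le> norm (\<Sum>i\<in>UNIV. \<xi> $ i *\<^sub>R riesz (\<lambda>b. c' (u t) b $ i))"
      if "t \<in> {0..T}" "\<And>i. c (u t) $ i < - \<delta> \<Longrightarrow> \<xi> $ i = 0" for t and \<xi> :: "real^'l"
      using uQ[OF that(1)] that(2) unfolding Q_def by blast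
    have "(\<lambda>h. grad \<phi> (xbar T) \<bullet> h) = blinfun_apply (\<phi>' (xbar T))" by (rule ext) (rule grad_inner[OF \<phi>'(1)])
    then show "(\<phi> has_derivative (\<lambda>h. grad \<phi> (xbar T) \<bullet> h)) (at (xbar T))" using \<phi>'(1) by simp
    have "(\<lambda>h. grad g (xbar \<tau>) \<bullet> h) = blinfun_apply (g' (xbar \<tau>))" by (rule ext) (rule g'grad)
    then show "(g has_derivative (\<lambda>h. grad g (xbar \<tau>) \<bullet> h)) (at (xbar \<tau>))" using g'(1) by simp
    show "\<exists>e>0. \<forall>h x. 0 < h \<and> h < e \<and> variation (dilation T \<tau> \<theta>) w h x \<and> (\<forall>t\<in>{0..T}. norm (x t - xbar t) \<le> K * h) \<and>
        (\<forall>t\<in>{0..T}. \<forall>i. c (u t + h *\<^sub>R w t) $ i \<le> 0) \<longrightarrow>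
        \<phi> (xbar T) \<le> \<phi> (x T) - h * \<theta> + \<Lambda> * max 0 (g (x \<tau>))"
      if "w \<in> borel_measurable (lebesgue_on {0..T})" "\<And>t. t \<in> {0..T} \<Longrightarrow> norm (w t) \<le> C" "K > 0" for \<theta> w C K
      using \<Lambda>(2)[rule_format, of w C K \<theta>] that unfolding U_eq mem_Collect_eq by blast
  qed (use c' qualification tau(1) g0 \<Lambda>(1) in auto)
  obtain p1 p2 \<beta> I1 I2 \<mu> B M where p:
    "lip_primitive 0 T (\<lambda>t. - adj t (p2 t)) p2" "p2 T = grad \<phi> (xbar T)"
    "lip_primitive 0 \<tau> (\<lambda>t. - adj t (p1 t)) p1" "p1 \<tau> = p2 \<tau> + \<beta> *\<^sub>R grad g (xbar \<tau>)"
    "((\<lambda>t. p1 t \<bullet> f (xbar t) (u t)) has_integral I1) {0..\<tau>}"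
    "((\<lambda>t. p2 t \<bullet> f (xbar t) (u t)) has_integral I2) {\<tau>..T}" "I1 / \<tau> - I2 / (T - \<tau>) = 1"
    "\<forall>i. \<mu> i \<in> borel_measurable (lebesgue_on {0..T})" "\<forall>i. \<forall>t\<in>{0..T}. \<bar>\<mu> i t\<bar> \<le> B"
    "negligible M" "\<forall>t\<in>{0..T} - M. (\<forall>i. 0 \<le> \<mu> i t \<and> \<mu> i t * c (u t) $ i = 0) \<and>
      (\<forall>h. (if t \<le> \<tau> then p1 t else p2 t) \<bullet> f' (xbar t, u t) (0, h) + (\<Sum>i\<in>UNIV. \<mu> i t * c' (u t) h $ i) = 0)"
    using normal_multiplier unfolding prod.case by (elim exE conjE)
  have fb: "norm (f (xbar t) (u t)) \<le> c1 * B1 + c2" if t: "t \<in> {0..T}" for t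
    using order_trans[OF growth(3)[OF uU[OF t], of "xbar t"]] mult_left_mono[OF B1(2)[OF t], of c1] growth(1) by simp
  \<comment> \<open>Returns from the modified control to the given one; rates may change on the null
    set \<open>N\<close>.\<close>
  have swap: "lip_primitive a b r' x" if "lip_primitive a b r x" "\<And>t. t \<notin> N \<Longrightarrow> r t = r' t" for a b r r' and x :: "real \<Rightarrow> 'z::euclidean_space"
    by (rule lip_primitive_cong[OF that(1) N that(2)]) auto
  have Lint: "lip_primitive a b (\<lambda>t. p t \<bullet> f (xbar t) (ubar t)) (\<lambda>t. integral {a..t} (\<lambda>t. p t \<bullet> f (xbar t) (u t)))"
    if ab: "0 \<le> a" "b \<le> T" and i: "((\<lambda>t. p t \<bullet> f (xbar t) (u t)) has_integral I) {a..b}" and pc: "continuous_on {a..b} p" for a b I p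
  proof (rule swap)
    obtain P where P: "P > 0" "\<And>t. t \<in> {a..b} \<Longrightarrow> norm (p t) \<le> P" by (rule continuous_on_Icc_bounded[OF pc]) blast
    show "lip_primitive a b (\<lambda>t. p t \<bullet> f (xbar t) (u t)) (\<lambda>t. integral {a..t} (\<lambda>t. p t \<bullet> f (xbar t) (u t)))"
    proof (rule integral_lip_primitive[OF has_integral_integrable[OF i]])
      fix t assume t: "t \<in> {a..b}"
      then have tT: "t \<in> {0..T}" using ab by auto
      have "norm (p t \<bullet> f (xbar t) (u t)) \<le> norm (p t) * norm (f (xbar t) (u t))" using Cauchy_Schwarz_ineq2 by simp
      also have "\<dots> \<le> P * (c1 * B1 + c2)" using P(1) by (intro mult_mono P(2)[OF t] fb[OF tT]) auto
      finally show "norm (p t \<bullet> f (xbar t) (u t)) \<le> P * (c1 * B1 + c2)" .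
    qed simp
    show "p t \<bullet> f (xbar t) (u t) = p t \<bullet> f (xbar t) (ubar t)" if "t \<notin> N" for t by (simp add: uN[OF that])
  qed
  have p2': "lip_primitive \<tau> T (\<lambda>t. - adj t (p2 t)) p2"
    by (rule lip_primitive_subinterval[OF p(1)]) (use tau_bounds in auto)
  show ?thesis
  proof (rule Lagrange_multipliers_nonempty[OF tau_bounds f'(1) g'(1) \<phi>'(1) c'(1)])
    show "lip_primitive 0 \<tau> (\<lambda>t. - riesz (\<lambda>b. p1 t \<bullet> f' (xbar t, ubar t) (b, 0))) p1"
      by (rule swap[OF p(3)]) (simp add: adj_def uN)
    show "lip_primitive \<tau> T (\<lambda>t. - riesz (\<lambda>b. p2 t \<bullet> f' (xbar t, ubar t) (b, 0))) p2"
      by (rule swap[OF p2']) (simp add: adj_def uN)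
    show "lip_primitive 0 \<tau> (\<lambda>t. p1 t \<bullet> f (xbar t) (ubar t)) (\<lambda>t. integral {0..t} (\<lambda>t. p1 t \<bullet> f (xbar t) (u t)))"
      by (rule Lint[OF _ _ p(5) lip_primitive_continuous[OF p(3)]]) (use tau_bounds in auto)
    show "lip_primitive \<tau> T (\<lambda>t. p2 t \<bullet> f (xbar t) (ubar t)) (\<lambda>t. integral {\<tau>..t} (\<lambda>t. p2 t \<bullet> f (xbar t) (u t)))"
      by (rule Lint[OF _ _ p(6) lip_primitive_continuous[OF p2']]) (use tau_bounds in auto)
    show "integral {0..\<tau>} (\<lambda>t. p1 t \<bullet> f (xbar t) (u t)) / \<tau> - integral {\<tau>..T} (\<lambda>t. p2 t \<bullet> f (xbar t) (u t)) / (T - \<tau>) = 1"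
      unfolding integral_unique[OF p(5)] integral_unique[OF p(6)] by (rule p(7))
    show "negligible (M \<union> N)" by (rule negligible_Un[OF p(10) N])
    show "p2 T = grad \<phi> (xbar T)" "p1 \<tau> = p2 \<tau> + \<beta> *\<^sub>R grad g (xbar \<tau>)" by (rule p(2), rule p(4))
    show "\<mu> i \<in> borel_measurable (lebesgue_on {0..T})" for i using p(8) by blast
    show "\<bar>\<mu> i t\<bar> \<le> B" if "t \<in> {0..T}" for i t using p(9) that by blast
    fix t assume t: "t \<in> {0..T} - (M \<union> N)"
    then have tM: "t \<in> {0..T} - M" and ut: "u t = ubar t" using uN by auto
    note pM = bspec[OF p(11) tM, unfolded ut]
    show "0 \<le> \<mu> i t" "\<mu> i t * c (ubar t) $ i = 0" for i using pM by blast+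
    show "(if t \<le> \<tau> then p1 t else p2 t) \<bullet> f' (xbar t, ubar t) (0, h) + (\<Sum>i\<in>UNIV. \<mu> i t * c' (ubar t) h $ i) = 0" for h
      using pM by blast
  qed simp_all
qed

end
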